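(* Let $n,d,m\ge 1$, let $a_1,\dots,a_m\in\mathbb{R}[x]_d$, $b=(b_1,\dots,b_m)\in\mathbb{R}^m$, $d_1=2\lceil d/2\rceil$, and let $K=\{x\in\mathbb{R}^n: c_i(x)=0\ (i\in\mathcal{E}),\ c_j(x)\ge 0\ (j\in\mathcal{I})\}$, where $\mathcal{E},\mathcal{I}$ are disjoint finite label sets and all $c_i,c_j\in\mathbb{R}[x]$. Write $c_{eq}=(c_i)_{i\in\mathcal{E}}$, $c_{in}=(c_j)_{j\in\mathcal{I}}$. Let $R\in\Sigma[x]_{d_1}$. Consider the problems $$(P)\qquad \min\ \langle R,y\rangle\quad\text{s.t.}\quad \langle a_i,y\rangle=b_i\ (i=1,\dots,m),\quad y\in\mathscr{R}_{d_1}(K),$$ $$(D)\qquad \max\ b^T\lambda\quad\text{s.t.}\quad R-\sum_{i=1}^m\lambda_i a_i\in\mathscr{P}_{d_1}(K),$$ and, for relaxation orders $k$, the moment relaxation $$(P_k)\qquad \begin{array}{cl}\min & \langle R,w\rangle\\ \text{s.t.} & \langle a_i,w\rangle=b_i\ (i=1,\dots,m),\\ & L^{(k)}_{c_i}[w]=0\ (i\in\mathcal{E}),\quad L^{(k)}_{c_j}[w]\succeq 0\ (j\in\mathcal{I}),\\ & M_k[w]\succeq 0,\quad w\in\mathbb{R}^{\mathbb{N}^n_{2k}},\end{array}$$ and the SOS relaxation $$(D_k)\qquad \max\ b^T\lambda\quad\text{s.t.}\quad R-\sum_{i=1}^m\lambda_i a_i\in \mathrm{Ideal}[c_{eq}]_{2k}+\mathrm{QM}[c_{in}]_{2k}.$$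 Let $\phi^*,\phi_k,\psi_k$ be the optimal values of $(P),(P_k),(D_k)$, respectively. Suppose $R$ is generic in $\Sigma[x]_{d_1}$, $(P)$ is feasible, and $\mathrm{Ideal}[c_{eq}]+\mathrm{QM}[c_{in}]$ is archimedean. Suppose $\lambda^*=(\lambda_1^*,\dots,\lambda_m^* )$ is a maximizer of $(D)$ and $w^{(k)}$ denotes a minimizer of $(P_k)$. Then: (i) If $w^{(k)}_0=0$, then $w^{(k)}$ has a flat truncation. (ii) Suppose LICQC, SCC and SOSC all hold at every minimizer of the polynomial optimization problem $$\min_{x\in\mathbb{R}^n}\ R(x)-\sum_{i=1}^m\lambda_i^*a_i(x)\quad\text{s.t.}\quad c_i(x)=0\ (i\in\mathcal{E}),\quad c_j(x)\ge 0\ (j\in\mathcal{I}).$$ Then, for all sufficiently large $k$, if $w^{(k)}_0\ne 0$, it holds that $\phi_k=\psi_k=\phi^*$ and every minimizer of $(P_k)$ has a flat truncation.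
   Context: $\mathbb{R}[x]=\mathbb{R}[x_1,\dots,x_n]$; $\mathbb{R}[x]_d$ is the set of polynomials of degree at most $d$; $\mathbb{N}^n_d=\{\alpha\in\mathbb{N}^n:|\alpha|\le d\}$. $\Sigma[x]$ is the cone of sums of squares of polynomials, $\Sigma[x]_d=\Sigma[x]\cap\mathbb{R}[x]_d$. A truncated multi-sequence (tms) of degree $d$ is a vector $y=(y_\alpha)_{\alpha\in\mathbb{N}^n_d}\in\mathbb{R}^{\mathbb{N}^n_d}$; $y_0$ is its entry at $\alpha=0$. For $p=\sum_\alpha p_\alpha x^\alpha\in\mathbb{R}[x]_d$, $\langle p,y\rangle=\sum_\alpha p_\alpha y_\alpha$. $\mathscr{R}_{d_1}(K)$ is the set of $y\in\mathbb{R}^{\mathbb{N}^n_{d_1}}$ for which there is a (nonnegative) Borel measure $\mu$ supported in $K$ with $y_\alpha=\int x^\alpha d\mu$ for all $\alpha\in\mathbb{N}^n_{d_1}$. $\mathscr{P}_{d_1}(K)=\{f\in\mathbb{R}[x]_{d_1}: f\ge 0\text{ on }K\}$. For a tuple $h=(h_1,\dots,h_{m_1})$, $\mathrm{Ideal}[h]=\sum_i h_i\mathbb{R}[x]$ and $\mathrm{Ideal}[h]_k=\sum_i h_i\,\mathbb{R}[x]_{k-\deg(h_i)}$. For $g=(g_1,\dots,g_{m_2})$, $\mathrm{QM}[g]=\Sigma[x]+\sum_j g_j\Sigma[x]$ and $\mathrm{QM}[g]_k=\Sigma[x]_k+\sum_j g_j\,\Sigma[x]_{k-\deg(g_j)}$.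 $\mathrm{Ideal}[h]+\mathrm{QM}[g]$ is archimedean if it contains $N-\|x\|^2$ for some scalar $N>0$. For $q\in\mathbb{R}[x]_{2k}$ and $y\in\mathbb{R}^{\mathbb{N}^n_{2k}}$, the $k$th order localizing matrix $L_q^{(k)}[y]$ is the symmetric matrix with $\langle qp^2,y\rangle=\mathrm{vec}(p)^T L_q^{(k)}[y]\,\mathrm{vec}(p)$ for all $p\in\mathbb{R}[x]_{k-\lceil\deg(q)/2\rceil}$, where $\mathrm{vec}(p)$ is the coefficient vector of $p$ in graded lexicographical order. $M_k[y]=L_1^{(k)}[y]$ is the moment matrix. Relaxation orders satisfy $k\ge d_1/2$ (and $2k\ge\deg(c_i)$ for all $i\in\mathcal{E}\cup\mathcal{I}$, so that the localizing matrices are defined). Let $d_K=\max_{i\in\mathcal{E}\cup\mathcal{I}}\{1,\lceil\deg(c_i)/2\rceil\}$. A tms $w\in\mathbb{R}^{\mathbb{N}^n_{2k}}$ has a flat truncation if there is an integer $t\in[d_K,k]$ with $\mathrm{rank}\,M_{t-d_K}[w]=\mathrm{rank}\,M_t[w]$. Optimality conditions for $\min F(x)$ s.t. $c_i(x)=0\ (i\in\mathcal{E})$, $c_j(x)\ge0\ (j\in\mathcal{I})$ at a minimizer $u$, with active set $J(u)=\{j\in\mathcal{I}:c_j(u)=0\}$: LICQC (linear independence constraint qualification) holds if the gradients $\nabla c_i(u)$, $i\in\mathcal{E}\cup J(u)$, are linearly independent; there then exist unique Lagrange multipliers $\nu_i$ with $\nabla F(u)=\sum_{i\in\mathcal{E}\cup\mathcal{I}}\nu_i\nabla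 c_i(u)$, $\nu_j\ge0$ and $\nu_jc_j(u)=0$ for $j\in\mathcal{I}$. SCC (strict complementarity) holds if $\nu_j+c_j(u)>0$ for all $j\in\mathcal{I}$. SOSC (second order sufficient condition) holds if $v^T\big(\nabla^2F(u)-\sum_{i\in\mathcal{E}\cup\mathcal{I}}\nu_i\nabla^2c_i(u)\big)v>0$ for all $0\ne v\in\mathbb{R}^n$ with $v^T\nabla c_i(u)=0$ for all $i\in\mathcal{E}\cup J(u)$. "Generic in $\Sigma[x]_{d_1}$" means: the assertion holds for all $R\in\Sigma[x]_{d_1}$ outside a subset of Lebesgue measure zero in $\mathbb{R}[x]_{d_1}$ (for the given data $K,a_i,b$).
   Formalization: Part (i) is stated only for relaxation orders k > d_K; at k = d_K it is false, e.g. K = [-1,1] with constraints 1-x, 1+x, a_1 = x^2, b_1 = 1, k = 1: for an open set of R the minimizer is w = (0,0,1), which has no flat truncation. *)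

theory Defs
  imports
    "HOL-Analysis.Analysis"
    "HOL-Library.Poly_Mapping"
    "Jordan_Normal_Form.DL_Rank"
begin

(* Matrices of varying size are those of Jordan_Normal_Form; on its vectors we write vec_index,
   so that $ always denotes the components of a point of real^'n. The bullet is their scalar
   product; on real^'n we write inner. *)
no_notation Matrix.vec_index (infixl "$" 100)
no_notation inner (infix "\<bullet>" 70)

abbreviation "lookup \<equiv> Poly_Mapping.lookup"
abbreviation "keys \<equiv> Poly_Mapping.keys"

section \<open>Polynomials in n = CARD('n) ordered variables\<close>

type_synonym 'n expo = "'n \<Rightarrow>\<^sub>0 nat"
type_synonym 'n mpoly = "'n expo \<Rightarrow>\<^sub>0 real"

definition mdeg :: "'n::finite expo \<Rightarrow> nat" where
  "mdeg \<alpha> = (\<Sum>i\<in>UNIV. lookup \<alpha> i)"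

definition expos :: "nat \<Rightarrow> 'n::finite expo set" where
  "expos d = {\<alpha>. mdeg \<alpha> \<le> d}"

(* The zero polynomial gets degree 0. *)
definition tdeg :: "'n::finite mpoly \<Rightarrow> nat" where
  "tdeg p = Max (insert 0 (mdeg ` keys p))"

definition polys :: "nat \<Rightarrow> 'n::finite mpoly set" where
  "polys d = {p. keys p \<subseteq> expos d}"

definition monom_eval :: "'n::finite expo \<Rightarrow> real ^ 'n \<Rightarrow> real" where
  "monom_eval \<alpha> x = (\<Prod>i\<in>UNIV. (x $ i) ^ lookup \<alpha> i)"

definition peval :: "'n::finite mpoly \<Rightarrow> real ^ 'n \<Rightarrow> real" where
  "peval p x = (\<Sum>\<alpha>\<in>keys p. lookup p \<alpha> * monom_eval \<alpha> x)"

definition Const :: "real \<Rightarrow> 'n::finite mpoly" where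
  "Const r = Poly_Mapping.single 0 r"

definition Var :: "'n::finite \<Rightarrow> 'n mpoly" where
  "Var i = Poly_Mapping.single (Poly_Mapping.single i 1) 1"

definition ceil_half :: "nat \<Rightarrow> nat" where
  "ceil_half n = nat \<lceil>real n / 2\<rceil>"

definition SOS :: "'n::finite mpoly set" where
  "SOS = {p. \<exists>(N::nat) q. p = (\<Sum>i<N. q i ^ 2)}"

definition SOS_le :: "nat \<Rightarrow> 'n::finite mpoly set" where
  "SOS_le d = SOS \<inter> polys d"

section \<open>Ideals and quadratic modules of a family h indexed by a finite set\<close>

definition Ideal :: "('l \<Rightarrow> 'n::finite mpoly) \<Rightarrow> 'l set \<Rightarrow> 'n mpoly set" where
  "Ideal h E = {(\<Sum>i\<in>E. h i * p i) | p. True}"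

(* The disjunction avoids the truncated difference k - tdeg (h i): a multiplier of negative
   degree bound has to be 0. *)
definition Ideal_le :: "('l \<Rightarrow> 'n::finite mpoly) \<Rightarrow> 'l set \<Rightarrow> nat \<Rightarrow> 'n mpoly set" where
  "Ideal_le h E k =
     {(\<Sum>i\<in>E. h i * p i) | p. \<forall>i\<in>E. p i = 0 \<or> tdeg (h i) + tdeg (p i) \<le> k}"

definition QM :: "('l \<Rightarrow> 'n::finite mpoly) \<Rightarrow> 'l set \<Rightarrow> 'n mpoly set" where
  "QM g I = {s0 + (\<Sum>j\<in>I. g j * s j) | s0 s. s0 \<in> SOS \<and> (\<forall>j\<in>I. s j \<in> SOS)}"

definition QM_le :: "('l \<Rightarrow> 'n::finite mpoly) \<Rightarrow> 'l set \<Rightarrow> nat \<Rightarrow> 'n mpoly set" where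
  "QM_le g I k = {s0 + (\<Sum>j\<in>I. g j * s j) | s0 s.
     s0 \<in> SOS_le k \<and> (\<forall>j\<in>I. s j \<in> SOS \<and> (s j = 0 \<or> tdeg (g j) + tdeg (s j) \<le> k))}"

definition archimedean :: "('l \<Rightarrow> 'n::finite mpoly) \<Rightarrow> 'l set \<Rightarrow> 'l set \<Rightarrow> bool" where
  "archimedean c E I \<longleftrightarrow>
     (\<exists>N>0. Const N - (\<Sum>i\<in>UNIV. Var i ^ 2) \<in> {p + q | p q. p \<in> Ideal c E \<and> q \<in> QM c I})"

section \<open>Truncated multi-sequences, moments and nonnegative polynomials\<close>

definition tms :: "nat \<Rightarrow> ('n::finite expo \<Rightarrow> real) set" where
  "tms d = (expos d \<rightarrow>\<^sub>E UNIV)"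

definition pairing :: "'n::finite mpoly \<Rightarrow> ('n expo \<Rightarrow> real) \<Rightarrow> real" where
  "pairing p y = (\<Sum>\<alpha>\<in>keys p. lookup p \<alpha> * y \<alpha>)"

definition semialg :: "('l \<Rightarrow> 'n::finite mpoly) \<Rightarrow> 'l set \<Rightarrow> 'l set \<Rightarrow> (real ^ 'n) set" where
  "semialg c E I = {x. (\<forall>i\<in>E. peval (c i) x = 0) \<and> (\<forall>j\<in>I. peval (c j) x \<ge> 0)}"

(* The sets K of interest (semialg) are closed, so mu is supported in K iff its complement is null. *)
definition moment_cone :: "nat \<Rightarrow> (real ^ 'n::finite) set \<Rightarrow> ('n expo \<Rightarrow> real) set" where
  "moment_cone d K = {y \<in> tms d. \<exists>\<mu> :: (real ^ 'n) measure.
     sets \<mu> = sets borel \<and> (AE x in \<mu>. x \<in> K) \<and>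
     (\<forall>\<alpha>\<in>expos d. integrable \<mu> (monom_eval \<alpha>) \<and> y \<alpha> = (LINT x|\<mu>. monom_eval \<alpha> x))}"

definition nonneg_polys :: "nat \<Rightarrow> (real ^ 'n::finite) set \<Rightarrow> 'n mpoly set" where
  "nonneg_polys d K = {f \<in> polys d. \<forall>x\<in>K. peval f x \<ge> 0}"

(* polys d is identified with the space of coefficient vectors indexed by expos d, which carries
   the product Lebesgue measure. *)
definition generic_in_SOS_le :: "nat \<Rightarrow> ('n::finite mpoly \<Rightarrow> bool) \<Rightarrow> bool" where
  "generic_in_SOS_le d P \<longleftrightarrow>
     (\<exists>N \<in> null_sets (Pi\<^sub>M (expos d) (\<lambda>_. lborel)).
        \<forall>R \<in> SOS_le d. restrict (lookup R) (expos d) \<notin> N \<longrightarrow> P R)"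

section \<open>Localizing and moment matrices\<close>

(* The order on exponents is the lexicographical order of Poly_Mapping; within one degree the
   monomials are listed from the largest to the smallest, i.e. 1, x1, ..., xn, x1^2, x1 x2, ... *)
definition grlex :: "nat \<Rightarrow> 'n::{finite,linorder} expo list" where
  "grlex d = concat (map (\<lambda>j. rev (sorted_list_of_set {\<alpha>. mdeg \<alpha> = j})) [0..<Suc d])"

definition coeff_vec :: "nat \<Rightarrow> 'n::{finite,linorder} mpoly \<Rightarrow> real Matrix.vec" where
  "coeff_vec d p = vec_of_list (map (lookup p) (grlex d))"

definition is_loc_mat ::
    "'n::{finite,linorder} mpoly \<Rightarrow> nat \<Rightarrow> ('n expo \<Rightarrow> real) \<Rightarrow> real mat \<Rightarrow> bool" where
  "is_loc_mat q k y L \<longleftrightarrow>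
     (let s = k - ceil_half (tdeg q); N = length (grlex s :: 'n expo list) in
        L \<in> carrier_mat N N \<and> transpose_mat L = L \<and>
        (\<forall>p \<in> polys s. pairing (q * p ^ 2) y = coeff_vec s p \<bullet> (L *\<^sub>v coeff_vec s p)))"

(* Well defined by ex1_loc_mat below. *)
definition loc_mat :: "'n::{finite,linorder} mpoly \<Rightarrow> nat \<Rightarrow> ('n expo \<Rightarrow> real) \<Rightarrow> real mat" where
  "loc_mat q k y = (THE L. is_loc_mat q k y L)"

definition mom_mat :: "nat \<Rightarrow> ('n::{finite,linorder} expo \<Rightarrow> real) \<Rightarrow> real mat" where
  "mom_mat k y = loc_mat 1 k y"

definition psd :: "real mat \<Rightarrow> bool" where
  "psd A \<longleftrightarrow> dim_row A = dim_col A \<and> transpose_mat A = A \<and>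
     (\<forall>v \<in> carrier_vec (dim_col A). v \<bullet> (A *\<^sub>v v) \<ge> 0)"

definition mat_rank :: "real mat \<Rightarrow> nat" where
  "mat_rank A = vec_space.rank (dim_row A) A"

definition d_K :: "('l \<Rightarrow> 'n::finite mpoly) \<Rightarrow> 'l set \<Rightarrow> 'l set \<Rightarrow> nat" where
  "d_K c E I = Max (insert 1 ((\<lambda>i. ceil_half (tdeg (c i))) ` (E \<union> I)))"

definition flat_truncation ::
    "('l \<Rightarrow> 'n::{finite,linorder} mpoly) \<Rightarrow> 'l set \<Rightarrow> 'l set \<Rightarrow> nat \<Rightarrow> ('n expo \<Rightarrow> real) \<Rightarrow> bool" where
  "flat_truncation c E I k w \<longleftrightarrow>
     (\<exists>t. d_K c E I \<le> t \<and> t \<le> k \<and> mat_rank (mom_mat (t - d_K c E I) w) = mat_rank (mom_mat t w))"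

section \<open>The optimization problems and their relaxations\<close>

definition feas_P :: "nat \<Rightarrow> (nat \<Rightarrow> 'n::finite mpoly) \<Rightarrow> (nat \<Rightarrow> real) \<Rightarrow> nat \<Rightarrow> (real ^ 'n) set
    \<Rightarrow> ('n expo \<Rightarrow> real) set" where
  "feas_P m a b d1 K = {y \<in> moment_cone d1 K. \<forall>i\<in>{1..m}. pairing (a i) y = b i}"

(* Only the entries of lam with index in {1..m} matter. *)
definition feas_D :: "nat \<Rightarrow> (nat \<Rightarrow> 'n::finite mpoly) \<Rightarrow> nat \<Rightarrow> (real ^ 'n) set \<Rightarrow> 'n mpoly
    \<Rightarrow> (nat \<Rightarrow> real) set" where
  "feas_D m a d1 K R = {lam. R - (\<Sum>i=1..m. Const (lam i) * a i) \<in> nonneg_polys d1 K}"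

definition is_relax_order :: "('l \<Rightarrow> 'n::finite mpoly) \<Rightarrow> 'l set \<Rightarrow> 'l set \<Rightarrow> nat \<Rightarrow> nat \<Rightarrow> bool" where
  "is_relax_order c E I d1 k \<longleftrightarrow> d1 \<le> 2 * k \<and> (\<forall>i \<in> E \<union> I. tdeg (c i) \<le> 2 * k)"

definition feas_Pk :: "nat \<Rightarrow> (nat \<Rightarrow> 'n::{finite,linorder} mpoly) \<Rightarrow> (nat \<Rightarrow> real)
    \<Rightarrow> ('l \<Rightarrow> 'n mpoly) \<Rightarrow> 'l set \<Rightarrow> 'l set \<Rightarrow> nat \<Rightarrow> ('n expo \<Rightarrow> real) set" where
  "feas_Pk m a b c E I k = {w \<in> tms (2 * k).
     (\<forall>i\<in>{1..m}. pairing (a i) w = b i) \<and>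
     (\<forall>i\<in>E. loc_mat (c i) k w =
        0\<^sub>m (dim_row (loc_mat (c i) k w)) (dim_col (loc_mat (c i) k w))) \<and>
     (\<forall>j\<in>I. psd (loc_mat (c j) k w)) \<and>
     psd (mom_mat k w)}"

definition feas_Dk :: "nat \<Rightarrow> (nat \<Rightarrow> 'n::finite mpoly) \<Rightarrow> ('l \<Rightarrow> 'n mpoly) \<Rightarrow> 'l set \<Rightarrow> 'l set
    \<Rightarrow> nat \<Rightarrow> 'n mpoly \<Rightarrow> (nat \<Rightarrow> real) set" where
  "feas_Dk m a c E I k R = {lam. R - (\<Sum>i=1..m. Const (lam i) * a i)
     \<in> {p + q | p q. p \<in> Ideal_le c E (2 * k) \<and> q \<in> QM_le c I (2 * k)}}"

(* Optimal values are extended reals: infinity for an infeasible minimization, and so on. *)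
definition phi_star :: "nat \<Rightarrow> (nat \<Rightarrow> 'n::finite mpoly) \<Rightarrow> (nat \<Rightarrow> real) \<Rightarrow> nat \<Rightarrow> (real ^ 'n) set
    \<Rightarrow> 'n mpoly \<Rightarrow> ereal" where
  "phi_star m a b d1 K R = (INF y \<in> feas_P m a b d1 K. ereal (pairing R y))"

definition phi :: "nat \<Rightarrow> (nat \<Rightarrow> 'n::{finite,linorder} mpoly) \<Rightarrow> (nat \<Rightarrow> real)
    \<Rightarrow> ('l \<Rightarrow> 'n mpoly) \<Rightarrow> 'l set \<Rightarrow> 'l set \<Rightarrow> 'n mpoly \<Rightarrow> nat \<Rightarrow> ereal" where
  "phi m a b c E I R k = (INF w \<in> feas_Pk m a b c E I k. ereal (pairing R w))"

definition psi :: "nat \<Rightarrow> (nat \<Rightarrow> 'n::finite mpoly) \<Rightarrow> (nat \<Rightarrow> real)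
    \<Rightarrow> ('l \<Rightarrow> 'n mpoly) \<Rightarrow> 'l set \<Rightarrow> 'l set \<Rightarrow> 'n mpoly \<Rightarrow> nat \<Rightarrow> ereal" where
  "psi m a b c E I R k = (SUP lam \<in> feas_Dk m a c E I k R. ereal (\<Sum>i=1..m. b i * lam i))"

definition maximizer_D :: "nat \<Rightarrow> (nat \<Rightarrow> 'n::finite mpoly) \<Rightarrow> (nat \<Rightarrow> real) \<Rightarrow> nat \<Rightarrow> (real ^ 'n) set
    \<Rightarrow> 'n mpoly \<Rightarrow> (nat \<Rightarrow> real) \<Rightarrow> bool" where
  "maximizer_D m a b d1 K R =
     is_arg_max (\<lambda>lam. \<Sum>i=1..m. b i * lam i) (\<lambda>lam. lam \<in> feas_D m a d1 K R)"

definition minimizer_Pk :: "nat \<Rightarrow> (nat \<Rightarrow> 'n::{finite,linorder} mpoly) \<Rightarrow> (nat \<Rightarrow> real)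
    \<Rightarrow> ('l \<Rightarrow> 'n mpoly) \<Rightarrow> 'l set \<Rightarrow> 'l set \<Rightarrow> 'n mpoly \<Rightarrow> nat \<Rightarrow> ('n expo \<Rightarrow> real) \<Rightarrow> bool" where
  "minimizer_Pk m a b c E I R k = is_arg_min (pairing R) (\<lambda>w. w \<in> feas_Pk m a b c E I k)"

section \<open>Optimality conditions\<close>

definition grad :: "(real ^ 'n::finite \<Rightarrow> real) \<Rightarrow> real ^ 'n \<Rightarrow> real ^ 'n" where
  "grad f u = (\<chi> i. frechet_derivative f (at u) (axis i 1))"

definition hessian :: "(real ^ 'n::finite \<Rightarrow> real) \<Rightarrow> real ^ 'n \<Rightarrow> real ^ 'n ^ 'n" where
  "hessian f u = (\<chi> i j. frechet_derivative (\<lambda>x. grad f x $ i) (at u) (axis j 1))"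

definition active :: "('l \<Rightarrow> 'n::finite mpoly) \<Rightarrow> 'l set \<Rightarrow> real ^ 'n \<Rightarrow> 'l set" where
  "active c I u = {j \<in> I. peval (c j) u = 0}"

(* Linear independence of the family of gradients, hence the injectivity. *)
definition LICQC :: "('l \<Rightarrow> 'n::finite mpoly) \<Rightarrow> 'l set \<Rightarrow> 'l set \<Rightarrow> real ^ 'n \<Rightarrow> bool" where
  "LICQC c E I u \<longleftrightarrow>
     inj_on (\<lambda>i. grad (peval (c i)) u) (E \<union> active c I u) \<and>
     independent ((\<lambda>i. grad (peval (c i)) u) ` (E \<union> active c I u))"

definition lagrange_mult ::
    "'n::finite mpoly \<Rightarrow> ('l \<Rightarrow> 'n mpoly) \<Rightarrow> 'l set \<Rightarrow> 'l set \<Rightarrow> real ^ 'n \<Rightarrow> ('l \<Rightarrow> real) \<Rightarrow> bool" where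
  "lagrange_mult F c E I u \<nu> \<longleftrightarrow>
     grad (peval F) u = (\<Sum>i\<in>E \<union> I. \<nu> i *\<^sub>R grad (peval (c i)) u) \<and>
     (\<forall>j\<in>I. \<nu> j \<ge> 0 \<and> \<nu> j * peval (c j) u = 0)"

definition SCC :: "('l \<Rightarrow> 'n::finite mpoly) \<Rightarrow> 'l set \<Rightarrow> real ^ 'n \<Rightarrow> ('l \<Rightarrow> real) \<Rightarrow> bool" where
  "SCC c I u \<nu> \<longleftrightarrow> (\<forall>j\<in>I. \<nu> j + peval (c j) u > 0)"

definition SOSC ::
    "'n::finite mpoly \<Rightarrow> ('l \<Rightarrow> 'n mpoly) \<Rightarrow> 'l set \<Rightarrow> 'l set \<Rightarrow> real ^ 'n \<Rightarrow> ('l \<Rightarrow> real) \<Rightarrow> bool" where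
  "SOSC F c E I u \<nu> \<longleftrightarrow>
     (\<forall>v. v \<noteq> 0 \<and> (\<forall>i \<in> E \<union> active c I u. inner v (grad (peval (c i)) u) = 0) \<longrightarrow>
        inner v ((hessian (peval F) u - (\<Sum>i\<in>E \<union> I. \<nu> i *\<^sub>R hessian (peval (c i)) u)) *v v) > 0)"

(* Under LICQC the multipliers of a minimizer exist and are unique on E \<union> I, so the existential
   quantifier just names them. *)
definition opt_conditions ::
    "'n::finite mpoly \<Rightarrow> ('l \<Rightarrow> 'n mpoly) \<Rightarrow> 'l set \<Rightarrow> 'l set \<Rightarrow> real ^ 'n \<Rightarrow> bool" where
  "opt_conditions F c E I u \<longleftrightarrow>
     LICQC c E I u \<and> (\<exists>\<nu>. lagrange_mult F c E I u \<nu> \<and> SCC c I u \<nu> \<and> SOSC F c E I u \<nu>)"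

section \<open>Localizing matrices are well defined\<close>

lemma finite_expos: "finite (expos d :: 'n::finite expo set)"
proof -
  have "lookup ` (expos d :: 'n expo set) \<subseteq> (UNIV \<rightarrow>\<^sub>E {..d})"
  proof (rule image_subsetI)
    fix \<alpha> :: "'n expo"
    assume "\<alpha> \<in> expos d"
    then have le: "sum (lookup \<alpha>) UNIV \<le> d"
      by (simp add: expos_def mdeg_def)
    have "lookup \<alpha> i \<le> d" for i
    proof -
      have "lookup \<alpha> i \<le> sum (lookup \<alpha>) UNIV"
        by (rule member_le_sum) auto
      with le show ?thesis by simp
    qed
    then show "lookup \<alpha> \<in> UNIV \<rightarrow>\<^sub>E {..d}" by auto
  qed
  then have "finite (lookup ` (expos d :: 'n expo set))"
    by (rule finite_subset) (auto intro: finite_PiE)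
  then show ?thesis
    by (rule finite_imageD) (auto intro: inj_onI poly_mapping_eqI)
qed

lemma finite_mdeg_eq: "finite {\<alpha> :: 'n::finite expo. mdeg \<alpha> = j}"
  by (rule finite_subset[OF _ finite_expos[of j]]) (auto simp: expos_def)

lemma set_grlex: "set (grlex d) = (expos d :: 'n::{finite,linorder} expo set)"
proof -
  have "set (grlex d) = (\<Union>j\<in>{0..<Suc d}. {\<alpha> :: 'n expo. mdeg \<alpha> = j})"
    unfolding grlex_def set_concat set_map set_rev set_upt image_image
    by (simp only: set_sorted_list_of_set[OF finite_mdeg_eq])
  then show ?thesis by (auto simp: expos_def)
qed

lemma distinct_grlex: "distinct (grlex d :: 'n::{finite,linorder} expo list)"
  unfolding grlex_def
proof (induction d)
  case 0
  show ?case by simp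
next
  case (Suc d)
  then show ?case
    by (auto simp: finite_mdeg_eq)
qed

lemma pairing_superset:
  assumes "finite A" "keys p \<subseteq> A"
  shows "pairing p y = (\<Sum>\<alpha>\<in>A. lookup p \<alpha> * y \<alpha>)"
  unfolding pairing_def
  by (rule sum.mono_neutral_left) (use assms in \<open>auto simp: in_keys_iff\<close>)

lemma pairing_add: "pairing (p + q) y = pairing p y + pairing q y"
proof -
  let ?A = "keys p \<union> keys q"
  have "pairing (p + q) y = (\<Sum>\<alpha>\<in>?A. lookup (p + q) \<alpha> * y \<alpha>)"
    by (rule pairing_superset) (auto simp: keys_add)
  moreover have "pairing p y = (\<Sum>\<alpha>\<in>?A. lookup p \<alpha> * y \<alpha>)"
    by (rule pairing_superset) auto
  moreover have "pairing q y = (\<Sum>\<alpha>\<in>?A. lookup q \<alpha> * y \<alpha>)"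
    by (rule pairing_superset) auto
  ultimately show ?thesis
    by (simp add: lookup_add sum.distrib algebra_simps)
qed

lemma pairing_sum: "pairing (\<Sum>i\<in>A. f i) y = (\<Sum>i\<in>A. pairing (f i) y)"
proof -
  have "pairing 0 y = 0" by (simp add: pairing_def)
  then show ?thesis
    by (induction A rule: infinite_finite_induct) (simp_all add: pairing_add)
qed

lemma lookup_Const_mult: "lookup (Const r * p) \<alpha> = r * lookup p \<alpha>"
proof -
  have "Const r * p = Poly_Mapping.map ((*) r) p"
    unfolding Const_def by (rule mult_map_scale_conv_mult[symmetric])
  then show ?thesis by (simp add: Poly_Mapping.map.rep_eq when_def)
qed

lemma pairing_Const_mult: "pairing (Const r * p) y = r * pairing p y"
proof -
  have "pairing (Const r * p) y = (\<Sum>\<alpha>\<in>keys p. lookup (Const r * p) \<alpha> * y \<alpha>)"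
    by (rule pairing_superset) (auto simp: in_keys_iff lookup_Const_mult)
  then show ?thesis
    by (simp add: pairing_def lookup_Const_mult sum_distrib_left mult.assoc)
qed

abbreviation Mon :: "'n::finite expo \<Rightarrow> 'n mpoly" where
  "Mon \<alpha> \<equiv> Poly_Mapping.single \<alpha> 1"

lemma polys_expand:
  fixes p :: "'n::{finite,linorder} mpoly"
  assumes "p \<in> polys s"
  shows "p = (\<Sum>i<length (grlex s :: 'n expo list). Const (lookup p (grlex s ! i)) * Mon (grlex s ! i))"
proof -
  let ?B = "grlex s :: 'n expo list"
  have "(\<Sum>i<length ?B. Const (lookup p (?B ! i)) * Mon (?B ! i))
      = (\<Sum>\<alpha>\<in>set ?B. Const (lookup p \<alpha>) * Mon \<alpha>)"
    by (rule sum.reindex_bij_betw, rule bij_betw_nth) (auto simp: distinct_grlex)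
  also have "\<dots> = p"
  proof (rule poly_mapping_eqI)
    fix \<beta>
    have "lookup (\<Sum>\<alpha>\<in>set ?B. Const (lookup p \<alpha>) * Mon \<alpha>) \<beta>
        = (\<Sum>\<alpha>\<in>set ?B. if \<alpha> = \<beta> then lookup p \<beta> else 0)"
      unfolding lookup_sum lookup_Const_mult
      by (rule sum.cong) (auto simp: lookup_single when_def)
    also have "\<dots> = (if \<beta> \<in> set ?B then lookup p \<beta> else 0)"
      by (simp add: sum.delta)
    also have "\<dots> = lookup p \<beta>"
      using assms by (auto simp: set_grlex finite_expos polys_def in_keys_iff)
    finally show "lookup (\<Sum>\<alpha>\<in>set ?B. Const (lookup p \<alpha>) * Mon \<alpha>) \<beta> = lookup p \<beta>" .
  qed
  finally show ?thesis ..
qed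

lemma pairing_square:
  fixes p q :: "'n::{finite,linorder} mpoly" and s :: nat
  defines "B \<equiv> grlex s :: 'n expo list"
  assumes "p \<in> polys s"
  shows "pairing (q * p ^ 2) y = (\<Sum>i<length B. \<Sum>j<length B.
    lookup p (B ! i) * lookup p (B ! j) * pairing (q * (Mon (B ! i) * Mon (B ! j))) y)"
proof -
  let ?c = "\<lambda>i. Const (lookup p (B ! i))"
  have C: "Const x * Const z = (Const (x * z) :: 'n mpoly)" for x z
    by (simp add: Const_def mult_single)
  have "q * p ^ 2 = q * ((\<Sum>i<length B. ?c i * Mon (B ! i)) * (\<Sum>j<length B. ?c j * Mon (B ! j)))"
    unfolding B_def polys_expand[OF assms(2), symmetric] power2_eq_square ..
  also have "\<dots> = (\<Sum>i<length B. \<Sum>j<length B. q * ((?c i * Mon (B ! i)) * (?c j * Mon (B ! j))))"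
    by (simp only: sum_product) (simp only: sum_distrib_left)
  also have "\<dots> = (\<Sum>i<length B. \<Sum>j<length B. Const (lookup p (B ! i) * lookup p (B ! j)) *
       (q * (Mon (B ! i) * Mon (B ! j))))"
    by (simp only: C[symmetric] ac_simps)
  finally show ?thesis
    by (simp only: pairing_sum pairing_Const_mult)
qed

definition loc_mat_entries ::
    "'n::{finite,linorder} mpoly \<Rightarrow> nat \<Rightarrow> ('n expo \<Rightarrow> real) \<Rightarrow> real mat" where
  "loc_mat_entries q s y = (let B = grlex s in
     Matrix.mat (length B) (length B) (\<lambda>(i, j). pairing (q * (Mon (B ! i) * Mon (B ! j))) y))"

lemma quad_form_expand:
  fixes L :: "real mat"
  assumes "L \<in> carrier_mat N N" "v \<in> carrier_vec N"
  shows "v \<bullet> (L *\<^sub>v v) = (\<Sum>i<N. \<Sum>j<N. vec_index v i * vec_index v j * L $$ (i, j))"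
proof -
  have "v \<bullet> (L *\<^sub>v v) = (\<Sum>i<N. vec_index v i * (\<Sum>j<N. L $$ (i, j) * vec_index v j))"
    using assms unfolding scalar_prod_def
    by (auto simp: scalar_prod_def atLeast0LessThan intro!: sum.cong)
  also have "\<dots> = (\<Sum>i<N. \<Sum>j<N. vec_index v i * vec_index v j * L $$ (i, j))"
    unfolding sum_distrib_left by (intro sum.cong refl) (simp only: ac_simps)
  finally show ?thesis .
qed

lemma coeff_vec_simps:
  fixes p :: "'n::{finite,linorder} mpoly"
  shows "coeff_vec s p \<in> carrier_vec (length (grlex s :: 'n expo list))"
    and "i < length (grlex s :: 'n expo list) \<Longrightarrow> vec_index (coeff_vec s p) i = lookup p (grlex s ! i)"
proof -
  show "coeff_vec s p \<in> carrier_vec (length (grlex s :: 'n expo list))"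
    unfolding coeff_vec_def by (rule carrier_vecI) simp
next
  assume "i < length (grlex s :: 'n expo list)"
  then show "vec_index (coeff_vec s p) i = lookup p (grlex s ! i)"
    unfolding coeff_vec_def by (simp add: vec_of_list_index)
qed

lemma is_loc_mat_entries:
  "is_loc_mat q k y (loc_mat_entries q (k - ceil_half (tdeg q)) y)"
proof -
  define s where "s = k - ceil_half (tdeg q)"
  let ?B = "grlex s :: 'a expo list" and ?L = "loc_mat_entries q s y"
  have car: "?L \<in> carrier_mat (length ?B) (length ?B)"
    by (simp add: loc_mat_entries_def Let_def)
  moreover have "transpose_mat ?L = ?L"
    by (rule eq_matI) (auto simp: loc_mat_entries_def Let_def mult.commute)
  moreover have "pairing (q * p ^ 2) y = coeff_vec s p \<bullet> (?L *\<^sub>v coeff_vec s p)"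
    if "p \<in> polys s" for p
    unfolding quad_form_expand[OF car coeff_vec_simps(1)] pairing_square[OF that]
    by (auto simp: coeff_vec_simps loc_mat_entries_def Let_def intro!: sum.cong)
  ultimately show ?thesis
    by (simp add: is_loc_mat_def s_def Let_def)
qed

lemma sym_quad_form_unique:
  fixes L L' :: "real mat"
  assumes L: "L \<in> carrier_mat N N" "transpose_mat L = L"
    and L': "L' \<in> carrier_mat N N" "transpose_mat L' = L'"
    and eq: "\<And>v. v \<in> carrier_vec N \<Longrightarrow> v \<bullet> (L *\<^sub>v v) = v \<bullet> (L' *\<^sub>v v)"
  shows "L = L'"
proof (rule eq_matI)
  fix i j assume "i < dim_row L'" "j < dim_col L'"
  then have ij: "i < N" "j < N" using L' by auto
  have sym: "A $$ (i, j) = A $$ (j, i)"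
    if "A \<in> carrier_mat N N" "transpose_mat A = A" for A :: "real mat"
    using that ij by (metis carrier_matD index_transpose_mat(1))
  have unit: "unit_vec N r \<bullet> (A *\<^sub>v unit_vec N t) = A $$ (r, t)"
    if "A \<in> carrier_mat N N" "r < N" "t < N" for A :: "real mat" and r t
    using that by simp
  have pol: "(unit_vec N i + unit_vec N j) \<bullet> (A *\<^sub>v (unit_vec N i + unit_vec N j))
      = A $$ (i, i) + A $$ (i, j) + (A $$ (j, i) + A $$ (j, j))"
    if A: "A \<in> carrier_mat N N" for A :: "real mat"
  proof -
    have "A *\<^sub>v (unit_vec N i + unit_vec N j) = A *\<^sub>v unit_vec N i + A *\<^sub>v unit_vec N j"
      using A by (intro mult_add_distrib_mat_vec) auto
    then show ?thesis
      using A ij by (simp add: add_scalar_prod_distrib[of _ N] scalar_prod_add_distrib[of _ N] unit)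
  qed
  have "A $$ (i, j) = ((unit_vec N i + unit_vec N j) \<bullet> (A *\<^sub>v (unit_vec N i + unit_vec N j))
      - unit_vec N i \<bullet> (A *\<^sub>v unit_vec N i) - unit_vec N j \<bullet> (A *\<^sub>v unit_vec N j)) / 2"
    if "A \<in> carrier_mat N N" "transpose_mat A = A" for A :: "real mat"
    using sym[OF that] pol[OF that(1)] unit[OF that(1)] ij by simp
  from this[OF L] this[OF L'] show "L $$ (i, j) = L' $$ (i, j)"
    by (simp add: eq)
qed (use L L' in auto)

lemma coeff_vec_surj:
  assumes "v \<in> carrier_vec (length (grlex s :: 'n::{finite,linorder} expo list))"
  shows "\<exists>p :: 'n mpoly. p \<in> polys s \<and> coeff_vec s p = v"
proof -
  let ?B = "grlex s :: 'n expo list"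
  define p :: "'n mpoly" where "p = (\<Sum>i<length ?B. Poly_Mapping.single (?B ! i) (vec_index v i))"
  have lk: "lookup p \<beta> = (\<Sum>i<length ?B. if ?B ! i = \<beta> then vec_index v i else 0)" for \<beta>
    by (auto simp: p_def lookup_sum lookup_single when_def intro!: sum.cong)
  have "p \<in> polys s"
  proof (clarsimp simp: polys_def in_keys_iff)
    fix \<beta> assume "lookup p \<beta> \<noteq> 0"
    then obtain i where "i < length ?B" "?B ! i = \<beta>"
      unfolding lk by (auto elim!: sum.not_neutral_contains_not_neutral split: if_splits)
    then have "\<beta> \<in> set ?B" by auto
    then show "\<beta> \<in> expos s" by (simp add: set_grlex)
  qed
  moreover have "coeff_vec s p = v"
  proof (rule eq_vecI)
    show "dim_vec (coeff_vec s p) = dim_vec v"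
      using assms coeff_vec_simps(1)[of s p] by simp
    fix i assume "i < dim_vec v"
    then have i: "i < length ?B" using assms by simp
    have "(\<Sum>j<length ?B. if ?B ! j = ?B ! i then vec_index v j else 0)
        = (\<Sum>j<length ?B. if j = i then vec_index v j else 0)"
      using i distinct_grlex[of s, where 'n = 'n]
      by (intro sum.cong) (auto simp: nth_eq_iff_index_eq)
    then show "vec_index (coeff_vec s p) i = vec_index v i"
      using i by (simp add: coeff_vec_simps lk)
  qed
  ultimately show ?thesis by blast
qed

lemma ex1_loc_mat: "\<exists>!L. is_loc_mat q k y L"
proof (rule ex1I)
  show "is_loc_mat q k y (loc_mat_entries q (k - ceil_half (tdeg q)) y)"
    by (rule is_loc_mat_entries)
next
  fix L assume L: "is_loc_mat q k y L"
  note L' = is_loc_mat_entries[of q k y]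
  show "L = loc_mat_entries q (k - ceil_half (tdeg q)) y"
  proof (rule sym_quad_form_unique)
    fix v :: "real Matrix.vec"
    assume "v \<in> carrier_vec (length (grlex (k - ceil_half (tdeg q)) :: 'a expo list))"
    from coeff_vec_surj[OF this] L L'
    show "v \<bullet> (L *\<^sub>v v) = v \<bullet> (loc_mat_entries q (k - ceil_half (tdeg q)) y *\<^sub>v v)"
      unfolding is_loc_mat_def Let_def by metis
  qed (use L L' in \<open>auto simp: is_loc_mat_def Let_def\<close>)
qed

lemma loc_mat_eq_entries: "loc_mat q k y = loc_mat_entries q (k - ceil_half (tdeg q)) y"
  unfolding loc_mat_def by (rule the1_equality[OF ex1_loc_mat is_loc_mat_entries])

end

(* Let f = R - sum_i lam_i a_i be the optimal dual polynomial. The optimality conditions give at every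
   zero u of f in K a local certificate f = m + c |x - u|^2 + O(|x - u|^3) with m in the quadratic module
   M = Ideal[c_eq] + QM[c_in] and c > 0: take nu_i - C L_i, resp. its square root to first order, as
   multiplier of c_i, where L_i is the linear part of c_i at u; for large C the remaining quadratic form is
   positive definite. Hence f has a finite zero set S in K, and Putinar's theorem, applied to the
   error terms, glues the local certificates to f - gamma Q in M with gamma > 0, where Q is a sum of
   squares of polynomials that generate the vanishing ideal of S.
   Putinar's theorem itself follows from Bernstein expansions on a box.

   For a generic sum of squares R is positive on K. As S is finite, Farkas' lemma then writes b as a
   nonnegative combination of the vectors a(u), u in S, since otherwise lam could be improved. These atoms
   are feasible for (P) and every (P_k), and all optimal values agree once f and f - gamma Q have
   certificates of degree 2k.

   A minimizer w of (P_k) satisfies <f,w> = 0, so <Q,w> = 0 and the generators of the ideal of S lie in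
   the kernel of M_k[w]. Therefore rank M_t[w] <= |S| for every fixed t and large k, and the nondecreasing
   ranks of M_0, M_{d_K}, M_{2 d_K}, ... have to repeat. *)
theory Submission
  imports Defs "HOL-Real_Asymp.Real_Asymp"
begin

section \<open>Polynomials and their derivatives\<close>

text \<open>f in M alone would equate the optimal values but say nothing about the kernel of M_k[w].
  Hence the strictness c > 0 in the local certificates: the slack c |x - u|^2 pays for subtracting
  gamma Q, and gamma <Q,w> <= <f,w> = 0 then reaches the generators. The local remainders O(|x -
  u|^3) have no sign, and Putinar's theorem needs strict positivity, which fails on S. Therefore a
  remainder is written as products of two generators with a coefficient vanishing on S; an even
  power of 1 - eta Q makes that coefficient uniformly small on K, so eps plus or minus the
  coefficient is positive on K and lies in M. Positivity of R serves duality: at u in S it gives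
  sum_i lam_i a_i(u) = R(u) > 0, so moving lam slightly along -lam makes the dual polynomial
  positive on all of S at once. This strict direction upgrades the weak inequalities of Farkas'
  lemma. Genericity is a Fubini argument: with the other coefficients fixed, at most one constant
  term makes the infimum over K equal to 0. Both certificates are found before any k is chosen, so
  one degree bound serves all minimizers w.\<close>

lemma Const_0 [simp]: "Const 0 = 0" and Const_1 [simp]: "Const 1 = 1"
  by (simp_all add: Const_def)

lemma Const_add: "Const (r + s) = Const r + Const s"
  by (simp add: Const_def single_add)

lemma Const_mult: "Const (r * s) = Const r * Const s"
  by (simp add: Const_def mult_single)

lemma Const_uminus: "Const (- r) = - Const r"
  by (simp add: Const_def single_uminus)

lemma Const_diff: "Const (r - s) = Const r - Const s"
  by (simp add: Const_def single_diff)

lemma Const_power: "Const (r ^ k) = Const r ^ k"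
  by (induction k) (simp_all add: Const_mult)

lemma Const_sum: "Const (sum f A) = (\<Sum>x\<in>A. Const (f x))"
  by (induction A rule: infinite_finite_induct) (simp_all add: Const_add)

lemma Const_numeral: "Const (numeral k) = numeral k"
  unfolding Const_def by simp

lemma peval_pairing: "peval p x = pairing p (\<lambda>\<alpha>. monom_eval \<alpha> x)"
  by (simp add: peval_def pairing_def)

lemma peval_0 [simp]: "peval 0 x = 0"
  by (simp add: peval_def)

lemma peval_single: "peval (Poly_Mapping.single \<alpha> r) x = r * monom_eval \<alpha> x"
  by (simp add: peval_def)

lemma monom_eval_0 [simp]: "monom_eval 0 x = 1"
  by (simp add: monom_eval_def)

lemma monom_eval_add: "monom_eval (\<alpha> + \<beta>) x = monom_eval \<alpha> x * monom_eval \<beta> x"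
  by (simp add: monom_eval_def lookup_add power_add prod.distrib)

lemma peval_Const [simp]: "peval (Const r) x = r"
  by (simp add: Const_def peval_single)

lemma peval_1 [simp]: "peval 1 x = 1"
  using peval_Const[of 1 x] by simp

lemma peval_Var [simp]: "peval (Var i) x = x $ i"
proof -
  have "monom_eval (Poly_Mapping.single i 1) x = (\<Prod>j\<in>UNIV. if j = i then x $ j else 1)"
    unfolding monom_eval_def by (rule prod.cong) (auto simp: lookup_single when_def)
  then show ?thesis by (simp add: Var_def peval_single)
qed

lemma peval_add [simp]: "peval (p + q) x = peval p x + peval q x"
  by (simp add: peval_pairing pairing_add)

lemma peval_uminus [simp]: "peval (- p) x = - peval p x"
proof -
  have "peval (- p) x + peval p x = 0"
    unfolding peval_add[symmetric] by simp
  then show ?thesis by simp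
qed

lemma peval_diff [simp]: "peval (p - q) x = peval p x - peval q x"
  using peval_add[of p "- q" x] by simp

lemma mpoly_single_induct [case_names single add]:
  fixes p :: "'n::finite mpoly"
  assumes s: "\<And>\<alpha> r. P (Poly_Mapping.single \<alpha> r)" and a: "\<And>p q. P p \<Longrightarrow> P q \<Longrightarrow> P (p + q)"
  shows "P p"
proof -
  have "P (\<Sum>\<alpha>\<in>A. Poly_Mapping.single \<alpha> (lookup p \<alpha>))" if "finite A" for A
    using that s[of 0 0] by (induction A) (auto intro: s a)
  moreover have "(\<Sum>\<alpha>\<in>keys p. Poly_Mapping.single \<alpha> (lookup p \<alpha>)) = p"
    by (rule poly_mapping_eqI) (auto simp: lookup_sum lookup_single when_def in_keys_iff)
  ultimately show ?thesis
    using finite_keys[of p] by metis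
qed

lemma peval_mult [simp]: "peval (p * q) x = peval p x * peval q x"
proof (induction p rule: mpoly_single_induct)
  case (single \<alpha> r)
  show ?case
    by (induction q rule: mpoly_single_induct)
      (simp_all add: mult_single peval_single monom_eval_add algebra_simps)
qed (simp add: algebra_simps)

lemma peval_power [simp]: "peval (p ^ k) x = peval p x ^ k"
  by (induction k) simp_all

lemma peval_sum [simp]: "peval (sum f A) x = (\<Sum>i\<in>A. peval (f i) x)"
  by (induction A rule: infinite_finite_induct) simp_all

lemma peval_prod [simp]: "peval (prod f A) x = (\<Prod>i\<in>A. peval (f i) x)"
  by (induction A rule: infinite_finite_induct) simp_all

lemma peval_numeral [simp]: "peval (numeral k) x = numeral k"
  using peval_Const[of "numeral k" x] by (simp only: Const_numeral)

lemma Var_power: "Var i ^ k = Poly_Mapping.single (Poly_Mapping.single i k) 1"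
proof (induction k)
  case (Suc k)
  have "Poly_Mapping.single i 1 + Poly_Mapping.single i k = Poly_Mapping.single i (Suc k)"
    by (simp add: single_add[symmetric])
  with Suc show ?case by (simp add: Var_def mult_single)
qed simp

lemma single_eq_prod_Var:
  "Poly_Mapping.single \<alpha> r = Const r * (\<Prod>i\<in>UNIV. Var i ^ lookup \<alpha> i :: 'n::finite mpoly)"
proof -
  have "(\<Prod>i\<in>A. Var i ^ lookup \<alpha> i) = Mon (\<Sum>i\<in>A. Poly_Mapping.single i (lookup \<alpha> i))"
    if "finite A" for A :: "'n set"
    using that by (induction A) (simp_all add: Var_power mult_single)
  from this[of UNIV] have "(\<Prod>i\<in>UNIV. Var i ^ lookup \<alpha> i) = Mon (\<Sum>i\<in>UNIV. Poly_Mapping.single i (lookup \<alpha> i))"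
    by simp
  also have "(\<Sum>i\<in>UNIV. Poly_Mapping.single i (lookup \<alpha> i)) = \<alpha>"
    by (rule poly_mapping_eqI) (simp add: lookup_sum lookup_single when_def)
  finally show ?thesis by (simp add: Const_def mult_single)
qed

lemma mpoly_induct [case_names Const Var add mult]:
  fixes p :: "'n::finite mpoly"
  assumes C: "\<And>r. P (Const r)" and V: "\<And>i. P (Var i)"
    and a: "\<And>p q. P p \<Longrightarrow> P q \<Longrightarrow> P (p + q)" and m: "\<And>p q. P p \<Longrightarrow> P q \<Longrightarrow> P (p * q)"
  shows "P p"
proof (induction p rule: mpoly_single_induct)
  case (single \<alpha> r)
  have 1: "P 1" using C[of 1] by simp
  have pw: "P (Var i ^ k)" for i k by (induction k) (auto intro: 1 m V)
  have "P (\<Prod>i\<in>A. Var i ^ lookup \<alpha> i)" if "finite A" for A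
    using that by (induction A) (auto intro: 1 m pw)
  then show ?case unfolding single_eq_prod_Var by (intro m C) simp
qed (rule a)

section \<open>Degree bounds\<close>

lemma mdeg_add: "mdeg (\<alpha> + \<beta>) = mdeg \<alpha> + mdeg \<beta>"
  by (simp add: mdeg_def lookup_add sum.distrib)

lemma mdeg_0 [simp]: "mdeg 0 = 0"
  by (simp add: mdeg_def)

lemma mdeg_single [simp]: "mdeg (Poly_Mapping.single i k) = k"
  by (simp add: mdeg_def lookup_single when_def)

lemma mem_polys_iff: "p \<in> polys d \<longleftrightarrow> tdeg p \<le> d"
  by (auto simp: polys_def expos_def tdeg_def)

lemma polys_mono: "p \<in> polys d \<Longrightarrow> d \<le> e \<Longrightarrow> p \<in> polys e"
  by (simp add: mem_polys_iff)

lemma polys_0 [simp]: "0 \<in> polys d"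
  by (simp add: polys_def)

lemma polys_Const [simp]: "Const r \<in> polys d"
  by (auto simp: polys_def expos_def Const_def)

lemma polys_1 [simp]: "1 \<in> polys d"
  using polys_Const[of 1 d] by simp

lemma polys_Mon [simp]: "Mon \<alpha> \<in> polys d \<longleftrightarrow> mdeg \<alpha> \<le> d"
  by (auto simp: polys_def expos_def)

lemma polys_add: "p \<in> polys d \<Longrightarrow> q \<in> polys d \<Longrightarrow> p + q \<in> polys d"
  unfolding polys_def using keys_add[of p q] by auto

lemma polys_uminus: "p \<in> polys d \<Longrightarrow> - p \<in> polys d"
  by (simp add: polys_def)

lemma polys_diff: "p \<in> polys d \<Longrightarrow> q \<in> polys d \<Longrightarrow> p - q \<in> polys d"
  using polys_add[of p d "- q"] polys_uminus[of q d] by simp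

lemma polys_sum: "(\<And>i. i \<in> A \<Longrightarrow> f i \<in> polys d) \<Longrightarrow> sum f A \<in> polys d"
  by (induction A rule: infinite_finite_induct) (auto intro: polys_add)

lemma polys_mult:
  assumes "p \<in> polys d" "q \<in> polys e"
  shows "p * q \<in> polys (d + e)"
  using keys_mult[of p q] assms unfolding polys_def expos_def by (fastforce simp: mdeg_add)

lemma polys_mult_le: "p \<in> polys d \<Longrightarrow> q \<in> polys e \<Longrightarrow> d + e \<le> k \<Longrightarrow> p * q \<in> polys k"
  using polys_mult polys_mono by blast

lemma polys_power2_le: "p \<in> polys d \<Longrightarrow> 2 * d \<le> k \<Longrightarrow> p ^ 2 \<in> polys k"
  unfolding power2_eq_square by (rule polys_mult_le) auto

lemma polys_tdeg: "p \<in> polys (tdeg p)"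
  by (simp add: mem_polys_iff)

lemma isCont_peval: "isCont (peval p) x"
  unfolding peval_def[abs_def] monom_eval_def by (intro continuous_intros)

lemma continuous_on_peval [continuous_intros]: "continuous_on A (peval p)"
  by (simp add: continuous_at_imp_continuous_on isCont_peval)

section \<open>Sums of squares\<close>

lemma SOS_square: "p ^ 2 \<in> SOS"
proof -
  have "p ^ 2 = (\<Sum>i<(1::nat). p ^ 2)" by simp
  then show ?thesis unfolding SOS_def by (intro CollectI exI)
qed

lemma SOS_0 [simp]: "0 \<in> SOS"
  using SOS_square[of 0] by simp

lemma SOS_1 [simp]: "1 \<in> SOS"
  using SOS_square[of 1] by simp

lemma SOS_Const: "r \<ge> 0 \<Longrightarrow> Const r \<in> SOS"
  using SOS_square[of "Const (sqrt r)"] by (simp flip: Const_power)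

lemma SOS_add: 
  assumes "p \<in> SOS" "q \<in> SOS"
  shows "p + q \<in> SOS"
proof -
  obtain N f where p: "p = (\<Sum>i<(N::nat). f i ^ 2)" using assms(1) by (auto simp: SOS_def)
  obtain N' g where q: "q = (\<Sum>i<(N'::nat). g i ^ 2)" using assms(2) by (auto simp: SOS_def)
  define h where "h i = (if i < N then f i else g (i - N))" for i
  have "(\<Sum>i<N + N'. h i ^ 2) = (\<Sum>i<N. h i ^ 2) + (\<Sum>i\<in>{N..<N + N'}. h i ^ 2)"
    by (subst sum.union_disjoint[symmetric]) (auto intro!: sum.cong)
  also have "(\<Sum>i<N. h i ^ 2) = p"
    unfolding p by (rule sum.cong) (auto simp: h_def)
  also have "(\<Sum>i\<in>{N..<N + N'}. h i ^ 2) = (\<Sum>i<N'. h (i + N) ^ 2)"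
    using sum.shift_bounds_nat_ivl[of "\<lambda>i. h i ^ 2" 0 N N'] by (simp add: atLeast0LessThan add.commute)
  also have "\<dots> = q"
    unfolding q by (rule sum.cong) (auto simp: h_def)
  finally show ?thesis unfolding SOS_def by (intro CollectI exI) (rule sym)
qed

lemma SOS_sum: "(\<And>i. i \<in> A \<Longrightarrow> f i \<in> SOS) \<Longrightarrow> sum f A \<in> SOS"
  by (induction A rule: infinite_finite_induct) (auto intro: SOS_add)

lemma SOS_induct [consumes 1, case_names zero add]:
  assumes "p \<in> SOS" and z: "P 0" and a: "\<And>p q. p \<in> SOS \<Longrightarrow> P p \<Longrightarrow> P (p + q ^ 2)"
  shows "P p"
proof -
  obtain N f where p: "p = (\<Sum>i<(N::nat). f i ^ 2)" using assms(1) by (auto simp: SOS_def)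
  have "(\<Sum>i<N. f i ^ 2) \<in> SOS \<and> P (\<Sum>i<N. f i ^ 2)"
    by (induction N) (auto intro: z a SOS_add SOS_square)
  then show ?thesis by (simp add: p)
qed

lemma SOS_mult_square:
  assumes "p \<in> SOS"
  shows "q ^ 2 * p \<in> SOS"
  using assms by (induction rule: SOS_induct)
    (auto simp: distrib_left intro: SOS_add SOS_square[of "q * _", unfolded power_mult_distrib])

lemma SOS_mult: "p \<in> SOS \<Longrightarrow> q \<in> SOS \<Longrightarrow> p * q \<in> SOS"
  by (induction rule: SOS_induct) (auto simp: distrib_right intro: SOS_add SOS_mult_square)

lemma SOS_nonneg: "p \<in> SOS \<Longrightarrow> peval p x \<ge> 0"
  by (induction rule: SOS_induct) auto

section \<open>Formal partial derivatives\<close>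

definition pdiff :: "'n::finite \<Rightarrow> 'n mpoly \<Rightarrow> 'n mpoly" where
  "pdiff i p = (\<Sum>\<alpha>\<in>keys p.
     Poly_Mapping.single (\<alpha> - Poly_Mapping.single i 1) (lookup p \<alpha> * real (lookup \<alpha> i)))"

lemma pdiff_superset:
  assumes "finite A" "keys p \<subseteq> A"
  shows "pdiff i p = (\<Sum>\<alpha>\<in>A.
     Poly_Mapping.single (\<alpha> - Poly_Mapping.single i 1) (lookup p \<alpha> * real (lookup \<alpha> i)))"
  unfolding pdiff_def
  by (rule sum.mono_neutral_left) (use assms in \<open>auto simp: in_keys_iff\<close>)

lemma pdiff_add [simp]: "pdiff i (p + q) = pdiff i p + pdiff i q"
proof -
  let ?A = "keys p \<union> keys q"
  have "pdiff i (p + q) = (\<Sum>\<alpha>\<in>?A.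
     Poly_Mapping.single (\<alpha> - Poly_Mapping.single i 1) (lookup (p + q) \<alpha> * real (lookup \<alpha> i)))"
    by (rule pdiff_superset) (auto simp: keys_add)
  moreover have "pdiff i p = (\<Sum>\<alpha>\<in>?A.
     Poly_Mapping.single (\<alpha> - Poly_Mapping.single i 1) (lookup p \<alpha> * real (lookup \<alpha> i)))"
    by (rule pdiff_superset) auto
  moreover have "pdiff i q = (\<Sum>\<alpha>\<in>?A.
     Poly_Mapping.single (\<alpha> - Poly_Mapping.single i 1) (lookup q \<alpha> * real (lookup \<alpha> i)))"
    by (rule pdiff_superset) auto
  ultimately show ?thesis
    by (simp add: lookup_add distrib_right single_add sum.distrib)
qed

lemma pdiff_single: "pdiff i (Poly_Mapping.single \<alpha> r) =
    Poly_Mapping.single (\<alpha> - Poly_Mapping.single i 1) (r * real (lookup \<alpha> i))"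
  by (simp add: pdiff_def)

lemma pdiff_0 [simp]: "pdiff i 0 = 0"
  by (simp add: pdiff_def)

lemma pdiff_Const [simp]: "pdiff i (Const r) = 0"
  by (simp add: Const_def pdiff_single)

lemma pdiff_Var [simp]: "pdiff i (Var j) = (if i = j then 1 else 0)"
  by (simp add: Var_def pdiff_single lookup_single when_def)

lemma pdiff_mult [simp]: "pdiff i (p * q) = pdiff i p * q + p * pdiff i q"
proof (induction p rule: mpoly_single_induct)
  case (single \<alpha> r)
  show ?case
  proof (induction q rule: mpoly_single_induct)
    case (single \<beta> s)
    let ?e = "Poly_Mapping.single i (1::nat)"
    \<comment> \<open>Truncated subtraction of exponents commutes with addition only when
      \<open>i\<close> occurs in \<gamma>; in the other case the coefficient
      \<open>lookup \<gamma> i\<close> is 0 and both terms vanish.\<close>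
    have shift: "\<gamma> + \<delta> - ?e = (\<gamma> - ?e) + \<delta>" if "lookup \<gamma> i \<noteq> 0" for \<gamma> \<delta> :: "'a expo"
      using that by (intro poly_mapping_eqI)
        (auto simp: lookup_add lookup_minus lookup_single when_def)
    have "Poly_Mapping.single (\<alpha> + \<beta> - ?e) (r * s * real (lookup \<alpha> i)) =
        Poly_Mapping.single ((\<alpha> - ?e) + \<beta>) (r * s * real (lookup \<alpha> i))"
      using shift[of \<alpha> \<beta>] by (cases "lookup \<alpha> i = 0") auto
    moreover have "Poly_Mapping.single (\<alpha> + \<beta> - ?e) (r * s * real (lookup \<beta> i)) =
        Poly_Mapping.single (\<alpha> + (\<beta> - ?e)) (r * s * real (lookup \<beta> i))"
      using shift[of \<beta> \<alpha>] by (cases "lookup \<beta> i = 0") (auto simp: add.commute)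
    ultimately show ?case
      by (simp add: mult_single pdiff_single lookup_add distrib_left single_add mult.assoc mult.left_commute
           mult.commute[of s])
  qed (simp add: algebra_simps)
qed (simp add: algebra_simps)

lemma pdiff_uminus [simp]: "pdiff i (- p) = - pdiff i p"
proof -
  have "pdiff i (- p) + pdiff i p = 0"
    unfolding pdiff_add[symmetric] by simp
  then show ?thesis by (simp add: eq_neg_iff_add_eq_0)
qed

lemma pdiff_diff [simp]: "pdiff i (p - q) = pdiff i p - pdiff i q"
  using pdiff_add[of i p "- q"] by simp

lemma pdiff_sum [simp]: "pdiff i (sum f A) = (\<Sum>j\<in>A. pdiff i (f j))"
  by (induction A rule: infinite_finite_induct) simp_all

text \<open>Connects the formal derivative with the analytic one, so that the gradients and Hessians
  of the optimality conditions become coefficients in polynomial identities.\<close>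

lemma has_derivative_peval:
  "(peval p has_derivative (\<lambda>v. \<Sum>i\<in>UNIV. peval (pdiff i p) x * v $ i)) (at x)"
proof (induction p rule: mpoly_induct)
  case (Const r)
  have "peval (Const r) = (\<lambda>_. r)" by auto
  then show ?case by simp
next
  case (Var i)
  have "peval (Var i) = (\<lambda>x. x $ i)" by auto
  moreover have "(\<Sum>j\<in>UNIV. peval (pdiff j (Var i)) x * v $ j) = v $ i" for v
    by (simp add: if_distrib[of "\<lambda>p. peval p x"] if_distrib[of "\<lambda>r. r * _"] cong: if_cong)
  ultimately show ?case
    by (auto intro: bounded_linear.has_derivative[OF bounded_linear_vec_nth has_derivative_ident])
next
  case (add p q)
  have "peval (p + q) = (\<lambda>x. peval p x + peval q x)" by auto
  then show ?case
    using has_derivative_add[OF add] by (simp add: sum.distrib distrib_right)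
next
  case (mult p q)
  have "peval (p * q) = (\<lambda>x. peval p x * peval q x)" by auto
  then show ?case
    using has_derivative_mult[OF mult]
    by (simp add: sum.distrib algebra_simps sum_distrib_left)
qed

lemma grad_peval: "grad (peval p) x $ i = peval (pdiff i p) x"
proof -
  have "frechet_derivative (peval p) (at x) = (\<lambda>v. \<Sum>i\<in>UNIV. peval (pdiff i p) x * v $ i)"
    by (rule frechet_derivative_at[OF has_derivative_peval, symmetric])
  then show ?thesis
    by (simp add: grad_def axis_def if_distrib[of "\<lambda>r. _ * r"] cong: if_cong)
qed

lemma hessian_peval: "hessian (peval p) x $ i $ j = peval (pdiff j (pdiff i p)) x"
proof -
  have "(\<lambda>x. grad (peval p) x $ i) = peval (pdiff i p)"
    by (auto simp: grad_peval)
  moreover have "frechet_derivative (peval (pdiff i p)) (at x) (axis j 1) = grad (peval (pdiff i p)) x $ j"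
    by (simp add: grad_def)
  ultimately show ?thesis
    by (simp add: hessian_def grad_peval)
qed

section \<open>Bernstein expansion on a box\<close>

lemma Const_prod: "Const (prod f A) = (\<Prod>x\<in>A. Const (f x))"
  by (induction A rule: infinite_finite_induct) (simp_all add: Const_mult)

lemma Const_of_nat: "Const (of_nat k) = of_nat k"
  by (induction k) (simp_all add: Const_add)

text \<open>Stated with real subtraction so that it also covers \<open>k > j\<close>, where both
  sides are 0.\<close>

lemma binomial_ratio_step:
  "real (j choose Suc k) * real (Suc k) = (real j - real k) * real (j choose k)"
proof (cases "k \<le> j")
  case True
  have "Suc k * (j choose Suc k) = (j - k) * (j choose k)"
    using binomial_absorption[of k "j"] binomial_absorb_comp[of j k] by (cases j) auto
  then have "real (Suc k * (j choose Suc k)) = real ((j - k) * (j choose k))" by simp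
  then show ?thesis using True by (simp only: of_nat_mult of_nat_diff) (simp add: mult.commute)
qed (simp add: binomial_eq_0)

text \<open>The ratio is the \<open>j\<close>-th Bernstein coefficient of \<open>z ^ k\<close>, and
  \<open>(j / N) ^ k\<close> is the value at the node. Raising \<open>k\<close> by one multiplies
  the ratio by \<open>(j - k) / (N - k)\<close>, which differs from \<open>j / N\<close> by at most
  \<open>k / (N - k)\<close>, uniformly in \<open>j\<close>.\<close>

lemma binomial_ratio_tendsto:
  assumes "\<epsilon> > (0::real)"
  shows "\<forall>\<^sub>F N in sequentially. \<forall>j\<le>N. \<bar>real (j choose k) / real (N choose k) - (real j / real N) ^ k\<bar> \<le> \<epsilon>"
  using assms
proof (induction k arbitrary: \<epsilon>)
  case 0
  then show ?case by simp
next
  case (Suc k)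
  have 1: "\<forall>\<^sub>F N in sequentially. \<forall>j\<le>N. \<bar>real (j choose k) / real (N choose k) - (real j / real N) ^ k\<bar> \<le> \<epsilon> / 2"
    by (rule Suc.IH) (use Suc.prems in simp)
  have "(\<lambda>N. real k / (real N - real k)) \<longlonglongrightarrow> 0"
    by real_asymp
  then have 2: "\<forall>\<^sub>F N in sequentially. real k / (real N - real k) < \<epsilon> / 2"
    by (rule order_tendstoD) (use Suc.prems in simp)
  have 3: "\<forall>\<^sub>F N in sequentially. N > 2 * k + 1" by (rule eventually_gt_at_top)
  from 1 2 3 show ?case
  proof eventually_elim
    case (elim N)
    show ?case
    proof (intro allI impI)
      fix j assume j: "j \<le> N"
      define r where "r = real (j choose k) / real (N choose k)"
      define s where "s = (real j - real k) / (real N - real k)"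
      define x where "x = real j / real N"
      have Npos: "real (N choose k) > 0" "real (N choose Suc k) > 0" "real N > real k"
        using elim(3) by (auto simp: binomial_eq_0_iff)
      have step: "real (j choose Suc k) / real (N choose Suc k) = r * s"
      proof -
        have "real (j choose Suc k) = (real j - real k) * real (j choose k) / real (Suc k)"
          using binomial_ratio_step[of j k] by (simp add: field_simps)
        moreover have "real (N choose Suc k) = (real N - real k) * real (N choose k) / real (Suc k)"
          using binomial_ratio_step[of N k] by (simp add: field_simps)
        ultimately show ?thesis unfolding r_def s_def by (simp add: mult.commute)
      qed
      have s1: "\<bar>s\<bar> \<le> 1"
        unfolding s_def using j elim(3) by (auto simp: abs_le_iff field_simps)
      have x1: "0 \<le> x" "x \<le> 1" unfolding x_def using j elim(3) by auto
      have "s - x = - (real k * (1 - x) / (real N - real k))"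
        unfolding s_def x_def using elim(3) by (simp add: field_simps)
      then have "\<bar>s - x\<bar> = real k * (1 - x) / (real N - real k)"
        using x1 Npos by simp
      also have "\<dots> \<le> real k / (real N - real k)"
        using x1 Npos by (intro divide_right_mono mult_left_le) auto
      finally have sx: "\<bar>s - x\<bar> \<le> \<epsilon> / 2" using elim(2) by linarith
      have rx: "\<bar>r - x ^ k\<bar> \<le> \<epsilon> / 2"
        using elim(1) j by (simp add: r_def x_def)
      have "r * s - x ^ Suc k = (r - x ^ k) * s + x ^ k * (s - x)"
        by (simp add: algebra_simps)
      also have "\<bar>\<dots>\<bar> \<le> \<bar>r - x ^ k\<bar> * \<bar>s\<bar> + x ^ k * \<bar>s - x\<bar>"
        using abs_triangle_ineq[of "(r - x ^ k) * s" "x ^ k * (s - x)"] x1 by (simp add: abs_mult)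
      also have "\<dots> \<le> \<epsilon> / 2 * 1 + 1 * (\<epsilon> / 2)"
        using s1 sx rx x1 Suc.prems by (intro add_mono mult_mono) (auto simp: power_le_one)
      finally show "\<bar>real (j choose Suc k) / real (N choose Suc k) - (real j / real N) ^ Suc k\<bar> \<le> \<epsilon>"
        by (simp add: step x_def)
    qed
  qed
qed

text \<open>Multiply \<open>z ^ k\<close> by \<open>(z + (1 - z)) ^ (N - k) = 1\<close> and expand.
  The identity \<open>choose_mult\<close> rewrites the coefficient
  \<open>(N - k) choose (j - k)\<close> as the stated ratio times \<open>N choose j\<close>.\<close>

lemma power_Bernstein_expansion:
  fixes z :: "'n::finite mpoly"
  assumes "k \<le> N"
  shows "z ^ k = (\<Sum>j\<le>N. Const (real (j choose k) / real (N choose k)) *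
    (Const (real (N choose j)) * z ^ j * (1 - z) ^ (N - j)))"
proof -
  have Nk: "real (N choose k) > 0" using assms by (simp add: binomial_eq_0_iff)
  have coef: "real (j choose k) / real (N choose k) * real (N choose j)
      = (if j < k then 0 else real ((N - k) choose (j - k)))" if "j \<le> N" for j
  proof (cases "j < k")
    case False
    then have "(N choose j) * (j choose k) = (N choose k) * ((N - k) choose (j - k))"
      using that by (intro choose_mult) auto
    then have "real (N choose j) * real (j choose k) = real (N choose k) * real ((N - k) choose (j - k))"
      by (metis of_nat_mult)
    then show ?thesis using Nk False by (simp add: field_simps)
  qed (simp add: binomial_eq_0)
  have "(\<Sum>j\<le>N. Const (real (j choose k) / real (N choose k)) *
    (Const (real (N choose j)) * z ^ j * (1 - z) ^ (N - j))) =
    (\<Sum>j\<le>N. if j < k then 0 else Const (real ((N - k) choose (j - k))) * z ^ j * (1 - z) ^ (N - j))"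
  proof (rule sum.cong[OF refl])
    fix j assume "j \<in> {..N}"
    then have jN: "j \<le> N" by simp
    have "Const (real (j choose k) / real (N choose k)) * Const (real (N choose j)) =
        (if j < k then 0 else Const (real ((N - k) choose (j - k))) :: 'n mpoly)"
      unfolding Const_mult[symmetric] coef[OF jN] by simp
    then show "Const (real (j choose k) / real (N choose k)) * (Const (real (N choose j)) * z ^ j * (1 - z) ^ (N - j)) =
        (if j < k then 0 else Const (real ((N - k) choose (j - k))) * z ^ j * (1 - z) ^ (N - j))"
      by (simp only: mult.assoc[symmetric]) simp
  qed
  also have "\<dots> = (\<Sum>j\<in>{k..N}. Const (real ((N - k) choose (j - k))) * z ^ j * (1 - z) ^ (N - j))"
    by (rule sum.mono_neutral_cong_right) auto
  also have "\<dots> = (\<Sum>j\<in>{0..N - k}. Const (real ((N - k) choose j)) * z ^ (j + k) * (1 - z) ^ (N - (j + k)))"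
    using sum.shift_bounds_cl_nat_ivl[of "\<lambda>j. Const (real ((N - k) choose (j - k))) * z ^ j * (1 - z) ^ (N - j)" 0 k "N - k"]
      assms by simp
  also have "\<dots> = z ^ k * (\<Sum>j\<le>N - k. of_nat ((N - k) choose j) * z ^ j * (1 - z) ^ (N - k - j))"
    unfolding sum_distrib_left atMost_atLeast0
    by (rule sum.cong) (auto simp: power_add Const_of_nat algebra_simps diff_diff_add add.commute)
  also have "\<dots> = z ^ k * (z + (1 - z)) ^ (N - k)"
    by (simp only: binomial_ring)
  finally show ?thesis by simp
qed

text \<open>Polynomials rewritten in the affine coordinates \<open>z\<close>. Bernstein expansion is
  additive, so sums of monomials give the right induction principle.\<close>

inductive_set monomial_span :: "('n::finite \<Rightarrow> 'n mpoly) \<Rightarrow> 'n mpoly set" for z where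
  mono: "Const r * (\<Prod>i\<in>UNIV. z i ^ \<alpha> i) \<in> monomial_span z"
| add: "p \<in> monomial_span z \<Longrightarrow> q \<in> monomial_span z \<Longrightarrow> p + q \<in> monomial_span z"

lemma monomial_span_mult:
  assumes "p \<in> monomial_span z" "q \<in> monomial_span z"
  shows "p * q \<in> monomial_span z"
  using assms(1)
proof induction
  case (mono r \<alpha>)
  show ?case using assms(2)
  proof induction
    case (mono s \<beta>)
    have "Const r * (\<Prod>i\<in>UNIV. z i ^ \<alpha> i) * (Const s * (\<Prod>i\<in>UNIV. z i ^ \<beta> i)) =
       Const (r * s) * (\<Prod>i\<in>UNIV. z i ^ (\<alpha> i + \<beta> i))"
      by (simp add: Const_mult power_add prod.distrib)
    then show ?case by (simp only: monomial_span.mono)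
  qed (simp add: distrib_left monomial_span.add)
qed (simp add: distrib_right monomial_span.add)

lemma monomial_span_UNIV:
  assumes V: "\<And>i. Var i = Const a * z i + Const b"
  shows "p \<in> monomial_span z"
proof (induction p rule: mpoly_induct)
  case (Const r)
  show ?case using monomial_span.mono[of r z "\<lambda>_. 0"] by simp
next
  case (Var i)
  have "(\<Prod>j\<in>UNIV. z j ^ (if j = i then 1 else 0)) = z i"
    by (simp add: if_distrib[of "\<lambda>k. _ ^ k"] cong: if_cong)
  then show ?case
    unfolding V using monomial_span.add[OF monomial_span.mono[of a z "\<lambda>j. if j = i then 1 else 0"]
      monomial_span.mono[of b z "\<lambda>_. 0"]] by simp
qed (auto intro: monomial_span.add monomial_span_mult)

text \<open>Tensor product Bernstein basis, of degree \<open>N\<close> in every variable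
  separately.\<close>

definition Bernstein_poly :: "('n::finite \<Rightarrow> 'n mpoly) \<Rightarrow> nat \<Rightarrow> ('n \<Rightarrow> nat) \<Rightarrow> 'n mpoly" where
  "Bernstein_poly z N g = (\<Prod>i\<in>UNIV. Const (real (N choose g i)) * z i ^ g i * (1 - z i) ^ (N - g i))"

text \<open>By additivity it is enough to treat a monomial, whose coefficients are products of the
  one-variable ratios. The grid node \<open>pt N g\<close> enters only through its coordinates in
  \<open>z\<close>.\<close>

lemma Bernstein_approx:
  fixes z :: "'n::finite \<Rightarrow> 'n mpoly"
  assumes V: "\<And>i. Var i = Const a * z i + Const b"
    and pt: "\<And>N g i. N > 0 \<Longrightarrow> peval (z i) (pt N g) = real (g i) / real N"
    and "\<epsilon> > (0::real)"
  shows "\<forall>\<^sub>F N in sequentially. \<exists>c. q = (\<Sum>g\<in>UNIV \<rightarrow>\<^sub>E {..N}. Const (c g) * Bernstein_poly z N g) \<and>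
     (\<forall>g\<in>UNIV \<rightarrow>\<^sub>E {..N}. \<bar>c g - peval q (pt N g)\<bar> \<le> \<epsilon>)"
  using monomial_span_UNIV[OF V, of q] \<open>\<epsilon> > 0\<close>
proof (induction arbitrary: \<epsilon>)
  case (add p q)
  have "\<epsilon> / 2 > 0" using add.prems by simp
  from add.IH(1)[OF this] add.IH(2)[OF this] show ?case
  proof eventually_elim
    case (elim N)
    from elim(1) obtain c where
      "p = (\<Sum>g\<in>UNIV \<rightarrow>\<^sub>E {..N}. Const (c g) * Bernstein_poly z N g)"
      "\<forall>g\<in>UNIV \<rightarrow>\<^sub>E {..N}. \<bar>c g - peval p (pt N g)\<bar> \<le> \<epsilon> / 2"
      by (elim exE conjE)
    moreover from elim(2) obtain d where
      "q = (\<Sum>g\<in>UNIV \<rightarrow>\<^sub>E {..N}. Const (d g) * Bernstein_poly z N g)"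
      "\<forall>g\<in>UNIV \<rightarrow>\<^sub>E {..N}. \<bar>d g - peval q (pt N g)\<bar> \<le> \<epsilon> / 2"
      by (elim exE conjE)
    moreover have "\<bar>c g + d g - peval (p + q) x\<bar> \<le> \<epsilon>"
      if "\<bar>c g - peval p x\<bar> \<le> \<epsilon> / 2" "\<bar>d g - peval q x\<bar> \<le> \<epsilon> / 2" for g x
      using that unfolding peval_add by linarith
    moreover have "(\<Sum>g\<in>UNIV \<rightarrow>\<^sub>E {..N}. Const (c g) * Bernstein_poly z N g) +
        (\<Sum>g\<in>UNIV \<rightarrow>\<^sub>E {..N}. Const (d g) * Bernstein_poly z N g) =
        (\<Sum>g\<in>UNIV \<rightarrow>\<^sub>E {..N}. Const (c g + d g) * Bernstein_poly z N g)"
      by (simp only: Const_add distrib_right sum.distrib)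
    ultimately show ?case
      by (intro exI[of _ "\<lambda>g. c g + d g"]) (simp only:, blast)
  qed
next
  case (mono r \<alpha>)
  define n where "n = real CARD('n)"
  have npos: "n > 0" by (simp add: n_def)
  \<comment> \<open>All factors lie in \<open>[0,1]\<close>, so errors of \<delta> in each of the
    \<open>n\<close> factors add up to at most \<open>n * \<delta>\<close> in the product.\<close>
  define \<delta> where "\<delta> = \<epsilon> / (n * (\<bar>r\<bar> + 1))"
  have dpos: "\<delta> > 0" using mono npos by (simp add: \<delta>_def)
  have "\<forall>\<^sub>F N in sequentially. \<forall>i\<in>UNIV. \<forall>j\<le>N.
      \<bar>real (j choose \<alpha> i) / real (N choose \<alpha> i) - (real j / real N) ^ \<alpha> i\<bar> \<le> \<delta>"
    by (rule eventually_ball_finite) (auto intro: binomial_ratio_tendsto dpos)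
  moreover have "\<forall>\<^sub>F N in sequentially. \<forall>i\<in>UNIV. \<alpha> i \<le> N"
    by (rule eventually_ball_finite) (auto intro: eventually_ge_at_top)
  moreover have "\<forall>\<^sub>F N in sequentially. (0::nat) < N" by (rule eventually_gt_at_top)
  ultimately show ?case
  proof eventually_elim
    case (elim N)
    define c where "c g = r * (\<Prod>i\<in>UNIV. real (g i choose \<alpha> i) / real (N choose \<alpha> i))" for g :: "'n \<Rightarrow> nat"
    have "(\<Prod>i\<in>UNIV. z i ^ \<alpha> i) = (\<Prod>i\<in>UNIV. \<Sum>j\<le>N. Const (real (j choose \<alpha> i) / real (N choose \<alpha> i)) *
      (Const (real (N choose j)) * z i ^ j * (1 - z i) ^ (N - j)))"
      by (rule prod.cong[OF refl], rule power_Bernstein_expansion) (use elim in auto)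
    also have "\<dots> = (\<Sum>g\<in>UNIV \<rightarrow>\<^sub>E {..N}. \<Prod>i\<in>UNIV. Const (real (g i choose \<alpha> i) / real (N choose \<alpha> i)) *
      (Const (real (N choose g i)) * z i ^ g i * (1 - z i) ^ (N - g i)))"
      by (rule prod_sum_PiE) auto
    finally have "Const r * (\<Prod>i\<in>UNIV. z i ^ \<alpha> i) =
       (\<Sum>g\<in>UNIV \<rightarrow>\<^sub>E {..N}. Const (c g) * Bernstein_poly z N g)"
      by (simp add: sum_distrib_left c_def Const_mult Const_prod Bernstein_poly_def prod.distrib mult.assoc)
    moreover have "\<bar>c g - peval (Const r * (\<Prod>i\<in>UNIV. z i ^ \<alpha> i)) (pt N g)\<bar> \<le> \<epsilon>"
      if g: "g \<in> UNIV \<rightarrow>\<^sub>E {..N}" for g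
    proof -
      have gN: "g i \<le> N" for i using g by auto
      have "norm ((\<Prod>i\<in>UNIV. real (g i choose \<alpha> i) / real (N choose \<alpha> i)) - (\<Prod>i\<in>UNIV. (real (g i) / real N) ^ \<alpha> i))
        \<le> (\<Sum>i\<in>UNIV. norm (real (g i choose \<alpha> i) / real (N choose \<alpha> i) - (real (g i) / real N) ^ \<alpha> i))"
        using elim gN by (intro norm_prod_diff) (auto intro!: power_le_one simp: divide_le_eq_1 binomial_right_mono)
      also have "\<dots> \<le> (\<Sum>i\<in>(UNIV :: 'n set). \<delta>)"
        using elim gN by (intro sum_mono) simp
      also have "\<dots> = n * \<delta>" by (simp add: n_def)
      finally have *: "\<bar>(\<Prod>i\<in>UNIV. real (g i choose \<alpha> i) / real (N choose \<alpha> i)) - (\<Prod>i\<in>UNIV. (real (g i) / real N) ^ \<alpha> i)\<bar> \<le> n * \<delta>"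
        by simp
      have "\<bar>c g - peval (Const r * (\<Prod>i\<in>UNIV. z i ^ \<alpha> i)) (pt N g)\<bar> = \<bar>r\<bar> *
        \<bar>(\<Prod>i\<in>UNIV. real (g i choose \<alpha> i) / real (N choose \<alpha> i)) - (\<Prod>i\<in>UNIV. (real (g i) / real N) ^ \<alpha> i)\<bar>"
        using elim by (simp add: c_def pt abs_mult flip: right_diff_distrib)
      also have "\<dots> \<le> (\<bar>r\<bar> + 1) * (n * \<delta>)"
        using * by (intro mult_mono) auto
      also have "\<dots> = \<epsilon>" using npos by (simp add: \<delta>_def)
      finally show ?thesis .
    qed
    ultimately show ?case by blast
  qed
qed

text \<open>Semirings containing the nonnegative constants: just what recombines products of linear
  forms with nonnegative coefficients.\<close>

definition cone_ring :: "'n::finite mpoly set \<Rightarrow> bool" where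
  "cone_ring T \<longleftrightarrow> (\<forall>r\<ge>0. Const r \<in> T) \<and> (\<forall>p\<in>T. \<forall>q\<in>T. p + q \<in> T \<and> p * q \<in> T)"

text \<open>Bernstein coefficients approach the values at the grid nodes, so with a positive minimum
  on the box all of them are nonnegative for some \<open>N\<close>; the basis polynomials are
  products of the given linear ones.\<close>

lemma positive_on_box_in_cone_ring:
  fixes q :: "'n::finite mpoly"
  assumes T: "cone_ring T" and R: "R > 0"
    and lin: "\<And>i. Const R + Var i \<in> T" "\<And>i. Const R - Var i \<in> T"
    and pos: "\<And>x. (\<And>i. \<bar>x $ i\<bar> \<le> R) \<Longrightarrow> peval q x > 0"
  shows "q \<in> T"
proof -
  have Tc: "Const r \<in> T" if "r \<ge> 0" for r using T that by (simp add: cone_ring_def)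
  have Ta: "p + p' \<in> T" and Tm: "p * p' \<in> T" if "p \<in> T" "p' \<in> T" for p p'
    using T that by (auto simp: cone_ring_def)
  have T1: "1 \<in> T" and T0: "0 \<in> T" using Tc[of 1] Tc[of 0] by simp_all
  have Tpow: "p ^ k \<in> T" if "p \<in> T" for p k by (induction k) (auto intro: Tm T1 that)
  have Tprod: "prod f A \<in> T" if "\<And>i. i \<in> A \<Longrightarrow> f i \<in> T" for f and A :: "'n set"
    using that by (induction A rule: infinite_finite_induct) (auto intro: Tm T1)
  have Tsum: "sum f A \<in> T" if "\<And>i. i \<in> A \<Longrightarrow> f i \<in> T" for f and A :: "('n \<Rightarrow> nat) set"
    using that by (induction A rule: infinite_finite_induct) (auto intro: Ta T0)
  \<comment> \<open>Affine coordinates that map the box \<open>[-R,R]^n\<close> onto the unit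
    cube.\<close>
  define z where "z i = Const (1 / (2 * R)) * (Const R + Var i)" for i :: 'n
  have z: "z i \<in> T" for i unfolding z_def using R by (intro Tm Tc lin) simp
  have "1 - z i = Const (1 / (2 * R)) * (Const R - Var i)" for i
  proof -
    have "Const (1 / (2 * R)) * (Const R - Var i) + z i = Const (1 / (2 * R)) * Const (2 * R)"
      unfolding z_def by (simp add: Const_mult Const_numeral flip: distrib_left) 
    also have "\<dots> = 1" unfolding Const_mult[symmetric] using R by simp
    finally show ?thesis by (simp add: algebra_simps)
  qed
  then have z': "1 - z i \<in> T" for i using R by (simp only:) (intro Tm Tc lin, simp)
  have V: "Var i = Const (2 * R) * z i + Const (- R)" for i
  proof -
    have "Const (2 * R) * z i = (Const (2 * R) * Const (1 / (2 * R))) * (Const R + Var i)"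
      unfolding z_def by (simp only: mult.assoc)
    also have "Const (2 * R) * Const (1 / (2 * R)) = (1 :: 'n mpoly)"
      unfolding Const_mult[symmetric] using R by simp
    finally show ?thesis by (simp add: Const_uminus)
  qed
  define pt :: "nat \<Rightarrow> ('n \<Rightarrow> nat) \<Rightarrow> real ^ 'n" where "pt N g = (\<chi> i. R * (2 * (real (g i) / real N) - 1))" for N g
  have pt: "peval (z i) (pt N g) = real (g i) / real N" for N g i
    using R by (simp add: z_def pt_def field_simps)
  define B :: "(real ^ 'n) set" where "B = cbox (\<chi> i. - R) (\<chi> i. R)"
  have B: "x \<in> B \<longleftrightarrow> (\<forall>i. \<bar>x $ i\<bar> \<le> R)" for x
    by (auto simp: B_def mem_box_cart abs_le_iff minus_le_iff)
  have "0 \<in> B" using R by (simp add: B)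
  then obtain x0 where x0: "x0 \<in> B" "\<And>x. x \<in> B \<Longrightarrow> peval q x0 \<le> peval q x"
    using continuous_attains_inf[of B "peval q"] by (auto simp: B_def continuous_on_peval)
  define \<delta> where "\<delta> = peval q x0"
  have "\<delta> > 0" unfolding \<delta>_def using x0 B pos by blast
  from Bernstein_approx[OF V pt this, of q]
  have "\<forall>\<^sub>F N in sequentially. N > 0 \<and> (\<exists>c. q = (\<Sum>g\<in>UNIV \<rightarrow>\<^sub>E {..N}. Const (c g) * Bernstein_poly z N g) \<and>
     (\<forall>g\<in>UNIV \<rightarrow>\<^sub>E {..N}. \<bar>c g - peval q (pt N g)\<bar> \<le> \<delta>))"
    by (intro eventually_conj eventually_gt_at_top)
  from eventually_happens'[OF sequentially_bot this] obtain N c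
    where N: "N > 0" and c: "q = (\<Sum>g\<in>UNIV \<rightarrow>\<^sub>E {..N}. Const (c g) * Bernstein_poly z N g)"
      "\<forall>g\<in>UNIV \<rightarrow>\<^sub>E {..N}. \<bar>c g - peval q (pt N g)\<bar> \<le> \<delta>"
    by (elim exE conjE)
  have "c g \<ge> 0" if g: "g \<in> UNIV \<rightarrow>\<^sub>E {..N}" for g
  proof -
    have "real (g i) / real N \<le> 1" for i using g N by (auto simp: divide_le_eq_1)
    then have "\<bar>2 * (real (g i) / real N) - 1\<bar> \<le> 1" for i
    proof -
      have "2 * (real (g i) / real N) \<le> 2 * 1"
        using \<open>\<And>i. real (g i) / real N \<le> 1\<close> by (intro mult_left_mono) auto
      then show ?thesis by (simp add: abs_le_iff)
    qed
    then have "pt N g \<in> B"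
      unfolding B pt_def using R by (simp add: abs_mult mult_left_le)
    from x0(2)[OF this] bspec[OF c(2) g] show ?thesis unfolding \<delta>_def by linarith
  qed
  moreover have "Bernstein_poly z N g \<in> T" for g
    unfolding Bernstein_poly_def by (intro Tprod Tm Tc Tpow z z') simp
  ultimately show ?thesis
    by (subst c(1)) (intro Tsum Tm Tc)
qed

section \<open>Putinar's Positivstellensatz\<close>

text \<open>Closure under nonnegative scalars is included, as such a scalar is the square of a
  constant.\<close>

definition quadratic_module :: "'n::finite mpoly set \<Rightarrow> bool" where
  "quadratic_module M \<longleftrightarrow> 1 \<in> M \<and> (\<forall>p\<in>M. \<forall>q\<in>M. p + q \<in> M) \<and> (\<forall>p\<in>M. \<forall>q. q ^ 2 * p \<in> M)"

lemma qm_add: "quadratic_module M \<Longrightarrow> p \<in> M \<Longrightarrow> q \<in> M \<Longrightarrow> p + q \<in> M"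
  by (simp add: quadratic_module_def)

lemma qm_square_mult: "quadratic_module M \<Longrightarrow> p \<in> M \<Longrightarrow> q ^ 2 * p \<in> M"
  by (simp add: quadratic_module_def)

lemma qm_0: "quadratic_module M \<Longrightarrow> 0 \<in> M"
  using qm_square_mult[of M 1 0] by (simp add: quadratic_module_def)

lemma qm_SOS_mult:
  assumes M: "quadratic_module M" "p \<in> M" and q: "q \<in> SOS"
  shows "q * p \<in> M"
  using q by (induction rule: SOS_induct)
    (auto simp: distrib_right intro: qm_0 qm_add qm_square_mult M)

lemma qm_SOS: "quadratic_module M \<Longrightarrow> q \<in> SOS \<Longrightarrow> q \<in> M"
  using qm_SOS_mult[of M 1 q] by (simp add: quadratic_module_def)

lemma qm_Const_mult: "quadratic_module M \<Longrightarrow> p \<in> M \<Longrightarrow> r \<ge> 0 \<Longrightarrow> Const r * p \<in> M"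
  by (intro qm_SOS_mult SOS_Const)

lemma qm_sum: "quadratic_module M \<Longrightarrow> (\<And>i. i \<in> A \<Longrightarrow> f i \<in> M) \<Longrightarrow> sum f A \<in> M"
  by (induction A rule: infinite_finite_induct) (auto intro: qm_0 qm_add)

definition qm_set :: "'n::finite mpoly set \<Rightarrow> (real ^ 'n) set" where
  "qm_set M = {x. \<forall>p\<in>M. peval p x \<ge> 0}"

lemma closed_qm_set: "closed (qm_set M)"
proof -
  have "qm_set M = (\<Inter>p\<in>M. {x. 0 \<le> peval p x})" by (auto simp: qm_set_def)
  then show ?thesis
    by (simp add: closed_INT closed_Collect_le continuous_on_peval)
qed

text \<open>With a single generator the quadratic module is closed under products, because
  \<open>g * g\<close> is a square. This brings the semiring argument for the box to bear on a
  quadratic module.\<close>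

lemma cone_ring_single_generator: "cone_ring {s + g * t | s t. s \<in> SOS \<and> t \<in> SOS}"
  unfolding cone_ring_def
proof (intro conjI allI impI ballI)
  fix r :: real assume "r \<ge> 0"
  then show "Const r \<in> {s + g * t | s t. s \<in> SOS \<and> t \<in> SOS}"
    by (intro CollectI exI[of _ "Const r"] exI[of _ 0]) (simp add: SOS_Const)
next
  fix p q assume "p \<in> {s + g * t | s t. s \<in> SOS \<and> t \<in> SOS}" "q \<in> {s + g * t | s t. s \<in> SOS \<and> t \<in> SOS}"
  then obtain s t s' t' where p: "p = s + g * t" "s \<in> SOS" "t \<in> SOS"
    and q: "q = s' + g * t'" "s' \<in> SOS" "t' \<in> SOS" by auto
  have "p + q = (s + s') + g * (t + t')"
    by (simp add: p q algebra_simps)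
  then show "p + q \<in> {s + g * t | s t. s \<in> SOS \<and> t \<in> SOS}"
    using p q by (blast intro: SOS_add)
  have "p * q = (s * s' + g ^ 2 * (t * t')) + g * (s * t' + t * s')"
    by (simp add: p q algebra_simps power2_eq_square)
  then show "p * q \<in> {s + g * t | s t. s \<in> SOS \<and> t \<in> SOS}"
    using p q by (blast intro: SOS_add SOS_mult SOS_mult_square)
qed

text \<open>Completing the square: \<open>N + 1 + x_i\<close> is the sum of \<open>3/4\<close>,
  \<open>(1/2 + x_i)^2\<close>, the squares of the other variables and \<open>N - |x|^2\<close>;
  likewise with \<open>- x_i\<close>. Hence the box of half-width \<open>N + 1\<close> in the
  positivity theorem.\<close>

lemma linear_in_ball_cone:
  fixes i :: "'n::finite"
  assumes "N \<ge> 0" "\<sigma> = 1 \<or> \<sigma> = -1"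
  defines "g \<equiv> Const N - (\<Sum>i\<in>UNIV. Var i ^ 2 :: 'n mpoly)"
  shows "Const (N + 1) + Const \<sigma> * Var i \<in> {s + g * t | s t. s \<in> SOS \<and> t \<in> SOS}"
proof -
  define s where "s = Const (3 / 4) + (Const (1 / 2) + Const \<sigma> * Var i) ^ 2 + (\<Sum>j\<in>UNIV - {i}. Var j ^ 2 :: 'n mpoly)"
  have "(\<Sum>i\<in>UNIV. Var i ^ 2 :: 'n mpoly) = Var i ^ 2 + (\<Sum>j\<in>UNIV - {i}. Var j ^ 2)"
    by (simp add: sum.remove[of _ i])
  moreover have "(Const (1 / 2) + Const \<sigma> * Var i) ^ 2 = Const (1 / 4) + Const \<sigma> * Var i + (Var i ^ 2 :: 'n mpoly)"
  proof -
    have "(Const (1 / 2) + Const \<sigma> * Var i) ^ 2 =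
      Const (1 / 2) * Const (1 / 2) + (Const (1/2) + Const (1/2)) * Const \<sigma> * Var i + Const \<sigma> * Const \<sigma> * (Var i ^ 2 :: 'n mpoly)"
      by (simp add: power2_eq_square algebra_simps)
    then show ?thesis
      using assms(2) by (auto simp flip: Const_mult Const_add)
  qed
  moreover have "Const (N + 1) = Const N + Const (3/4) + (Const (1 / 4) :: 'n mpoly)"
    by (simp add: add.commute flip: Const_add)
  ultimately have "Const (N + 1) + Const \<sigma> * Var i = s + g * 1"
    unfolding s_def g_def by simp
  moreover have "s \<in> SOS"
    unfolding s_def by (intro SOS_add SOS_sum SOS_square SOS_Const) simp
  ultimately show ?thesis
    by (intro CollectI exI[of _ s] exI[of _ 1]) simp
qed

text \<open>Bernoulli gives \<open>1 + k t \<le> (1 + t) ^ k\<close>, and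
  \<open>(1 - t) ^ k * (1 + t) ^ k = (1 - t^2) ^ k \<le> 1\<close>.\<close>

lemma one_minus_power_bound:
  fixes t :: real
  assumes "0 \<le> t" "t \<le> 1"
  shows "(1 - t) ^ k * t \<le> 1 / (real k + 1)"
proof -
  have "(1 - t) ^ k * (1 + real k * t) \<le> (1 - t) ^ k * (1 + t) ^ k"
    using Bernoulli_inequality[of t k] assms by (intro mult_left_mono) auto
  also have "\<dots> = (1 - t\<^sup>2) ^ k"
    by (simp add: power2_eq_square algebra_simps flip: power_mult_distrib)
  also have "\<dots> \<le> 1" using assms by (intro power_le_one) (auto simp: power_le_one)
  finally have 1: "(1 - t) ^ k * (1 + real k * t) \<le> 1" .
  have "(1 - t) ^ k * t * (real k + 1) = (1 - t) ^ k * (real k * t + t)" by (simp add: algebra_simps)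
  also have "\<dots> \<le> (1 - t) ^ k * (1 + real k * t)" using assms by (intro mult_left_mono) auto
  finally have "(1 - t) ^ k * t * (real k + 1) \<le> 1" using 1 by linarith
  then show ?thesis by (simp add: pos_le_divide_eq)
qed

text \<open>Generators that are negative somewhere on the box are traded for a polynomial positive on
  the whole box: \<open>(1 - g)\<^sup>2\<^sup>k g\<close> is tiny where \<open>g \<ge> 0\<close> and at most \<open>g\<close> where \<open>g < 0\<close>.\<close>

theorem Putinar_Positivstellensatz:
  fixes M :: "'n::finite mpoly set"
  assumes M: "quadratic_module M" and arch: "Const N - (\<Sum>i\<in>UNIV. Var i ^ 2) \<in> M" and N: "N > 0"
    and pos: "\<And>x. x \<in> qm_set M \<Longrightarrow> peval p x > 0"
  shows "p \<in> M"
proof -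
  define g0 where "g0 = Const N - (\<Sum>i\<in>UNIV. Var i ^ 2 :: 'n mpoly)"
  define T where "T = {s + g0 * t | s t. s \<in> SOS \<and> t \<in> SOS}"
  have TM: "T \<subseteq> M"
    unfolding T_def using qm_SOS_mult[OF M arch] by (auto simp: g0_def mult.commute intro!: qm_add[OF M] intro: qm_SOS[OF M])
  define R where "R = N + 1"
  define B :: "(real ^ 'n) set" where "B = cbox (\<chi> i. - R) (\<chi> i. R)"
  have B: "x \<in> B \<longleftrightarrow> (\<forall>i. \<bar>x $ i\<bar> \<le> R)" for x
    by (auto simp: B_def mem_box_cart abs_le_iff minus_le_iff)
  have cB: "compact B" by (simp add: B_def)
  have inM: "q \<in> M" if "\<And>x. x \<in> B \<Longrightarrow> peval q x > 0" for q
  proof -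
    have "q \<in> T"
    proof (rule positive_on_box_in_cone_ring)
      show "cone_ring T" unfolding T_def by (rule cone_ring_single_generator)
      show "R > 0" using N by (simp add: R_def)
      show "Const R + Var i \<in> T" for i
        using linear_in_ball_cone[of N 1 i] N by (simp add: T_def R_def g0_def)
      show "Const R - Var i \<in> T" for i
        using linear_in_ball_cone[of N "-1" i] N by (simp add: T_def R_def g0_def Const_uminus)
    qed (use that B in auto)
    with TM show ?thesis by blast
  qed
  define A where "A = B \<inter> {x. peval p x \<le> 0}"
  have cA: "compact A" unfolding A_def
    by (intro compact_Int_closed cB closed_Collect_le continuous_intros)
  \<comment> \<open>A point of the box with \<open>p \<le> 0\<close> lies outside
    \<open>qm_set M\<close>, so some element of \<open>M\<close> is negative there; compactness
    leaves finitely many of them.\<close>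
  have cover: "A \<subseteq> (\<Union>g\<in>M. {x. peval g x < 0})"
    using pos by (force simp: A_def qm_set_def not_le)
  have "open {x. peval g x < 0}" for g :: "'n mpoly"
    by (intro open_Collect_less continuous_intros)
  then obtain F where F: "F \<subseteq> M" "finite F" "A \<subseteq> (\<Union>g\<in>F. {x. peval g x < 0})"
    by (rule compactE_image[OF cA _ cover])
  have "\<exists>s>0. \<forall>x\<in>B. s * peval g x \<le> 1" for g
  proof -
    have "bounded (peval g ` B)"
      by (intro compact_imp_bounded compact_continuous_image cB continuous_on_peval)
    then obtain b where "b > 0" "\<forall>x\<in>B. \<bar>peval g x\<bar> \<le> b"
      unfolding bounded_pos by auto
    then show ?thesis
      by (intro exI[of _ "1 / b"]) (auto simp: divide_le_eq abs_le_iff)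
  qed
  then obtain s where s: "\<And>g. s g > 0" "\<And>g x. x \<in> B \<Longrightarrow> s g * peval g x \<le> 1" by metis
  \<comment> \<open>The scaling makes \<open>h g \<le> 1\<close> on the box, so that
    \<open>0 \<le> 1 - h g \<le> 1\<close> wherever \<open>h g \<ge> 0\<close>.\<close>
  define h where "h g = Const (s g) * g" for g
  have h1: "peval (h g) x \<le> 1" if "x \<in> B" for g x using s that by (simp add: h_def)
  have hM: "h g \<in> M" if "g \<in> F" for g
    unfolding h_def using that F s by (intro qm_Const_mult[OF M]) (auto intro: less_imp_le)
  define S where "S k x = (\<Sum>g\<in>F. (1 - peval (h g) x) ^ (2 * k) * peval (h g) x)" for k x
  define m where "m = real (card F)"
  have term_le: "(1 - peval (h g) x) ^ (2 * k) * peval (h g) x \<le> 1 / (2 * real k + 1)" if "x \<in> B" for g k x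
  proof (cases "peval (h g) x \<ge> 0")
    case True
    then show ?thesis using one_minus_power_bound[of "peval (h g) x" "2 * k"] h1[OF that] by simp
  next
    case False
    then have "(1 - peval (h g) x) ^ (2 * k) * peval (h g) x \<le> 0"
      by (intro mult_nonneg_nonpos) auto
    also have "\<dots> \<le> 1 / (2 * real k + 1)" by simp
    finally show ?thesis .
  qed
  have S_le: "S k x \<le> m / (2 * real k + 1)" if "x \<in> B" for k x
    using sum_bounded_above[of F "\<lambda>g. (1 - peval (h g) x) ^ (2 * k) * peval (h g) x" "1 / (2 * real k + 1)"]
      term_le[OF that] by (simp add: S_def m_def)
  have S_le': "S k x \<le> m / (2 * real k + 1) + peval (h g) x" if "x \<in> B" "g \<in> F" "peval (h g) x < 0" for k x g
  proof -
    have "(1 - peval (h g) x) ^ (2 * k) * peval (h g) x \<le> 1 * peval (h g) x"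
      using that(3) by (intro mult_right_mono_neg one_le_power) auto
    moreover have "(\<Sum>g\<in>F - {g}. (1 - peval (h g) x) ^ (2 * k) * peval (h g) x) \<le> m / (2 * real k + 1)"
    proof -
      have "(\<Sum>g\<in>F - {g}. (1 - peval (h g) x) ^ (2 * k) * peval (h g) x) \<le> real (card (F - {g})) * (1 / (2 * real k + 1))"
        by (rule sum_bounded_above) (rule term_le[OF that(1)])
      also have "\<dots> \<le> m * (1 / (2 * real k + 1))"
        unfolding m_def using F(2) by (intro mult_right_mono) (auto intro: card_mono simp: card_Diff1_le)
      finally show ?thesis by simp
    qed
    ultimately show ?thesis
      unfolding S_def using F(2) that(2) by (simp add: sum.remove[of F g])
  qed
  \<comment> \<open>Positive on the whole box: either \<open>p > 0\<close> or some
    \<open>h g < 0\<close>. Its minimum \<epsilon> makes this alternative uniform.\<close>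
  define \<phi> where "\<phi> x = Max (insert (peval p x) ((\<lambda>g. - peval (h g) x) ` F))" for x
  have \<phi>cont: "continuous_on B \<phi>"
  proof -
    have "continuous_on B (\<lambda>x. Max (insert (peval p x) ((\<lambda>g. - peval (h g) x) ` G)))" if "finite G" for G
      using that
    proof (induction G)
      case (insert a G)
      have "Max (insert (peval p x) ((\<lambda>g. - peval (h g) x) ` insert a G)) =
          max (- peval (h a) x) (Max (insert (peval p x) ((\<lambda>g. - peval (h g) x) ` G)))" for x
        using insert.hyps by (subst image_insert, subst insert_commute, intro Max_insert) auto
      then show ?case using insert.IH by (simp add: continuous_intros)
    qed (simp add: continuous_on_peval)
    then show ?thesis unfolding \<phi>_def using F(2) by blast
  qed
  have \<phi>pos: "\<phi> x > 0" if "x \<in> B" for x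
  proof (cases "peval p x > 0")
    case True
    then show ?thesis unfolding \<phi>_def using F(2) by (subst Max_gr_iff) auto
  next
    case False
    then have "x \<in> A" using that by (simp add: A_def)
    then obtain g where g: "g \<in> F" "peval g x < 0" using F(3) by auto
    then have "peval (h g) x < 0" using s by (simp add: h_def mult_pos_neg)
    then show ?thesis unfolding \<phi>_def using F(2) g by (subst Max_gr_iff) auto
  qed
  have "0 \<in> B" using N by (simp add: B R_def)
  then obtain x0 where x0: "x0 \<in> B" "\<And>x. x \<in> B \<Longrightarrow> \<phi> x0 \<le> \<phi> x"
    using continuous_attains_inf[OF cB _ \<phi>cont] by blast
  define \<epsilon> where "\<epsilon> = \<phi> x0"
  have \<epsilon>: "\<epsilon> > 0" "\<And>x. x \<in> B \<Longrightarrow> \<epsilon> \<le> \<phi> x" using \<phi>pos x0 by (auto simp: \<epsilon>_def)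
  have "bounded (peval p ` B)"
    by (intro compact_imp_bounded compact_continuous_image cB continuous_on_peval)
  then obtain b where b: "b > 0" "\<And>x. x \<in> B \<Longrightarrow> \<bar>peval p x\<bar> \<le> b"
    unfolding bounded_pos by auto
  \<comment> \<open>\<open>lam * \<epsilon> = b + \<epsilon>\<close>: where some
    \<open>h g \<le> - \<epsilon>\<close>, the term of \<open>g\<close> pushes \<open>- q\<close>
    above the bound \<open>b\<close> of \<open>\<bar>p\<bar>\<close>, while a large \<open>k\<close>
    keeps \<open>q < \<epsilon>\<close> where \<open>p \<ge> \<epsilon>\<close>.\<close>
  define lam where "lam = (b + \<epsilon>) / \<epsilon>"
  have lam: "lam > 0" using b \<epsilon> by (simp add: lam_def)
  have "(\<lambda>k. lam * (m / (2 * real k + 1))) \<longlonglongrightarrow> 0" by real_asymp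
  then have "\<forall>\<^sub>F k in sequentially. lam * (m / (2 * real k + 1)) < \<epsilon>"
    by (rule order_tendstoD) (use \<epsilon> in simp)
  then obtain k where k: "lam * (m / (2 * real k + 1)) < \<epsilon>"
    using eventually_happens'[OF sequentially_bot] by blast
  define q where "q = Const lam * (\<Sum>g\<in>F. ((1 - h g) ^ k) ^ 2 * h g)"
  have qM: "q \<in> M" unfolding q_def
    using lam by (intro qm_Const_mult[OF M] qm_sum[OF M] qm_square_mult[OF M] hM) auto
  have pq: "peval q x = lam * S k x" for x
    by (simp add: q_def S_def power_mult mult.commute[of 2 k])
  have "p - q \<in> M"
  proof (rule inM)
    fix x assume x: "x \<in> B"
    have "\<epsilon> \<le> peval p x \<or> (\<exists>g\<in>F. \<epsilon> \<le> - peval (h g) x)"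
    proof -
      have "\<phi> x \<in> insert (peval p x) ((\<lambda>g. - peval (h g) x) ` F)"
        unfolding \<phi>_def using F(2) by (intro Max_in) auto
      with \<epsilon>(2)[OF x] show ?thesis by auto
    qed
    then show "peval (p - q) x > 0"
    proof
      assume "\<epsilon> \<le> peval p x"
      moreover have "lam * S k x \<le> lam * (m / (2 * real k + 1))"
        using lam S_le[OF x] by (intro mult_left_mono) auto
      ultimately show ?thesis using k by (simp add: pq)
    next
      assume "\<exists>g\<in>F. \<epsilon> \<le> - peval (h g) x"
      then obtain g where g: "g \<in> F" "\<epsilon> \<le> - peval (h g) x" by blast
      then have "S k x \<le> m / (2 * real k + 1) - \<epsilon>"
        using S_le'[OF x g(1), of k] \<epsilon> by linarith
      then have "lam * S k x \<le> lam * (m / (2 * real k + 1) - \<epsilon>)"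
        using lam by (intro mult_left_mono) auto
      also have "\<dots> = lam * (m / (2 * real k + 1)) - (b + \<epsilon>)"
        using \<epsilon> by (simp only: right_diff_distrib) (simp add: lam_def)
      finally show ?thesis using k b(2)[OF x] by (simp add: pq)
    qed
  qed
  from qm_add[OF M this qM] show ?thesis by simp
qed

section \<open>Second order local certificates\<close>

definition coord :: "real ^ 'n::finite \<Rightarrow> 'n \<Rightarrow> 'n mpoly" where
  "coord u a = Var a - Const (u $ a)"

definition norm_poly :: "real ^ 'n::finite \<Rightarrow> 'n mpoly" where
  "norm_poly u = (\<Sum>a\<in>UNIV. coord u a ^ 2)"

definition ord2 :: "real ^ 'n::finite \<Rightarrow> 'n mpoly \<Rightarrow> bool" where
  "ord2 u p \<longleftrightarrow> (\<exists>d. p = (\<Sum>a\<in>UNIV. \<Sum>b\<in>UNIV. coord u a * coord u b * d a b))"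

text \<open>\<open>ord2\<close> and \<open>ord3\<close> describe the square and the cube of the
  maximal ideal at \<open>u\<close>. The cube is written with coefficients vanishing at
  \<open>u\<close>, because these coefficients are what the gluing makes small.\<close>

definition ord3 :: "real ^ 'n::finite \<Rightarrow> 'n mpoly \<Rightarrow> bool" where
  "ord3 u p \<longleftrightarrow> (\<exists>d. p = (\<Sum>a\<in>UNIV. \<Sum>b\<in>UNIV. coord u a * coord u b * d a b) \<and>
     (\<forall>a b. peval (d a b) u = 0))"

lemma peval_coord [simp]: "peval (coord u a) x = x $ a - u $ a"
  by (simp add: coord_def)

lemma peval_norm_poly: "peval (norm_poly u) x = (dist x u)\<^sup>2"
  by (simp add: norm_poly_def dist_norm norm_vec_def L2_set_def sum_nonneg)

lemma norm_poly_SOS: "norm_poly u \<in> SOS"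
  unfolding norm_poly_def by (intro SOS_sum SOS_square)

text \<open>Induction along sums and products keeps the quotients polynomial; prescribing their
  values at \<open>u\<close> identifies the linear term.\<close>

lemma Hadamard:
  "\<exists>g. p = Const (peval p u) + (\<Sum>a\<in>UNIV. coord u a * g a) \<and> (\<forall>a. peval (g a) u = peval (pdiff a p) u)"
proof (induction p rule: mpoly_induct)
  case (Const r)
  show ?case by (rule exI[of _ "\<lambda>_. 0"]) simp
next
  case (Var i)
  show ?case
    by (rule exI[of _ "\<lambda>a. if a = i then 1 else 0"])
      (simp add: coord_def if_distrib[of "\<lambda>p. _ * p"] cong: if_cong)
next
  case (add p q)
  then obtain g h where gh:
    "p = Const (peval p u) + (\<Sum>a\<in>UNIV. coord u a * g a)" "\<forall>a. peval (g a) u = peval (pdiff a p) u"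
    "q = Const (peval q u) + (\<Sum>a\<in>UNIV. coord u a * h a)" "\<forall>a. peval (h a) u = peval (pdiff a q) u"
    by (elim exE conjE)
  then have "p + q = (Const (peval p u) + (\<Sum>a\<in>UNIV. coord u a * g a)) +
      (Const (peval q u) + (\<Sum>a\<in>UNIV. coord u a * h a))"
    by (intro arg_cong2[of _ _ _ _ "(+)"])
  also have "\<dots> = Const (peval (p + q) u) + (\<Sum>a\<in>UNIV. coord u a * (g a + h a))"
    by (simp add: Const_add distrib_left sum.distrib add_ac)
  finally have eq: "p + q = Const (peval (p + q) u) + (\<Sum>a\<in>UNIV. coord u a * (g a + h a))" .
  show ?case
    by (rule exI[of _ "\<lambda>a. g a + h a"], rule conjI, rule eq) (use gh(2,4) in simp)
next
  case (mult p q)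
  then obtain g h where g:
    "p = Const (peval p u) + (\<Sum>a\<in>UNIV. coord u a * g a)" "\<forall>a. peval (g a) u = peval (pdiff a p) u"
    and h: "q = Const (peval q u) + (\<Sum>a\<in>UNIV. coord u a * h a)" "\<forall>a. peval (h a) u = peval (pdiff a q) u"
    by (elim exE conjE)
  have "p * q = Const (peval p u) * q + (\<Sum>a\<in>UNIV. coord u a * g a) * q"
    by (subst g(1)) (rule distrib_right)
  also have "Const (peval p u) * q = Const (peval p u) * Const (peval q u) + Const (peval p u) * (\<Sum>a\<in>UNIV. coord u a * h a)"
    by (subst h(1)) (rule distrib_left)
  finally have "p * q = Const (peval (p * q) u) + (\<Sum>a\<in>UNIV. coord u a * (g a * q + Const (peval p u) * h a))"
    by (simp add: Const_mult distrib_left sum.distrib sum_distrib_left sum_distrib_right mult_ac add_ac)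
  moreover have "\<forall>a. peval (g a * q + Const (peval p u) * h a) u = peval (pdiff a (p * q)) u"
    using g(2) h(2) by simp
  ultimately show ?case
    by (intro exI[of _ "\<lambda>a. g a * q + Const (peval p u) * h a"] conjI)
qed

lemma ord2_0 [simp]: "ord2 u 0"
  unfolding ord2_def by (rule exI[of _ "\<lambda>_ _. 0"]) simp

lemma ord3_0 [simp]: "ord3 u 0"
  unfolding ord3_def by (rule exI[of _ "\<lambda>_ _. 0"]) simp

lemma ord3_imp_ord2: "ord3 u p \<Longrightarrow> ord2 u p"
  by (auto simp: ord2_def ord3_def)

lemma ord2_add: "ord2 u p \<Longrightarrow> ord2 u q \<Longrightarrow> ord2 u (p + q)"
  unfolding ord2_def
proof (elim exE)
  fix d e assume "p = (\<Sum>a\<in>UNIV. \<Sum>b\<in>UNIV. coord u a * coord u b * d a b)"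
    "q = (\<Sum>a\<in>UNIV. \<Sum>b\<in>UNIV. coord u a * coord u b * e a b)"
  then show "\<exists>d. p + q = (\<Sum>a\<in>UNIV. \<Sum>b\<in>UNIV. coord u a * coord u b * d a b)"
    by (intro exI[of _ "\<lambda>a b. d a b + e a b"]) (simp add: distrib_left sum.distrib)
qed

lemma ord3_add: "ord3 u p \<Longrightarrow> ord3 u q \<Longrightarrow> ord3 u (p + q)"
  unfolding ord3_def
proof (elim exE conjE)
  fix d e assume "p = (\<Sum>a\<in>UNIV. \<Sum>b\<in>UNIV. coord u a * coord u b * d a b)"
    "q = (\<Sum>a\<in>UNIV. \<Sum>b\<in>UNIV. coord u a * coord u b * e a b)"
    "\<forall>a b. peval (d a b) u = 0" "\<forall>a b. peval (e a b) u = 0"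
  then show "\<exists>d. p + q = (\<Sum>a\<in>UNIV. \<Sum>b\<in>UNIV. coord u a * coord u b * d a b) \<and> (\<forall>a b. peval (d a b) u = 0)"
    by (intro exI[of _ "\<lambda>a b. d a b + e a b"]) (simp add: distrib_left sum.distrib)
qed

lemma ord3_mult: "ord3 u p \<Longrightarrow> ord3 u (q * p)"
  unfolding ord3_def
proof (elim exE conjE)
  fix d assume "p = (\<Sum>a\<in>UNIV. \<Sum>b\<in>UNIV. coord u a * coord u b * d a b)" "\<forall>a b. peval (d a b) u = 0"
  then show "\<exists>d. q * p = (\<Sum>a\<in>UNIV. \<Sum>b\<in>UNIV. coord u a * coord u b * d a b) \<and> (\<forall>a b. peval (d a b) u = 0)"
    by (intro exI[of _ "\<lambda>a b. q * d a b"]) (simp add: sum_distrib_left mult_ac)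
qed

lemma ord3_uminus: "ord3 u p \<Longrightarrow> ord3 u (- p)"
  using ord3_mult[of u p "-1"] by simp

lemma ord3_diff: "ord3 u p \<Longrightarrow> ord3 u q \<Longrightarrow> ord3 u (p - q)"
  using ord3_add[of u p "- q"] ord3_uminus[of u q] by simp

lemma ord3_sum: "(\<And>i. i \<in> A \<Longrightarrow> ord3 u (f i)) \<Longrightarrow> ord3 u (sum f A)"
  by (induction A rule: infinite_finite_induct) (auto intro: ord3_add)

lemma ord2_mult_vanish: "ord2 u p \<Longrightarrow> peval q u = 0 \<Longrightarrow> ord3 u (p * q)"
  unfolding ord2_def ord3_def
proof (elim exE)
  fix d assume "p = (\<Sum>a\<in>UNIV. \<Sum>b\<in>UNIV. coord u a * coord u b * d a b)" "peval q u = 0"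
  then show "\<exists>d. p * q = (\<Sum>a\<in>UNIV. \<Sum>b\<in>UNIV. coord u a * coord u b * d a b) \<and> (\<forall>a b. peval (d a b) u = 0)"
    by (intro exI[of _ "\<lambda>a b. d a b * q"]) (simp add: sum_distrib_right mult.assoc)
qed

lemma vanish_mult_vanish:
  assumes "peval p u = 0" "peval q u = 0"
  shows "ord2 u (p * q)"
proof -
  obtain g where g: "p = (\<Sum>a\<in>UNIV. coord u a * g a)"
    using Hadamard[of p u] assms by auto
  obtain h where h: "q = (\<Sum>a\<in>UNIV. coord u a * h a)"
    using Hadamard[of q u] assms by auto
  have "p * q = (\<Sum>a\<in>UNIV. \<Sum>b\<in>UNIV. coord u a * coord u b * (g a * h b))"
    unfolding g h sum_product by (intro sum.cong refl) (simp add: mult_ac)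
  then show ?thesis unfolding ord2_def by (rule exI[where x = "\<lambda>a b. g a * h b"])
qed

section \<open>Linear and quadratic forms centred at a point\<close>

definition lin_poly :: "real ^ 'n::finite \<Rightarrow> ('n \<Rightarrow> real) \<Rightarrow> 'n mpoly" where
  "lin_poly u \<beta> = (\<Sum>a\<in>UNIV. Const (\<beta> a) * coord u a)"

definition quad_poly :: "real ^ 'n::finite \<Rightarrow> ('n \<Rightarrow> 'n \<Rightarrow> real) \<Rightarrow> 'n mpoly" where
  "quad_poly u B = (\<Sum>a\<in>UNIV. \<Sum>b\<in>UNIV. Const (B a b) * (coord u a * coord u b))"

definition quad_form :: "('n::finite \<Rightarrow> 'n \<Rightarrow> real) \<Rightarrow> ('n \<Rightarrow> real) \<Rightarrow> real" where
  "quad_form B v = (\<Sum>a\<in>UNIV. \<Sum>b\<in>UNIV. B a b * (v a * v b))"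

lemma peval_lin_poly [simp]: "peval (lin_poly u \<beta>) u = 0"
  by (simp add: lin_poly_def)

lemma ord2_quad_poly: "ord2 u (quad_poly u B)"
  unfolding ord2_def quad_poly_def
  by (rule exI[of _ "\<lambda>a b. Const (B a b)"]) (simp add: mult_ac)

lemma quad_poly_add: "quad_poly u (\<lambda>a b. B a b + C a b) = quad_poly u B + quad_poly u C"
  by (simp add: quad_poly_def Const_add distrib_right sum.distrib)

lemma quad_poly_diff: "quad_poly u (\<lambda>a b. B a b - C a b) = quad_poly u B - quad_poly u C"
  by (simp add: quad_poly_def Const_diff left_diff_distrib sum_subtractf)

lemma quad_poly_scale: "quad_poly u (\<lambda>a b. r * B a b) = Const r * quad_poly u B"
  by (simp add: quad_poly_def Const_mult sum_distrib_left mult.assoc)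

lemma quad_poly_sum: "quad_poly u (\<lambda>a b. \<Sum>i\<in>A. B i a b) = (\<Sum>i\<in>A. quad_poly u (B i))"
proof (induction A rule: infinite_finite_induct)
  case (insert i A)
  then show ?case by (simp add: quad_poly_add)
qed (simp_all add: quad_poly_def)

lemma lin_poly_sum: "lin_poly u (\<lambda>a. \<Sum>i\<in>A. r i * \<beta> i a) = (\<Sum>i\<in>A. Const (r i) * lin_poly u (\<beta> i))"
  unfolding lin_poly_def Const_sum Const_mult sum_distrib_right sum_distrib_left mult.assoc
  by (rule sum.swap)

lemma lin_poly_square: "lin_poly u \<beta> ^ 2 = quad_poly u (\<lambda>a b. \<beta> a * \<beta> b)"
  unfolding lin_poly_def quad_poly_def power2_eq_square sum_product
  by (intro sum.cong refl) (simp add: Const_mult mult_ac)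

lemma norm_poly_quad: "norm_poly u = quad_poly u (\<lambda>a b. if a = b then 1 else 0)"
proof -
  have "(\<Sum>b\<in>UNIV. Const (if a = b then 1 else 0) * (coord u a * coord u b)) = coord u a ^ 2" for a
    by (simp add: if_distrib[of Const] if_distrib[of "\<lambda>p. p * _"] power2_eq_square cong: if_cong)
  then show ?thesis by (simp add: norm_poly_def quad_poly_def)
qed

text \<open>Hadamard's lemma, applied once more to the quotients of its first application.\<close>

lemma Taylor2:
  "\<exists>\<tau>. ord3 u \<tau> \<and> p = Const (peval p u) + lin_poly u (\<lambda>a. peval (pdiff a p) u) +
     quad_poly u (\<lambda>a b. peval (pdiff b (pdiff a p)) u / 2) + \<tau>"
proof -
  obtain g where g: "p = Const (peval p u) + (\<Sum>a\<in>UNIV. coord u a * g a)"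
    "\<And>a. peval (g a) u = peval (pdiff a p) u"
    using Hadamard[of p u] by auto
  have "\<forall>a. \<exists>h. g a = Const (peval (g a) u) + (\<Sum>b\<in>UNIV. coord u b * h b) \<and>
      (\<forall>b. peval (h b) u = peval (pdiff b (g a)) u)"
    using Hadamard by blast
  from choice[OF this] obtain h where
    h: "\<And>a. g a = Const (peval (g a) u) + (\<Sum>b\<in>UNIV. coord u b * h a b)"
    "\<And>a b. peval (h a b) u = peval (pdiff b (g a)) u"
    by blast
  define G where "G a b = peval (pdiff b (g a)) u" for a b
  define \<tau> where "\<tau> = (\<Sum>a\<in>UNIV. \<Sum>b\<in>UNIV. coord u a * coord u b * (h a b - Const (G a b)))"
  have \<tau>: "ord3 u \<tau>"
    unfolding ord3_def \<tau>_def by (rule exI[of _ "\<lambda>a b. h a b - Const (G a b)"]) (simp add: h(2) G_def)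
  have pd: "pdiff i (coord u a) = (if i = a then 1 else 0)" for i a
    by (simp add: coord_def)
  \<comment> \<open>The second quotients need not be symmetric; only \<open>G i j + G j i\<close> is
    determined by \<open>p\<close>, so the quadratic form is symmetrised at the end.\<close>
  have hess: "peval (pdiff j (pdiff i p)) u = G i j + G j i" for i j
  proof -
    have "pdiff i p = g i + (\<Sum>a\<in>UNIV. coord u a * pdiff i (g a))"
      by (subst g(1)) (simp add: pd sum.distrib if_distrib[of "\<lambda>p. p * _"] cong: if_cong)
    then have "pdiff j (pdiff i p) = pdiff j (g i) + (pdiff i (g j) + (\<Sum>a\<in>UNIV. coord u a * pdiff j (pdiff i (g a))))"
      by (simp add: pd sum.distrib if_distrib[of "\<lambda>p. p * _"] cong: if_cong)
    then show ?thesis by (simp add: G_def)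
  qed
  have "p = Const (peval p u) + (\<Sum>a\<in>UNIV. coord u a * (Const (peval (g a) u) + (\<Sum>b\<in>UNIV. coord u b * h a b)))"
    using g(1) h(1) by simp
  also have "(\<Sum>a\<in>UNIV. coord u a * (Const (peval (g a) u) + (\<Sum>b\<in>UNIV. coord u b * h a b))) =
      lin_poly u (\<lambda>a. peval (pdiff a p) u) + (\<Sum>a\<in>UNIV. \<Sum>b\<in>UNIV. coord u a * coord u b * h a b)"
    by (simp add: lin_poly_def g(2) distrib_left sum.distrib sum_distrib_left mult_ac)
  also have "(\<Sum>a\<in>UNIV. \<Sum>b\<in>UNIV. coord u a * coord u b * h a b) = quad_poly u G + \<tau>"
    unfolding \<tau>_def quad_poly_def sum.distrib[symmetric]
    by (intro sum.cong refl) (simp add: algebra_simps)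
  also have "quad_poly u G = quad_poly u (\<lambda>a b. peval (pdiff b (pdiff a p)) u / 2)"
  proof -
    have sym: "quad_poly u G = quad_poly u (\<lambda>a b. G b a)"
      unfolding quad_poly_def by (subst sum.swap) (simp add: mult_ac)
    have "quad_poly u (\<lambda>a b. peval (pdiff b (pdiff a p)) u / 2) = quad_poly u (\<lambda>a b. (1/2) * (G a b + G b a))"
      by (simp add: hess)
    also have "\<dots> = Const (1/2) * (quad_poly u G + quad_poly u (\<lambda>a b. G b a))"
      by (simp only: quad_poly_scale quad_poly_add)
    also have "\<dots> = (Const (1/2) + Const (1/2)) * quad_poly u G"
      unfolding sym[symmetric] by (simp only: distrib_left distrib_right)
    also have "\<dots> = quad_poly u G" by (simp flip: Const_add)
    finally show ?thesis ..
  qed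
  finally show ?thesis using \<tau> by (auto simp: add.assoc)
qed

text \<open>Expansion along one coordinate axis, used both to read off entries and to complete the
  square.\<close>

lemma quad_form_shift:
  assumes sym: "\<And>x y. B x y = B y x"
  shows "quad_form B (\<lambda>x. v x + t * (if x = a then 1 else 0)) = quad_form B v + 2 * t * (\<Sum>y\<in>UNIV. B a y * v y) + t\<^sup>2 * B a a"
proof -
  let ?e = "\<lambda>x. if x = a then 1 else (0::real)"
  have "quad_form B (\<lambda>x. v x + t * w x) = quad_form B v +
     (\<Sum>x\<in>UNIV. \<Sum>y\<in>UNIV. B x y * v x * (t * w y)) + (\<Sum>x\<in>UNIV. \<Sum>y\<in>UNIV. B x y * v y * (t * w x)) +
     (\<Sum>x\<in>UNIV. \<Sum>y\<in>UNIV. B x y * (t * w x * (t * w y)))" for w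
    unfolding quad_form_def sum.distrib[symmetric]
    by (intro sum.cong refl) (simp add: algebra_simps)
  from this[of ?e] have "quad_form B (\<lambda>x. v x + t * ?e x) = quad_form B v +
     (\<Sum>x\<in>UNIV. \<Sum>y\<in>UNIV. B x y * v x * (t * ?e y)) + (\<Sum>x\<in>UNIV. \<Sum>y\<in>UNIV. B x y * v y * (t * ?e x)) +
     (\<Sum>x\<in>UNIV. \<Sum>y\<in>UNIV. B x y * (t * ?e x * (t * ?e y)))" .
  also have "(\<Sum>x\<in>UNIV. \<Sum>y\<in>UNIV. B x y * v x * (t * ?e y)) = t * (\<Sum>y\<in>UNIV. B a y * v y)"
    by (simp add: if_distrib[of "\<lambda>r. _ * r"] sum_distrib_left sym[of _ a] mult_ac cong: if_cong)
  also have "(\<Sum>x\<in>UNIV. \<Sum>y\<in>UNIV. B x y * v y * (t * ?e x)) = t * (\<Sum>y\<in>UNIV. B a y * v y)"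
    by (subst sum.swap) (simp add: if_distrib[of "\<lambda>r. _ * r"] sum_distrib_left mult_ac cong: if_cong)
  also have "(\<Sum>x\<in>UNIV. \<Sum>y\<in>UNIV. B x y * (t * ?e x * (t * ?e y))) = t\<^sup>2 * B a a"
    by (simp add: if_distrib[of "\<lambda>r. _ * r"] if_distrib[of "\<lambda>r. r * _"] power2_eq_square mult_ac cong: if_cong)
  finally show ?thesis by simp
qed

text \<open>Completing the square: each step enlarges the radical of the form.\<close>

lemma psd_quad_poly_SOS:
  fixes B :: "'n::finite \<Rightarrow> 'n \<Rightarrow> real"
  assumes "\<And>a b. B a b = B b a" "\<And>v. quad_form B v \<ge> 0"
  shows "quad_poly u B \<in> SOS"
  using assms
proof (induction "card {a. \<exists>b. B a b \<noteq> 0}" arbitrary: B rule: less_induct)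
  case less
  note sym = less.prems(1) and psd = less.prems(2)
  show ?case
  proof (cases "\<exists>a. B a a \<noteq> 0")
    case False
    \<comment> \<open>With zero diagonal the form is linear in \<open>t\<close> along this line, so
      its values at \<open>t = 1\<close> and \<open>t = -1\<close> have opposite signs unless
      \<open>B a b = 0\<close>.\<close>
    have "B a b = 0" for a b
    proof -
      have "quad_form B (\<lambda>x. (if x = b then 1 else 0) + t * (if x = a then 1 else 0)) = 2 * t * B a b" for t
      proof -
        have "quad_form B (\<lambda>x. if x = b then 1 else 0) = B b b"
          by (simp add: quad_form_def if_distrib[of "\<lambda>r. _ * r"] if_distrib[of "\<lambda>r. r * _"] cong: if_cong)
        then show ?thesis
          unfolding quad_form_shift[OF sym] using False
          by (simp add: if_distrib[of "\<lambda>r. _ * r"] cong: if_cong)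
      qed
      from psd[of "\<lambda>x. (if x = b then 1 else 0) + 1 * (if x = a then 1 else 0)", unfolded this]
        psd[of "\<lambda>x. (if x = b then 1 else 0) + (-1) * (if x = a then 1 else 0)", unfolded this]
      show ?thesis by simp
    qed
    then show ?thesis by (simp add: quad_poly_def)
  next
    case True
    then obtain a where "B a a \<noteq> 0" by blast
    moreover have "quad_form B (\<lambda>x. 0 + 1 * (if x = a then 1 else 0)) = B a a"
      unfolding quad_form_shift[OF sym] by (simp add: quad_form_def)
    ultimately have pos: "B a a > 0" using psd[of "\<lambda>x. 0 + 1 * (if x = a then 1 else 0)"] by simp
    define B' where "B' x y = B x y - B a x * B a y / B a a" for x y
    have "B = (\<lambda>x y. B' x y + (B a x / sqrt (B a a)) * (B a y / sqrt (B a a)))"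
      using pos by (intro ext) (simp add: B'_def)
    then have "quad_poly u B = quad_poly u (\<lambda>x y. B' x y + (B a x / sqrt (B a a)) * (B a y / sqrt (B a a)))"
      by (rule arg_cong)
    then have "quad_poly u B = quad_poly u B' + lin_poly u (\<lambda>x. B a x / sqrt (B a a)) ^ 2"
      by (simp only: quad_poly_add lin_poly_square)
    moreover have "quad_poly u B' \<in> SOS"
    proof (rule less.hyps)
      show "B' x y = B' y x" for x y by (simp add: B'_def sym[of x y] mult.commute)
      have "{x. \<exists>y. B' x y \<noteq> 0} \<subseteq> {x. \<exists>y. B x y \<noteq> 0} - {a}"
      proof -
        have "B' a y = 0" for y using pos by (simp add: B'_def)
        moreover have "B' x y = 0" if "\<forall>y. B x y = 0" for x y
          using that sym[of a x] by (simp add: B'_def)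
        ultimately show ?thesis by blast
      qed
      moreover have "a \<in> {x. \<exists>y. B x y \<noteq> 0}" using pos by (auto intro!: exI[of _ a])
      ultimately show "card {x. \<exists>y. B' x y \<noteq> 0} < card {x. \<exists>y. B x y \<noteq> 0}"
        by (intro psubset_card_mono finite) blast
      fix v
      define s where "s = (\<Sum>y\<in>UNIV. B a y * v y)"
      \<comment> \<open>\<open>B'\<close> is the form \<open>B\<close> minimised over the coordinate
        \<open>a\<close>, attained at the step \<open>- s / B a a\<close>, so it inherits
        nonnegativity.\<close>
      have "quad_form B' v = quad_form B v - s\<^sup>2 / B a a"
        unfolding quad_form_def B'_def s_def power2_eq_square sum_product sum_divide_distrib
          sum_subtractf[symmetric]
        by (intro sum.cong refl) (simp add: algebra_simps)
      also have "\<dots> = quad_form B (\<lambda>x. v x + (- s / B a a) * (if x = a then 1 else 0))"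
        unfolding quad_form_shift[OF sym] s_def[symmetric] using pos by (simp add: power2_eq_square field_simps)
      finally show "quad_form B' v \<ge> 0" using psd by simp
    qed
    ultimately show ?thesis by (simp add: SOS_add SOS_square)
  qed
qed

text \<open>Up to third order \<open>p ^ 2\<close> is the square of the linear part, which
  Cauchy-Schwarz bounds by the squared gradient times \<open>|x - u|^2\<close>. So a small multiple
  of such a square can be subtracted from a strict certificate.\<close>

lemma square_le_norm_poly:
  assumes "peval p u = 0"
  shows "\<exists>C>0. \<exists>s\<in>SOS. \<exists>\<tau>. ord3 u \<tau> \<and> Const C * norm_poly u = p ^ 2 + s + \<tau>"
proof -
  define \<beta> where "\<beta> a = peval (pdiff a p) u" for a
  obtain \<tau> where \<tau>: "ord3 u \<tau>" "p = Const (peval p u) + lin_poly u \<beta> +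
     quad_poly u (\<lambda>a b. peval (pdiff b (pdiff a p)) u / 2) + \<tau>"
    using Taylor2[of u p] unfolding \<beta>_def by blast
  define r where "r = quad_poly u (\<lambda>a b. peval (pdiff b (pdiff a p)) u / 2) + \<tau>"
  have p: "p = lin_poly u \<beta> + r" using \<tau>(2) assms by (simp add: r_def add.assoc)
  have r: "ord2 u r" unfolding r_def by (intro ord2_add ord2_quad_poly ord3_imp_ord2 \<tau>)
  have "p ^ 2 - lin_poly u \<beta> ^ 2 = r * (p + lin_poly u \<beta>)"
    unfolding p by (simp add: power2_eq_square algebra_simps)
  moreover have "ord3 u (r * (p + lin_poly u \<beta>))"
    using assms by (intro ord2_mult_vanish r) simp
  ultimately have o: "ord3 u (p ^ 2 - lin_poly u \<beta> ^ 2)" by simp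
  \<comment> \<open>The added 1 keeps \<open>C\<close> positive when the gradient vanishes.\<close>
  define C where "C = (\<Sum>a\<in>UNIV. (\<beta> a)\<^sup>2) + 1"
  define B where "B a b = C * (if a = b then 1 else 0) - \<beta> a * \<beta> b" for a b
  have "quad_poly u B \<in> SOS"
  proof (rule psd_quad_poly_SOS)
    fix v
    have "(\<Sum>a\<in>UNIV. \<beta> a * v a)\<^sup>2 \<le> (\<Sum>a\<in>UNIV. (\<beta> a)\<^sup>2) * (\<Sum>a\<in>UNIV. (v a)\<^sup>2)"
      by (rule Cauchy_Schwarz_ineq_sum)
    also have "\<dots> \<le> C * (\<Sum>a\<in>UNIV. (v a)\<^sup>2)"
      by (intro mult_right_mono) (auto simp: C_def intro: sum_nonneg)
    finally have 1: "(\<Sum>a\<in>UNIV. \<beta> a * v a)\<^sup>2 \<le> C * (\<Sum>a\<in>UNIV. (v a)\<^sup>2)" .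
    have "quad_form B v = (\<Sum>a\<in>UNIV. \<Sum>b\<in>UNIV. C * (if a = b then 1 else 0) * (v a * v b)) -
       (\<Sum>a\<in>UNIV. \<Sum>b\<in>UNIV. \<beta> a * v a * (\<beta> b * v b))"
      unfolding quad_form_def B_def sum_subtractf[symmetric]
      by (intro sum.cong refl) (simp add: algebra_simps)
    also have "\<dots> = C * (\<Sum>a\<in>UNIV. (v a)\<^sup>2) - (\<Sum>a\<in>UNIV. \<beta> a * v a)\<^sup>2"
      by (simp add: power2_eq_square sum_product sum_distrib_left if_distrib[of "\<lambda>r. _ * r"]
        if_distrib[of "\<lambda>r. r * _"] mult_ac cong: if_cong)
    finally show "quad_form B v \<ge> 0" using 1 by simp
  qed (simp add: B_def mult.commute)
  moreover have "quad_poly u B = Const C * norm_poly u - lin_poly u \<beta> ^ 2"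
    unfolding B_def lin_poly_square norm_poly_quad by (simp only: quad_poly_diff quad_poly_scale)
  moreover have "C > 0" unfolding C_def by (simp add: add_nonneg_pos sum_nonneg)
  ultimately show ?thesis using ord3_uminus[OF o]
    by (intro exI[of _ C] conjI bexI[of _ "quad_poly u B"] exI[of _ "- (p ^ 2 - lin_poly u \<beta> ^ 2)"]) auto
qed

text \<open>The term with \<open>c > 0\<close> is a reserve: part of it can be spent on squares
  vanishing at \<open>u\<close>, and it forces quadratic growth of \<open>f\<close> on
  \<open>qm_set M\<close>.\<close>

definition strict_local_cert :: "'n::finite mpoly set \<Rightarrow> real ^ 'n \<Rightarrow> 'n mpoly \<Rightarrow> bool" where
  "strict_local_cert M u f \<longleftrightarrow>
     (\<exists>c>0. \<exists>m\<in>M. \<exists>\<tau>. ord3 u \<tau> \<and> f = m + Const c * norm_poly u + \<tau>)"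

lemma ord3_small:
  assumes "ord3 u \<tau>" "\<epsilon> > 0"
  shows "\<exists>e>0. \<forall>x. dist x u < e \<longrightarrow> \<bar>peval \<tau> x\<bar> \<le> \<epsilon> * (dist x u)\<^sup>2"
proof -
  obtain d where d: "\<tau> = (\<Sum>a\<in>UNIV. \<Sum>b\<in>UNIV. coord u a * coord u b * d a b)" "\<And>a b. peval (d a b) u = 0"
    using assms(1) by (auto simp: ord3_def)
  define D where "D x = (\<Sum>a\<in>UNIV. \<Sum>b\<in>UNIV. \<bar>peval (d a b) x\<bar>)" for x
  have "isCont D u" unfolding D_def by (intro continuous_intros isCont_peval)
  moreover have "D u = 0" by (simp add: D_def d(2))
  ultimately obtain e where e: "e > 0" "\<And>x. dist x u < e \<Longrightarrow> \<bar>D x\<bar> < \<epsilon>"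
    using assms(2) by (auto simp: continuous_at_eps_delta dist_real_def)
  have "\<bar>peval \<tau> x\<bar> \<le> \<epsilon> * (dist x u)\<^sup>2" if "dist x u < e" for x
  proof -
    have comp: "\<bar>x $ a - u $ a\<bar> \<le> dist x u" for a
      using component_le_norm_cart[of "x - u" a] by (simp add: dist_norm)
    have "\<bar>peval \<tau> x\<bar> \<le> (\<Sum>a\<in>UNIV. \<Sum>b\<in>UNIV. \<bar>(x $ a - u $ a) * (x $ b - u $ b) * peval (d a b) x\<bar>)"
      unfolding d(1) by (simp, intro order_trans[OF sum_abs] sum_mono order_refl)
    also have "\<dots> \<le> (\<Sum>a\<in>UNIV. \<Sum>b\<in>UNIV. (dist x u)\<^sup>2 * \<bar>peval (d a b) x\<bar>)"
      unfolding power2_eq_square abs_mult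
      by (intro sum_mono mult_right_mono mult_mono comp) auto
    also have "\<dots> = (dist x u)\<^sup>2 * D x" by (simp add: D_def sum_distrib_left)
    also have "\<dots> \<le> (dist x u)\<^sup>2 * \<epsilon>" using e(2)[OF that] by (intro mult_left_mono) auto
    finally show ?thesis by (simp add: mult.commute)
  qed
  with e(1) show ?thesis by blast
qed

text \<open>On \<open>K\<close> the module part is nonnegative, and near \<open>u\<close> the third
  order part takes at most half of the reserve. Serves both to isolate the zeros and to keep a
  modified polynomial nonnegative near them.\<close>

lemma strict_local_cert_growth:
  assumes "strict_local_cert M u f" and "K \<subseteq> qm_set M"
  shows "\<exists>e>0. \<exists>c>0. \<forall>x\<in>K. dist x u < e \<longrightarrow> c * (dist x u)\<^sup>2 \<le> peval f x"
proof -
  obtain c m \<tau> where c: "c > 0" "m \<in> M" "ord3 u \<tau>" "f = m + Const c * norm_poly u + \<tau>"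
    using assms(1) by (auto simp: strict_local_cert_def)
  obtain e where e: "e > 0" "\<And>x. dist x u < e \<Longrightarrow> \<bar>peval \<tau> x\<bar> \<le> c / 2 * (dist x u)\<^sup>2"
    using ord3_small[OF c(3), of "c / 2"] c(1) by auto
  have "c / 2 * (dist x u)\<^sup>2 \<le> peval f x" if "x \<in> K" "dist x u < e" for x
  proof -
    have "peval m x \<ge> 0" using that assms(2) c(2) by (auto simp: qm_set_def)
    then show ?thesis using e(2)[OF that(2)] by (simp add: c(4) peval_norm_poly abs_le_iff)
  qed
  then show ?thesis using e(1) c(1) by (intro exI[of _ e] conjI exI[of _ "c / 2"]) auto
qed

lemma strict_local_cert_add:
  assumes M: "quadratic_module M" and f: "strict_local_cert M u f" and q: "q \<in> M"
  shows "strict_local_cert M u (f + q)"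
proof -
  obtain c m \<tau> where c: "c > 0" "m \<in> M" "ord3 u \<tau>" "f = m + Const c * norm_poly u + \<tau>"
    using f by (auto simp: strict_local_cert_def)
  then have "f + q = (m + q) + Const c * norm_poly u + \<tau>" by simp
  then show ?thesis
    unfolding strict_local_cert_def using c qm_add[OF M c(2) q] by blast
qed

lemma strict_local_cert_diff:
  assumes M: "quadratic_module M" and f: "strict_local_cert M u f"
    and fin: "finite A" and q: "\<And>i. i \<in> A \<Longrightarrow> peval (q i) u = 0"
  shows "\<exists>c0>0. \<forall>c\<le>c0. strict_local_cert M u (f - Const c * (\<Sum>i\<in>A. q i ^ 2))"
proof -
  have "\<forall>i\<in>A. \<exists>C s \<tau>. C > 0 \<and> s \<in> SOS \<and> ord3 u \<tau> \<and> Const C * norm_poly u = q i ^ 2 + s + \<tau>"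
    using square_le_norm_poly q by meson
  then obtain C s \<tau> where C: "\<And>i. i \<in> A \<Longrightarrow> C i > 0 \<and> s i \<in> SOS \<and> ord3 u (\<tau> i) \<and>
      Const (C i) * norm_poly u = q i ^ 2 + s i + \<tau> i"
    by metis
  define Q where "Q = (\<Sum>i\<in>A. q i ^ 2)"
  obtain c m t where c: "c > 0" "m \<in> M" "ord3 u t" "f = m + Const c * norm_poly u + t"
    using f by (auto simp: strict_local_cert_def)
  define D where "D = (\<Sum>i\<in>A. C i) + 1"
  have sumC: "(\<Sum>i\<in>A. C i) \<ge> 0" using C by (intro sum_nonneg) (auto intro: less_imp_le)
  have D: "D > 0" using sumC by (simp add: D_def)
  \<comment> \<open>Since \<open>D\<close> exceeds the sum of the \<open>C i\<close>, at least half
    of the reserve \<open>c\<close> remains.\<close>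
  define c0 where "c0 = c / (2 * D)"
  have c0: "c0 > 0" using c D by (simp add: c0_def)
  have Qeq: "Q = Const (\<Sum>i\<in>A. C i) * norm_poly u - (\<Sum>i\<in>A. s i) - (\<Sum>i\<in>A. \<tau> i)"
  proof -
    have "Const (\<Sum>i\<in>A. C i) * norm_poly u = (\<Sum>i\<in>A. Const (C i) * norm_poly u)"
      by (simp add: Const_sum sum_distrib_right)
    also have "\<dots> = (\<Sum>i\<in>A. q i ^ 2 + s i + \<tau> i)" by (rule sum.cong) (use C in auto)
    finally show ?thesis by (simp add: Q_def sum.distrib)
  qed
  have base: "strict_local_cert M u (f - Const c0 * Q)"
  proof -
    define c' where "c' = c - c0 * (\<Sum>i\<in>A. C i)"
    have "c0 * (\<Sum>i\<in>A. C i) \<le> c0 * D" using c0 by (intro mult_left_mono) (auto simp: D_def)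
    also have "c0 * D = c / 2" using D by (simp add: c0_def)
    finally have "c' > 0" using c(1) by (simp add: c'_def)
    moreover have "f - Const c0 * Q = (m + Const c0 * (\<Sum>i\<in>A. s i)) + Const c' * norm_poly u + (t + Const c0 * (\<Sum>i\<in>A. \<tau> i))"
      unfolding Qeq c(4) c'_def by (simp add: Const_diff Const_mult algebra_simps)
    moreover have "m + Const c0 * (\<Sum>i\<in>A. s i) \<in> M"
      using C c0 by (intro qm_add[OF M c(2)] qm_Const_mult[OF M] qm_SOS[OF M] SOS_sum) auto
    moreover have "ord3 u (t + Const c0 * (\<Sum>i\<in>A. \<tau> i))"
      using C by (intro ord3_add c(3) ord3_mult ord3_sum) auto
    ultimately show ?thesis unfolding strict_local_cert_def by blast
  qed
  \<comment> \<open>A smaller coefficient, even a negative one, only adds a nonnegative multiple of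
    squares.\<close>
  have "strict_local_cert M u (f - Const c' * Q)" if "c' \<le> c0" for c'
  proof -
    have "Const (c0 - c') * Q \<in> M"
      using that unfolding Q_def by (intro qm_Const_mult[OF M] qm_SOS[OF M] SOS_sum SOS_square) auto
    from strict_local_cert_add[OF M base this] show ?thesis by (simp add: Const_diff algebra_simps)
  qed
  with c0 show ?thesis unfolding Q_def by blast
qed

section \<open>From local certificates to the quadratic module\<close>

definition subst_poly :: "'n::finite mpoly \<Rightarrow> real poly \<Rightarrow> 'n mpoly" where
  "subst_poly t p = poly (map_poly Const p) t"

lemma subst_poly_0 [simp]: "subst_poly t 0 = 0"
  by (simp add: subst_poly_def)

lemma subst_poly_pCons: "subst_poly t (pCons a p) = Const a + t * subst_poly t p"
  by (simp add: subst_poly_def map_poly_pCons)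

lemma subst_poly_1 [simp]: "subst_poly t 1 = 1"
  unfolding one_pCons subst_poly_pCons by simp

lemma subst_poly_add: "subst_poly t (p + q) = subst_poly t p + subst_poly t q"
proof (induction p arbitrary: q)
  case (pCons a p)
  obtain b r where "q = pCons b r" by (rule pCons_cases)
  then show ?case
    by (simp only: add_pCons subst_poly_pCons pCons.IH Const_add) (simp add: algebra_simps)
qed simp

lemma subst_poly_smult: "subst_poly t (Polynomial.smult r p) = Const r * subst_poly t p"
  by (induction p) (simp_all add: subst_poly_pCons Const_mult algebra_simps)

lemma subst_poly_mult: "subst_poly t (p * q) = subst_poly t p * subst_poly t q"
  by (induction p)
    (simp_all add: subst_poly_pCons subst_poly_add subst_poly_smult algebra_simps)

lemma subst_poly_power: "subst_poly t (p ^ k) = subst_poly t p ^ k"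
  by (induction k) (simp_all add: subst_poly_mult)

lemma subst_poly_diff: "subst_poly t (p - q) = subst_poly t p - subst_poly t q"
  using subst_poly_add[of t "p - q" q] by (simp add: algebra_simps)

lemma subst_poly_sum: "subst_poly t (sum f A) = (\<Sum>i\<in>A. subst_poly t (f i))"
  by (induction A rule: infinite_finite_induct) (simp_all add: subst_poly_add)

lemma peval_subst_poly [simp]: "peval (subst_poly t p) x = poly p (peval t x)"
  by (induction p) (simp_all add: subst_poly_pCons)

text \<open>Powers of distinct linear factors are coprime; the multiplicity of the root
  \<open>a\<close> carries the argument.\<close>

lemma prod_linear_power_dvd:
  fixes q :: "real poly"
  assumes "finite A" "\<And>a. a \<in> A \<Longrightarrow> [:- a, 1:] ^ k dvd q"
  shows "(\<Prod>a\<in>A. [:- a, 1:]) ^ k dvd q"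
  using assms
proof (induction A)
  case (insert a A)
  let ?P = "(\<Prod>a\<in>A. [:- a, 1:]) ^ k"
  from insert obtain r where r: "q = ?P * r" by (auto elim: dvdE)
  have "poly ?P a \<noteq> 0" using insert.hyps by (auto simp: poly_prod)
  then have "Polynomial.order a ?P = 0" by (rule order_0I)
  moreover have "[:- a, 1:] ^ k dvd q" using insert by simp
  ultimately have "[:- a, 1:] ^ k dvd r"
  proof (cases "r = 0")
    case False
    have "?P \<noteq> 0" using \<open>poly ?P a \<noteq> 0\<close> by (metis poly_0)
    with False have "?P * r \<noteq> 0" by (rule no_zero_divisors[rotated])
    from order_mult[OF this, of a] have "Polynomial.order a q = Polynomial.order a r"
      unfolding r \<open>Polynomial.order a ?P = 0\<close> by simp
    with \<open>[:- a, 1:] ^ k dvd q\<close> \<open>?P * r \<noteq> 0\<close> show ?thesis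
      unfolding order_divides r by auto
  qed simp
  then have "?P * [:- a, 1:] ^ k dvd q"
    unfolding r by (rule mult_dvd_mono[OF dvd_refl])
  then show ?case
    unfolding prod.insert[OF insert.hyps] power_mult_distrib by (subst mult.commute)
qed simp

text \<open>The Lagrange polynomials \<open>L a\<close> sum to 1 modulo \<open>P\<close>. The
  function \<open>1 - (1 - x^2)^2\<close> fixes 0 and 1 and has derivative 0 there, so the modified
  polynomials take these values at the nodes to second order, and their squares sum to 1 modulo
  \<open>P^2\<close>. Squares are what may multiply elements of a quadratic module.\<close>

lemma interpolation_idempotents:
  fixes A :: "real set"
  assumes A: "finite A"
  defines "P \<equiv> \<Prod>a\<in>A. [:- a, 1:]"
  shows "\<exists>L. (\<forall>a\<in>A. \<forall>b\<in>A. poly (L a) b = (if a = b then 1 else 0)) \<and> P dvd 1 - (\<Sum>a\<in>A. L a) \<and>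
     P\<^sup>2 dvd 1 - (\<Sum>a\<in>A. (1 - (1 - (L a)\<^sup>2)\<^sup>2)\<^sup>2)"
proof (intro exI conjI ballI)
  define L where "L a = Polynomial.smult (1 / (\<Prod>b\<in>A - {a}. a - b)) (\<Prod>b\<in>A - {a}. [:- b, 1:])" for a
  show L: "poly (L a) b = (if a = b then 1 else 0)" if "a \<in> A" "b \<in> A" for a b
    using that A by (auto simp: L_def poly_prod)
  have "[:- a, 1:] dvd 1 - (\<Sum>a\<in>A. L a)" if "a \<in> A" for a
    using that A by (simp add: dvd_iff_poly_eq_0 poly_sum L)
  then have "P ^ 1 dvd 1 - (\<Sum>a\<in>A. L a)"
    unfolding P_def by (intro prod_linear_power_dvd A) simp
  then show "P dvd 1 - (\<Sum>a\<in>A. L a)" by simp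
  have "[:- a, 1:]\<^sup>2 dvd 1 - (\<Sum>a\<in>A. (1 - (1 - (L a)\<^sup>2)\<^sup>2)\<^sup>2)" if "a \<in> A" for a
  proof -
    define D where "D a = 1 - (1 - (L a)\<^sup>2)\<^sup>2" for a
    have "[:- a, 1:] dvd 1 - (L a)\<^sup>2" using that by (simp add: dvd_iff_poly_eq_0 L)
    then have "[:- a, 1:]\<^sup>2 dvd (1 - (L a)\<^sup>2)\<^sup>2" by (simp add: dvd_power_same)
    moreover have "1 - (D a)\<^sup>2 = (1 - (L a)\<^sup>2)\<^sup>2 * (1 + D a)"
      unfolding D_def by (simp add: power2_eq_square algebra_simps)
    ultimately have 1: "[:- a, 1:]\<^sup>2 dvd 1 - (D a)\<^sup>2" by simp
    have 2: "[:- a, 1:]\<^sup>2 dvd (D b)\<^sup>2" if "b \<in> A - {a}" for b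
    proof -
      have "[:- a, 1:] dvd L b" using that \<open>a \<in> A\<close> by (simp add: dvd_iff_poly_eq_0 L)
      moreover have "D b = L b * (L b * (2 - (L b)\<^sup>2))"
        unfolding D_def by (simp add: power2_eq_square algebra_simps)
      ultimately show ?thesis by (simp add: dvd_power_same)
    qed
    have "1 - (\<Sum>a\<in>A. (D a)\<^sup>2) = (1 - (D a)\<^sup>2) - (\<Sum>b\<in>A - {a}. (D b)\<^sup>2)"
      using A that by (simp add: sum.remove[of A a])
    also have "[:- a, 1:]\<^sup>2 dvd \<dots>" by (intro dvd_diff 1 dvd_sum 2)
    finally show ?thesis by (simp add: D_def)
  qed
  then show "P\<^sup>2 dvd 1 - (\<Sum>a\<in>A. (1 - (1 - (L a)\<^sup>2)\<^sup>2)\<^sup>2)"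
    unfolding P_def by (intro prod_linear_power_dvd A)
qed

text \<open>Finitely many hyperplanes do not cover the space. This reduces interpolation on
  \<open>S\<close> to one variable.\<close>

lemma separating_linear_form:
  fixes S :: "(real ^ 'n::finite) set"
  assumes "finite S"
  shows "\<exists>t. inj_on (peval t) S"
proof -
  define H where "H = (\<Union>(u, v)\<in>{p \<in> S \<times> S. fst p \<noteq> snd p}. {a. inner (u - v) a = 0})"
  have "negligible {a. inner (u - v) a = 0}" if "u \<noteq> v" for u v :: "real ^ 'n"
    using that by (intro negligible_hyperplane) simp
  then have "negligible H"
    unfolding H_def using assms
    by (intro negligible_Union finite_imageI) (auto intro: finite_subset[of _ "S \<times> S"])
  then have "H \<noteq> UNIV" using non_negligible_UNIV by metis
  then obtain a where a: "a \<notin> H" by blast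
  define t where "t = (\<Sum>i\<in>UNIV. Const (a $ i) * Var i)"
  have t: "peval t x = inner x a" for x
    by (simp add: t_def inner_vec_def mult.commute)
  have "inj_on (peval t) S"
  proof (rule inj_onI, rule ccontr)
    fix u v assume "u \<in> S" "v \<in> S" "peval t u = peval t v" "u \<noteq> v"
    then have "a \<in> H" by (auto simp: H_def t inner_diff_left intro!: bexI[of _ "(u, v)"])
    with a show False by contradiction
  qed
  then show ?thesis by blast
qed

text \<open>The sum of squares \<open>Q\<close>. With \<open>T\<close> and \<open>l\<close> from
  \<open>point_idempotents\<close>, the polynomials \<open>T\<close> and
  \<open>l u * coord u a\<close> generate the vanishing ideal of \<open>S\<close>.\<close>

definition point_gens ::
    "(real ^ 'n::finite) set \<Rightarrow> 'n mpoly \<Rightarrow> (real ^ 'n \<Rightarrow> 'n mpoly) \<Rightarrow> 'n mpoly" where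
  "point_gens S T l = T ^ 2 + (\<Sum>u\<in>S. \<Sum>a\<in>UNIV. (l u * coord u a) ^ 2)"

lemma point_gens_SOS: "point_gens S T l \<in> SOS"
  unfolding point_gens_def by (intro SOS_add SOS_sum SOS_square)

text \<open>Substitute a separating linear form into the one-variable interpolation.
  \<open>T = 0\<close> leaves parallel hyperplanes through the points of \<open>S\<close>; on the
  one through \<open>u\<close> the factor \<open>l u\<close> is 1, so the products
  \<open>l u * coord u a\<close> cut out \<open>u\<close>.\<close>

lemma point_idempotents:
  fixes S :: "(real ^ 'n::finite) set"
  assumes S: "finite S"
  shows "\<exists>T l \<rho> \<rho>'. (\<forall>u\<in>S. \<forall>v\<in>S. peval (l u) v = (if u = v then 1 else 0)) \<and>
     1 - (\<Sum>u\<in>S. l u) = T * \<rho> \<and> 1 - (\<Sum>u\<in>S. (1 - (1 - (l u)\<^sup>2)\<^sup>2)\<^sup>2) = T\<^sup>2 * \<rho>' \<and>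
     (\<forall>x. peval (point_gens S T l) x = 0 \<longleftrightarrow> x \<in> S)"
proof -
  obtain t where t: "inj_on (peval t) S" using separating_linear_form[OF S] by blast
  define A where "A = peval t ` S"
  have A: "finite A" using S by (simp add: A_def)
  obtain L where L: "\<And>a b. a \<in> A \<Longrightarrow> b \<in> A \<Longrightarrow> poly (L a) b = (if a = b then 1 else 0)"
    "(\<Prod>a\<in>A. [:- a, 1:]) dvd 1 - (\<Sum>a\<in>A. L a)"
    "(\<Prod>a\<in>A. [:- a, 1:])\<^sup>2 dvd 1 - (\<Sum>a\<in>A. (1 - (1 - (L a)\<^sup>2)\<^sup>2)\<^sup>2)"
    using interpolation_idempotents[OF A] by blast
  define T where "T = subst_poly t (\<Prod>a\<in>A. [:- a, 1:])"
  define l where "l u = subst_poly t (L (peval t u))" for u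
  have re: "(\<Sum>a\<in>A. g a) = (\<Sum>u\<in>S. g (peval t u))" for g :: "real \<Rightarrow> real poly"
    unfolding A_def by (simp add: sum.reindex[OF t])
  obtain r where "1 - (\<Sum>a\<in>A. L a) = (\<Prod>a\<in>A. [:- a, 1:]) * r" using L(2) by (rule dvdE)
  then have "subst_poly t (1 - (\<Sum>a\<in>A. L a)) = T * subst_poly t r"
    by (simp add: T_def subst_poly_mult)
  then have 1: "1 - (\<Sum>u\<in>S. l u) = T * subst_poly t r"
    by (simp add: re subst_poly_diff subst_poly_sum l_def)
  obtain r' where "1 - (\<Sum>a\<in>A. (1 - (1 - (L a)\<^sup>2)\<^sup>2)\<^sup>2) = (\<Prod>a\<in>A. [:- a, 1:])\<^sup>2 * r'"
    using L(3) by (rule dvdE)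
  then have "subst_poly t (1 - (\<Sum>a\<in>A. (1 - (1 - (L a)\<^sup>2)\<^sup>2)\<^sup>2)) = T\<^sup>2 * subst_poly t r'"
    by (simp add: T_def subst_poly_mult subst_poly_power)
  then have 2: "1 - (\<Sum>u\<in>S. (1 - (1 - (l u)\<^sup>2)\<^sup>2)\<^sup>2) = T\<^sup>2 * subst_poly t r'"
    by (simp add: re subst_poly_diff subst_poly_sum subst_poly_power l_def)
  have 3: "peval (l u) v = (if u = v then 1 else 0)" if "u \<in> S" "v \<in> S" for u v
    using that L(1)[of "peval t u" "peval t v"] inj_onD[OF t, of u v] by (auto simp: l_def A_def)
  have 4: "peval (point_gens S T l) x = 0 \<longleftrightarrow> x \<in> S" for x
  proof
    assume "peval (point_gens S T l) x = 0"
    then have "(peval T x)\<^sup>2 + (\<Sum>u\<in>S. \<Sum>a\<in>UNIV. (peval (l u) x * (x $ a - u $ a))\<^sup>2) = 0"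
      by (simp add: point_gens_def)
    moreover have nn: "(\<Sum>u\<in>S. \<Sum>a\<in>UNIV. (peval (l u) x * (x $ a - u $ a))\<^sup>2) \<ge> 0"
      by (intro sum_nonneg) auto
    ultimately have T0: "peval T x = 0" and W0: "(\<Sum>u\<in>S. \<Sum>a\<in>UNIV. (peval (l u) x * (x $ a - u $ a))\<^sup>2) = 0"
      by (auto simp: add_nonneg_eq_0_iff)
    from T0 have "peval t x \<in> A"
      using A by (auto simp: T_def poly_prod)
    then obtain u where u: "u \<in> S" "peval t x = peval t u" by (auto simp: A_def)
    then have "peval (l u) x = 1" using L(1)[of "peval t u" "peval t u"] by (auto simp: l_def A_def)
    moreover have "(\<Sum>a\<in>UNIV. (peval (l u) x * (x $ a - u $ a))\<^sup>2) = 0"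
      using W0 u(1) S by (subst (asm) sum_nonneg_eq_0_iff) (auto intro: sum_nonneg)
    ultimately have "x = u" by (simp add: sum_nonneg_eq_0_iff Finite_Cartesian_Product.vec_eq_iff)
    with u show "x \<in> S" by simp
  next
    assume x: "x \<in> S"
    have "peval t x \<in> A" using x by (simp add: A_def)
    then have "peval T x = 0" using A by (auto simp: T_def poly_prod)
    moreover have "peval (l u) x * (x $ a - u $ a) = 0" if "u \<in> S" for u a
      using 3[OF that x] by auto
    ultimately show "peval (point_gens S T l) x = 0"
      by (simp add: point_gens_def)
  qed
  show ?thesis using 1 2 3 4 by blast
qed

section \<open>Gluing on a compact set\<close>

lemma compact_qm_set:
  assumes arch: "Const N - (\<Sum>i\<in>UNIV. Var i ^ 2) \<in> M"
  shows "compact (qm_set M)"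
proof -
  have "norm x \<le> sqrt N" if "x \<in> qm_set M" for x
  proof -
    from that arch have "0 \<le> peval (Const N - (\<Sum>i\<in>UNIV. Var i ^ 2)) x" unfolding qm_set_def by blast
    then show ?thesis by (simp add: norm_vec_def L2_set_def)
  qed
  then have "bounded (qm_set M)" unfolding bounded_iff by blast
  then show ?thesis using closed_qm_set compact_eq_bounded_closed by blast
qed

text \<open>Where \<open>\<bar>\<phi>\<bar> \<ge> \<epsilon>\<close>, a compact set,
  \<open>e\<close> is bounded by some \<open>q < 1\<close>; elsewhere
  \<open>0 \<le> e \<le> 1\<close> suffices.\<close>

lemma power_mult_uniformly_small:
  fixes e \<phi> :: "'a::metric_space \<Rightarrow> real"
  assumes K: "compact K" and c: "continuous_on K e" "continuous_on K \<phi>"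
    and e: "\<And>x. x \<in> K \<Longrightarrow> 0 \<le> e x" "\<And>x. x \<in> K \<Longrightarrow> e x \<le> 1" "\<And>x. x \<in> K \<Longrightarrow> \<phi> x \<noteq> 0 \<Longrightarrow> e x < 1"
    and \<epsilon>: "\<epsilon> > 0"
  shows "\<forall>\<^sub>F n in sequentially. \<forall>x\<in>K. \<bar>e x ^ n * \<phi> x\<bar> < \<epsilon>"
proof -
  define K' where "K' = {x \<in> K. \<bar>\<phi> x\<bar> \<in> {\<epsilon>..}}"
  have cK': "compact K'"
  proof -
    have "closedin (top_of_set K) (K \<inter> (\<lambda>x. \<bar>\<phi> x\<bar>) -` {\<epsilon>..})"
      by (intro continuous_closedin_preimage continuous_intros c)
    then have "compact (K \<inter> (\<lambda>x. \<bar>\<phi> x\<bar>) -` {\<epsilon>..})"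
      using K closedin_compact by blast
    moreover have "K' = K \<inter> (\<lambda>x. \<bar>\<phi> x\<bar>) -` {\<epsilon>..}" by (auto simp: K'_def)
    ultimately show ?thesis by simp
  qed
  have sub: "K' \<subseteq> K" by (auto simp: K'_def)
  obtain b where b: "b > 0" "\<And>x. x \<in> K \<Longrightarrow> \<bar>\<phi> x\<bar> \<le> b"
    using compact_imp_bounded[OF compact_continuous_image[OF c(2) K]] unfolding bounded_pos by auto
  obtain q where q: "0 \<le> q" "q < 1" "\<And>x. x \<in> K' \<Longrightarrow> e x \<le> q"
  proof (cases "K' = {}")
    case True
    then show ?thesis using that[of 0] by auto
  next
    case False
    from continuous_attains_sup[OF cK' False continuous_on_subset[OF c(1) sub]]
    obtain x0 where x0: "x0 \<in> K'" "\<And>x. x \<in> K' \<Longrightarrow> e x \<le> e x0" by blast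
    then have "e x0 < 1" using e(3)[of x0] \<epsilon> by (auto simp: K'_def)
    then show ?thesis using that[of "e x0"] x0 e(1)[of x0] sub by auto
  qed
  have "(\<lambda>n. q ^ n * b) \<longlonglongrightarrow> 0 * b"
    using q by (intro tendsto_mult LIMSEQ_power_zero tendsto_const) auto
  then have "\<forall>\<^sub>F n in sequentially. q ^ n * b < \<epsilon>"
    by (rule order_tendstoD) (use \<epsilon> in simp)
  then show ?thesis
  proof eventually_elim
    case (elim n)
    show ?case
    proof
      fix x assume x: "x \<in> K"
      show "\<bar>e x ^ n * \<phi> x\<bar> < \<epsilon>"
      proof (cases "x \<in> K'")
        case True
        have "\<bar>e x ^ n * \<phi> x\<bar> = e x ^ n * \<bar>\<phi> x\<bar>" using e(1)[OF x] by (simp add: abs_mult)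
        also have "\<dots> \<le> q ^ n * b"
          using e(1)[OF x] q(3)[OF True] b(2)[OF x] q(1) by (intro mult_mono power_mono) auto
        finally show ?thesis using elim by simp
      next
        case False
        then have "\<bar>\<phi> x\<bar> < \<epsilon>" using x by (auto simp: K'_def)
        moreover have "\<bar>e x ^ n * \<phi> x\<bar> \<le> \<bar>\<phi> x\<bar>"
          using e(1,2)[OF x] by (simp add: abs_mult mult_left_le_one_le power_le_one)
        ultimately show ?thesis by linarith
      qed
    qed
  qed
qed

text \<open>Polarisation: \<open>4 G_a G_b Z = (G_a + G_b)^2 Z - (G_a - G_b)^2 Z\<close>. So
  \<open>Z\<close> occurs with both signs, and \<open>\<epsilon> + Z\<close> and
  \<open>\<epsilon> - Z\<close> absorb it. Each square is charged \<epsilon>/2 from either index,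
  hence the factor \<open>CARD('n)\<close>.\<close>

lemma qm_absorb_ord3:
  fixes G :: "'n::finite \<Rightarrow> 'n mpoly"
  assumes M: "quadratic_module M"
    and pos: "\<And>a b. Const \<epsilon> + Z a b \<in> M" "\<And>a b. Const \<epsilon> - Z a b \<in> M"
  shows "Const (\<epsilon> * real CARD('n)) * (\<Sum>a\<in>UNIV. G a ^ 2) + (\<Sum>a\<in>UNIV. \<Sum>b\<in>UNIV. G a * G b * Z a b) \<in> M"
    (is "?L \<in> M")
proof -
  have "G a * G b * Z a b + Const (\<epsilon> / 2) * (G a ^ 2 + G b ^ 2) \<in> M" for a b
  proof -
    have h: "Const (1/4) * (4 * p) = p" for p :: "'n mpoly"
    proof -
      have "Const (1/4) * (4 * p) = Const (1/4 * 4) * p"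
        by (simp only: Const_mult Const_numeral mult.assoc)
      then show ?thesis by simp
    qed
    have e2: "2 * Const (\<epsilon> / 2) = (Const \<epsilon> :: 'n mpoly)"
      unfolding Const_numeral[symmetric] Const_mult[symmetric] by simp
    have "4 * (G a * G b * Z a b + Const (\<epsilon> / 2) * (G a ^ 2 + G b ^ 2)) =
      4 * (G a * G b * Z a b) + (2 * Const (\<epsilon> / 2)) * (2 * (G a ^ 2 + G b ^ 2))"
      by (simp add: algebra_simps)
    also have "\<dots> = (G a + G b) ^ 2 * (Const \<epsilon> + Z a b) + (G a - G b) ^ 2 * (Const \<epsilon> - Z a b)"
      unfolding e2 by (simp add: power2_eq_square algebra_simps)
    finally have *: "4 * (G a * G b * Z a b + Const (\<epsilon> / 2) * (G a ^ 2 + G b ^ 2)) =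
      (G a + G b) ^ 2 * (Const \<epsilon> + Z a b) + (G a - G b) ^ 2 * (Const \<epsilon> - Z a b)" .
    have "Const (1/4) * (4 * (G a * G b * Z a b + Const (\<epsilon> / 2) * (G a ^ 2 + G b ^ 2))) \<in> M"
      unfolding * by (intro qm_Const_mult[OF M] qm_add[OF M] qm_square_mult[OF M] pos) simp
    then show ?thesis unfolding h .
  qed
  then have "(\<Sum>a\<in>UNIV. \<Sum>b\<in>UNIV. G a * G b * Z a b + Const (\<epsilon> / 2) * (G a ^ 2 + G b ^ 2)) \<in> M"
    by (intro qm_sum[OF M])
  also have "(\<Sum>a\<in>UNIV. \<Sum>b\<in>UNIV. G a * G b * Z a b + Const (\<epsilon> / 2) * (G a ^ 2 + G b ^ 2)) =
      (\<Sum>a\<in>UNIV. \<Sum>b\<in>UNIV. G a * G b * Z a b) +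
      Const (\<epsilon> / 2) * ((\<Sum>a\<in>(UNIV::'n set). \<Sum>b\<in>(UNIV::'n set). G a ^ 2) + (\<Sum>a\<in>(UNIV::'n set). \<Sum>b\<in>UNIV. G b ^ 2))"
    by (simp only: sum.distrib sum_distrib_left distrib_left)
  also have "(\<Sum>a\<in>(UNIV::'n set). \<Sum>b\<in>(UNIV::'n set). G a ^ 2) = of_nat CARD('n) * (\<Sum>a\<in>UNIV. G a ^ 2)"
    by (simp add: sum_distrib_left)
  also have "(\<Sum>a\<in>(UNIV::'n set). \<Sum>b\<in>UNIV. G b ^ 2) = of_nat CARD('n) * (\<Sum>a\<in>UNIV. G a ^ 2)"
    by simp
  also have "(\<Sum>a\<in>UNIV. \<Sum>b\<in>UNIV. G a * G b * Z a b) +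
      Const (\<epsilon> / 2) * (of_nat CARD('n) * (\<Sum>a\<in>UNIV. G a ^ 2) + of_nat CARD('n) * (\<Sum>a\<in>UNIV. G a ^ 2)) = ?L"
  proof -
    have "Const (\<epsilon> * real CARD('n)) = Const (\<epsilon> / 2) * of_nat CARD('n) + Const (\<epsilon> / 2) * (of_nat CARD('n) :: 'n mpoly)"
      unfolding Const_of_nat[symmetric] Const_mult[symmetric] Const_add[symmetric] by simp
    then show ?thesis by (simp only: algebra_simps)
  qed
  finally show ?thesis .
qed

text \<open>With \<open>e = 1 - \<eta> Q\<close> the telescoping identity \<open>1 - e\<^sup>n = \<eta> Q \<Sum> e\<^sup>i\<close> leaves
  \<open>e\<^sup>n F\<close>, and \<open>e\<^sup>n\<close> is uniformly small away from \<open>S\<close>: every error term vanishing on \<open>S\<close>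
  is absorbed, via Putinar's theorem, by a small multiple of \<open>Q\<close>.\<close>

lemma local_certificates_glue:
  fixes M :: "'n::finite mpoly set"
  assumes M: "quadratic_module M" and arch: "Const N - (\<Sum>i\<in>UNIV. Var i ^ 2) \<in> M" and N: "N > 0"
    and S: "finite S" "S \<subseteq> qm_set M"
    and l: "\<And>u v. u \<in> S \<Longrightarrow> v \<in> S \<Longrightarrow> peval (l u) v = (if u = v then 1 else 0)"
    and idem: "1 - (\<Sum>u\<in>S. (1 - (1 - (l u)\<^sup>2)\<^sup>2)\<^sup>2) = T\<^sup>2 * \<rho>"
    and zero: "\<And>x. peval (point_gens S T l) x = 0 \<longleftrightarrow> x \<in> S"
    and F: "\<And>x. x \<in> qm_set M \<Longrightarrow> peval F x \<ge> 0" "\<And>u. u \<in> S \<Longrightarrow> peval F u = 0"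
    and loc: "\<And>u. u \<in> S \<Longrightarrow> \<exists>m\<in>M. \<exists>\<tau>. ord3 u \<tau> \<and> F = m + \<tau>"
    and \<epsilon>: "\<epsilon> > 0"
  shows "F + Const \<epsilon> * point_gens S T l \<in> M"
proof -
  define K where "K = qm_set M"
  have K: "compact K" unfolding K_def by (rule compact_qm_set[OF arch])
  define Q where "Q = point_gens S T l"
  define W where "W = (\<Sum>u\<in>S. \<Sum>a\<in>UNIV. (l u * coord u a) ^ 2)"
  have QW: "Q = T ^ 2 + W" by (simp add: Q_def W_def point_gens_def)
  have QS: "Q \<in> SOS" unfolding Q_def by (rule point_gens_SOS)
  have WS: "W \<in> SOS" unfolding W_def by (intro SOS_sum SOS_square)
  have putinar: "p \<in> M" if "\<And>x. x \<in> K \<Longrightarrow> peval p x > 0" for p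
    using Putinar_Positivstellensatz[OF M arch N] that by (simp add: K_def)
  define n where "n = real CARD('n)"
  have n: "n > 0" by (simp add: n_def)
  \<comment> \<open>The budget \<open>\<epsilon> Q\<close> is split: \<open>\<delta> Q\<close>,
    \<open>\<delta> T^2\<close> and \<open>n \<delta> W\<close> pay for three error terms, and the
    surplus \<open>\<delta> (n T^2 + W)\<close> is a sum of squares.\<close>
  define \<delta> where "\<delta> = \<epsilon> / (n + 2)"
  have \<delta>: "\<delta> > 0" "\<epsilon> = (n + 2) * \<delta>" using \<epsilon> n by (auto simp: \<delta>_def)
  have "\<forall>u\<in>S. \<exists>m d. m \<in> M \<and> F = m + (\<Sum>a\<in>UNIV. \<Sum>b\<in>UNIV. coord u a * coord u b * d a b) \<and> (\<forall>a b. peval (d a b) u = 0)"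
    using loc unfolding ord3_def by blast
  from bchoice[OF this] obtain m where "\<forall>u\<in>S. \<exists>d. m u \<in> M \<and>
      F = m u + (\<Sum>a\<in>UNIV. \<Sum>b\<in>UNIV. coord u a * coord u b * d a b) \<and> (\<forall>a b. peval (d a b) u = 0)" ..
  from bchoice[OF this] obtain d where "\<forall>u\<in>S. m u \<in> M \<and>
      F = m u + (\<Sum>a\<in>UNIV. \<Sum>b\<in>UNIV. coord u a * coord u b * d u a b) \<and> (\<forall>a b. peval (d u a b) u = 0)" ..
  then have md: "\<And>u. u \<in> S \<Longrightarrow> m u \<in> M"
    "\<And>u. u \<in> S \<Longrightarrow> F = m u + (\<Sum>a\<in>UNIV. \<Sum>b\<in>UNIV. coord u a * coord u b * d u a b)"
    "\<And>u a b. u \<in> S \<Longrightarrow> peval (d u a b) u = 0"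
    by (simp_all only:)
  define D where "D u = 1 - (1 - (l u)\<^sup>2)\<^sup>2" for u
  \<comment> \<open>As \<open>D u = l u * (l u * (2 - (l u)^2))\<close>, the two outer factors
    \<open>l u\<close> in \<open>(D u)^2\<close> turn the coordinates into generators. The rest goes
    into \<open>X\<close>, which vanishes at \<open>u\<close> through \<open>d\<close> and at the
    other points of \<open>S\<close> through \<open>l u\<close>.\<close>
  define X where "X u a b = (l u * (2 - (l u)\<^sup>2))\<^sup>2 * d u a b" for u a b
  have X0: "peval (X u a b) v = 0" if "u \<in> S" "v \<in> S" for u v a b
    using l[OF that] md(3)[OF that(1)] by (auto simp: X_def)
  obtain b where b: "b > 0" "\<And>x. x \<in> K \<Longrightarrow> \<bar>peval Q x\<bar> \<le> b"
    using compact_imp_bounded[OF compact_continuous_image[OF continuous_on_peval[of K Q] K]] unfolding bounded_pos by auto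
  \<comment> \<open>Makes \<open>0 \<le> e \<le> 1\<close> on \<open>K\<close>, with
    \<open>e = 1\<close> only on \<open>S\<close>.\<close>
  define \<eta> where "\<eta> = 1 / b"
  have \<eta>: "\<eta> > 0" using b by (simp add: \<eta>_def)
  define e where "e = 1 - Const \<eta> * Q"
  have e0: "0 \<le> peval e x" if "x \<in> K" for x
    using b(2)[OF that] b(1) by (simp add: e_def \<eta>_def abs_le_iff)
  have e1: "peval e x \<le> 1" for x
    using SOS_nonneg[OF QS, of x] \<eta> by (simp add: e_def)
  have e1': "peval e x < 1" if "x \<notin> S" for x
    using SOS_nonneg[OF QS, of x] \<eta> zero[of x] that by (simp add: e_def Q_def less_le)
  have small: "\<forall>\<^sub>F k in sequentially. \<forall>x\<in>K. \<bar>peval e x ^ k * peval Y x\<bar> < \<delta>"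
    if "\<And>u. u \<in> S \<Longrightarrow> peval Y u = 0" for Y
    using K e0 e1 e1' that \<delta>(1)
    by (intro power_mult_uniformly_small continuous_on_peval) auto
  have "\<forall>\<^sub>F k in sequentially. \<forall>x\<in>K. \<bar>peval e x ^ k * peval (\<rho> * F) x\<bar> < \<delta>"
    by (rule small) (simp add: F)
  moreover have "\<forall>\<^sub>F k in sequentially. \<forall>u\<in>S. \<forall>a\<in>UNIV. \<forall>b\<in>UNIV. \<forall>x\<in>K. \<bar>peval e x ^ k * peval (X u a b) x\<bar> < \<delta>"
    by (intro eventually_ball_finite S(1) finite ballI small) (rule X0)
  ultimately have "\<forall>\<^sub>F k in sequentially. (\<forall>x\<in>K. \<bar>peval e x ^ k * peval (\<rho> * F) x\<bar> < \<delta>) \<and>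
     (\<forall>u\<in>S. \<forall>a\<in>UNIV. \<forall>b\<in>UNIV. \<forall>x\<in>K. \<bar>peval e x ^ k * peval (X u a b) x\<bar> < \<delta>)"
    by (rule eventually_conj)
  then obtain k0 where k0: "\<forall>k\<ge>k0. (\<forall>x\<in>K. \<bar>peval e x ^ k * peval (\<rho> * F) x\<bar> < \<delta>) \<and>
     (\<forall>u\<in>S. \<forall>a\<in>UNIV. \<forall>b\<in>UNIV. \<forall>x\<in>K. \<bar>peval e x ^ k * peval (X u a b) x\<bar> < \<delta>)"
    unfolding eventually_sequentially ..
  have "k0 \<le> 2 * k0" by simp
  note k1 = mp[OF spec[OF k0, of "2 * k0"] this]
  \<comment> \<open>The even exponent makes \<open>E\<close> a square, hence an admissible
    multiplier.\<close>
  define E where "E = e ^ (2 * k0)"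
  have Esq: "E = (e ^ k0)\<^sup>2" by (simp add: E_def power_mult mult.commute)
  have E1: "\<bar>peval (E * (\<rho> * F)) x\<bar> < \<delta>" if "x \<in> K" for x
    using k1 that by (simp add: E_def)
  have E2: "\<bar>peval (E * X u a b) x\<bar> < \<delta>" if "x \<in> K" "u \<in> S" for x u a b
    using k1 that by (simp add: E_def)
  define r where "r = (\<Sum>i<2 * k0. e ^ i)"
  have tele: "1 - E = Const \<eta> * Q * r"
    unfolding E_def r_def one_diff_power_eq by (simp add: e_def)
  have p1: "Q * (Const \<eta> * r * F + Const \<delta>) \<in> M"
  proof (intro qm_SOS_mult[OF M _ QS] putinar)
    fix x assume x: "x \<in> K"
    have "peval r x \<ge> 0" using e0[OF x] by (simp add: r_def sum_nonneg)
    then have "peval (Const \<eta> * r * F) x \<ge> 0" using \<eta> F(1) x by (simp add: K_def)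
    then show "peval (Const \<eta> * r * F + Const \<delta>) x > 0" using \<delta>(1) by simp
  qed
  have p2: "T\<^sup>2 * (E * (\<rho> * F) + Const \<delta>) \<in> M"
  proof (intro qm_square_mult[OF M] putinar)
    fix x assume "x \<in> K"
    from E1[OF this] show "peval (E * (\<rho> * F) + Const \<delta>) x > 0" by (simp only: peval_add peval_Const)
  qed
  have p3: "(\<Sum>u\<in>S. (e ^ k0 * D u)\<^sup>2 * m u) \<in> M"
    by (intro qm_sum[OF M] qm_square_mult[OF M] md(1))
  have p4: "(\<Sum>u\<in>S. Const (\<delta> * real CARD('n)) * (\<Sum>a\<in>UNIV. (l u * coord u a) ^ 2) +
      (\<Sum>a\<in>UNIV. \<Sum>b\<in>UNIV. (l u * coord u a) * (l u * coord u b) * (E * X u a b))) \<in> M"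
  proof (intro qm_sum[OF M] qm_absorb_ord3[OF M] putinar)
    fix u a b x assume "u \<in> S" "x \<in> K"
    from E2[OF this(2,1), of a b] show "peval (Const \<delta> + E * X u a b) x > 0" "peval (Const \<delta> - E * X u a b) x > 0"
      by (simp_all only: peval_add peval_diff peval_Const)
  qed
  have p5: "Const \<delta> * (Const n * T\<^sup>2 + W) \<in> M"
    using \<delta>(1) n by (intro qm_Const_mult[OF M] qm_SOS[OF M] SOS_add WS SOS_mult[OF SOS_Const SOS_square]) auto
  have DF: "(D u)\<^sup>2 * F = (D u)\<^sup>2 * m u + (\<Sum>a\<in>UNIV. \<Sum>b\<in>UNIV. (l u * coord u a) * (l u * coord u b) * X u a b)"
    if "u \<in> S" for u
  proof -
    have "D u = l u * (l u * (2 - (l u)\<^sup>2))"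
      unfolding D_def by (simp add: power2_eq_square algebra_simps)
    then have "(D u)\<^sup>2 = (l u)\<^sup>2 * (l u * (2 - (l u)\<^sup>2))\<^sup>2" by (simp only: power_mult_distrib)
    then have "(D u)\<^sup>2 * (\<Sum>a\<in>UNIV. \<Sum>b\<in>UNIV. coord u a * coord u b * d u a b) =
      (\<Sum>a\<in>UNIV. \<Sum>b\<in>UNIV. (l u * coord u a) * (l u * coord u b) * X u a b)"
      unfolding X_def sum_distrib_left
      by (intro sum.cong refl) (simp only: power2_eq_square mult_ac)
    then show ?thesis by (subst md(2)[OF that]) (simp only: distrib_left)
  qed
  \<comment> \<open>Three parts: the telescoped one is a multiple of \<open>Q\<close>, the middle
    one a multiple of \<open>T^2\<close>, and the last one can use the local certificates.\<close>
  have "F = (1 - E) * F + E * ((1 - (\<Sum>u\<in>S. (D u)\<^sup>2)) * F) + E * (\<Sum>u\<in>S. (D u)\<^sup>2 * F)"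
    by (simp add: algebra_simps sum_distrib_left)
  also have "1 - (\<Sum>u\<in>S. (D u)\<^sup>2) = T\<^sup>2 * \<rho>" using idem by (simp add: D_def)
  also have "(\<Sum>u\<in>S. (D u)\<^sup>2 * F) = (\<Sum>u\<in>S. (D u)\<^sup>2 * m u) +
      (\<Sum>u\<in>S. \<Sum>a\<in>UNIV. \<Sum>b\<in>UNIV. (l u * coord u a) * (l u * coord u b) * X u a b)"
    by (simp add: DF sum.distrib)
  also have "E * ((\<Sum>u\<in>S. (D u)\<^sup>2 * m u) +
      (\<Sum>u\<in>S. \<Sum>a\<in>UNIV. \<Sum>b\<in>UNIV. (l u * coord u a) * (l u * coord u b) * X u a b)) =
      (\<Sum>u\<in>S. (e ^ k0 * D u)\<^sup>2 * m u) +
      (\<Sum>u\<in>S. \<Sum>a\<in>UNIV. \<Sum>b\<in>UNIV. (l u * coord u a) * (l u * coord u b) * (E * X u a b))"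
  proof -
    have "E * (\<Sum>u\<in>S. (D u)\<^sup>2 * m u) = (\<Sum>u\<in>S. (e ^ k0 * D u)\<^sup>2 * m u)"
      by (simp only: Esq sum_distrib_left power_mult_distrib mult.assoc)
    moreover have "E * (\<Sum>u\<in>S. \<Sum>a\<in>UNIV. \<Sum>b\<in>UNIV. (l u * coord u a) * (l u * coord u b) * X u a b) =
      (\<Sum>u\<in>S. \<Sum>a\<in>UNIV. \<Sum>b\<in>UNIV. (l u * coord u a) * (l u * coord u b) * (E * X u a b))"
      unfolding sum_distrib_left by (intro sum.cong refl) (simp only: mult_ac)
    ultimately show ?thesis by (simp only: distrib_left)
  qed
  finally have Feq: "F = (1 - E) * F + E * (T\<^sup>2 * \<rho> * F) + ((\<Sum>u\<in>S. (e ^ k0 * D u)\<^sup>2 * m u) +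
      (\<Sum>u\<in>S. \<Sum>a\<in>UNIV. \<Sum>b\<in>UNIV. (l u * coord u a) * (l u * coord u b) * (E * X u a b)))"
    (is "_ = _ + _ + (?P3 + ?R)") .
  have P4: "(\<Sum>u\<in>S. Const (\<delta> * real CARD('n)) * (\<Sum>a\<in>UNIV. (l u * coord u a) ^ 2) +
      (\<Sum>a\<in>UNIV. \<Sum>b\<in>UNIV. (l u * coord u a) * (l u * coord u b) * (E * X u a b))) = Const (\<delta> * n) * W + ?R"
    by (simp only: W_def n_def sum.distrib sum_distrib_left)
  have "F + Const \<epsilon> * Q = Q * (Const \<eta> * r * F + Const \<delta>) + T\<^sup>2 * (E * (\<rho> * F) + Const \<delta>) + ?P3 +
     (Const (\<delta> * n) * W + ?R) + Const \<delta> * (Const n * T\<^sup>2 + W)"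
  proof -
    have "Const \<epsilon> * Q = Const n * Const \<delta> * Q + Const \<delta> * Q + Const \<delta> * Q"
      unfolding \<delta>(2) by (simp add: Const_add Const_mult algebra_simps Const_numeral)
    also have "\<dots> = Const \<delta> * Q + Const \<delta> * T\<^sup>2 + Const (\<delta> * n) * W + Const \<delta> * (Const n * T\<^sup>2 + W)"
      by (simp add: QW Const_mult algebra_simps)
    finally have 1: "Const \<epsilon> * Q = Const \<delta> * Q + Const \<delta> * T\<^sup>2 + Const (\<delta> * n) * W + Const \<delta> * (Const n * T\<^sup>2 + W)" .
    have "(1 - E) * F = Q * (Const \<eta> * r * F)"
      unfolding tele by (simp only: mult_ac)
    moreover have "E * (T\<^sup>2 * \<rho> * F) = T\<^sup>2 * (E * (\<rho> * F))"
      by (simp only: mult_ac)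
    ultimately have 2: "F = Q * (Const \<eta> * r * F) + T\<^sup>2 * (E * (\<rho> * F)) + (?P3 + ?R)"
      using Feq by (simp only:)
    have "F + Const \<epsilon> * Q = (Q * (Const \<eta> * r * F) + T\<^sup>2 * (E * (\<rho> * F)) + (?P3 + ?R)) +
        (Const \<delta> * Q + Const \<delta> * T\<^sup>2 + Const (\<delta> * n) * W + Const \<delta> * (Const n * T\<^sup>2 + W))"
      by (rule arg_cong2[of _ _ _ _ "(+)", OF 2 1])
    then show ?thesis
      by (simp only: distrib_left add_ac mult.commute[of Q "Const \<delta>"] mult.commute[of "T\<^sup>2" "Const \<delta>"])
  qed
  also have "\<dots> \<in> M"
    by (intro qm_add[OF M] p1 p2 p3 p4[unfolded P4] p5)
  finally show ?thesis unfolding Q_def .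
qed

lemma eventually_small_scale:
  assumes "finite S" "\<And>u. u \<in> S \<Longrightarrow> \<exists>c0>0. \<forall>c\<le>c0. P u (c::real)"
  shows "\<exists>c0>0. \<forall>c\<le>c0. \<forall>u\<in>S. P u c"
  using assms
proof (induction S)
  case empty
  show ?case by (intro exI[of _ 1]) simp
next
  case (insert u S)
  then obtain c0 c1 where "c0 > 0" "\<forall>c\<le>c0. \<forall>u\<in>S. P u c" "c1 > 0" "\<forall>c\<le>c1. P u c"
    by (metis insertI1 insertI2)
  then show ?case by (intro exI[of _ "min c0 c1"]) auto
qed

text \<open>Quadratic growth makes the compact zero set discrete, hence finite. A multiple of
  \<open>Q\<close> is subtracted from \<open>f\<close> so that the rest is still nonnegative and
  locally certified; gluing then gives back only half of what was subtracted.\<close>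

theorem nonneg_with_strict_local_certs:
  fixes M :: "'n::finite mpoly set"
  assumes M: "quadratic_module M" and arch: "Const N - (\<Sum>i\<in>UNIV. Var i ^ 2) \<in> M" and N: "N > 0"
    and nn: "\<And>x. x \<in> qm_set M \<Longrightarrow> peval f x \<ge> 0"
    and loc: "\<And>u. u \<in> qm_set M \<Longrightarrow> peval f u = 0 \<Longrightarrow> strict_local_cert M u f"
  defines "S \<equiv> {u \<in> qm_set M. peval f u = 0}"
  shows "finite S \<and> (\<exists>T l \<rho> c. c > 0 \<and> f - Const c * point_gens S T l \<in> M \<and>
    (\<forall>u\<in>S. \<forall>v\<in>S. peval (l u) v = (if u = v then 1 else 0)) \<and> 1 - (\<Sum>u\<in>S. l u) = T * \<rho>)"
proof -
  define K where "K = qm_set M"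
  have K: "compact K" unfolding K_def by (rule compact_qm_set[OF arch])
  have S: "S = {u \<in> K. peval f u = 0}" by (simp add: S_def K_def)
  have cS: "compact S"
  proof -
    have "S = K \<inter> {u. peval f u = 0}" by (auto simp: S)
    then show ?thesis
      by (simp add: compact_Int_closed K closed_Collect_eq continuous_on_peval)
  qed
  have locS: "strict_local_cert M u f" if "u \<in> S" for u
    using that loc by (simp add: S K_def)
  have "\<exists>e>0. S \<inter> ball u e \<subseteq> {u}" if u: "u \<in> S" for u
  proof -
    obtain e c where e: "e > 0" "c > 0" "\<And>x. x \<in> K \<Longrightarrow> dist x u < e \<Longrightarrow> c * (dist x u)\<^sup>2 \<le> peval f x"
      using strict_local_cert_growth[OF locS[OF u], of K] unfolding K_def by blast
    have "x = u" if "x \<in> S" "dist x u < e" for x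
    proof -
      have "c * (dist x u)\<^sup>2 \<le> 0" using e(3)[of x] that by (simp add: S)
      then show ?thesis using e(2) by (simp add: mult_le_0_iff)
    qed
    then show ?thesis using e(1) by (intro exI[of _ e]) (auto simp: dist_commute)
  qed
  then obtain e where e: "\<And>u. u \<in> S \<Longrightarrow> e u > 0" "\<And>u. u \<in> S \<Longrightarrow> S \<inter> ball u (e u) \<subseteq> {u}"
    by metis
  have fS: "finite S"
  proof -
    have "S \<subseteq> (\<Union>u\<in>S. ball u (e u))" using e(1) by auto
    from compactE_image[OF cS _ this] obtain C where C: "C \<subseteq> S" "finite C" "S \<subseteq> (\<Union>u\<in>C. ball u (e u))"
      by auto
    have "S \<subseteq> C"
    proof
      fix x assume "x \<in> S"
      with C(3) obtain u where "u \<in> C" "x \<in> ball u (e u)" by blast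
      with e(2)[of u] \<open>x \<in> S\<close> C(1) have "x = u" by blast
      with \<open>u \<in> C\<close> show "x \<in> C" by simp
    qed
    with C(2) show ?thesis by (rule rev_finite_subset)
  qed
  obtain T l \<rho> \<rho>' where
    l: "\<forall>u\<in>S. \<forall>v\<in>S. peval (l u) v = (if u = v then 1 else 0)"
    and \<rho>: "1 - (\<Sum>u\<in>S. l u) = T * \<rho>" and \<rho>': "1 - (\<Sum>u\<in>S. (1 - (1 - (l u)\<^sup>2)\<^sup>2)\<^sup>2) = T\<^sup>2 * \<rho>'"
    and zero: "\<forall>x. peval (point_gens S T l) x = 0 \<longleftrightarrow> x \<in> S"
    using point_idempotents[OF fS] by (elim exE conjE) (rule that)
  define Q where "Q = point_gens S T l"
  have Qnn: "peval Q x \<ge> 0" for x unfolding Q_def by (intro SOS_nonneg point_gens_SOS)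
  \<comment> \<open>One index type for all generators, so that \<open>Q\<close> becomes a single
    finite sum of squares.\<close>
  define q where "q i = (case i of None \<Rightarrow> T | Some (u, a) \<Rightarrow> l u * coord u a)" for i :: "((real ^ 'n) \<times> 'n) option"
  define A where "A = insert None (Some ` (S \<times> (UNIV :: 'n set)))"
  have fA: "finite A" using fS by (simp add: A_def)
  have QA: "Q = (\<Sum>i\<in>A. q i ^ 2)"
  proof -
    have "(\<Sum>i\<in>A. q i ^ 2) = q None ^ 2 + (\<Sum>i\<in>Some ` (S \<times> (UNIV :: 'n set)). q i ^ 2)"
      unfolding A_def using fS by (subst sum.insert) auto
    also have "(\<Sum>i\<in>Some ` (S \<times> (UNIV :: 'n set)). q i ^ 2) = (\<Sum>p\<in>S \<times> UNIV. q (Some p) ^ 2)"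
      by (subst sum.reindex) auto
    also have "\<dots> = (\<Sum>u\<in>S. \<Sum>a\<in>UNIV. (l u * coord u a) ^ 2)"
      by (simp add: sum.cartesian_product q_def case_prod_unfold)
    finally show ?thesis by (simp add: Q_def point_gens_def q_def)
  qed
  have q0: "peval (q i) u = 0" if "i \<in> A" "u \<in> S" for i u
  proof -
    have "(\<Sum>i\<in>A. (peval (q i) u)\<^sup>2) = 0"
      using zero that(2) by (auto simp: QA[unfolded Q_def])
    then show ?thesis using fA that(1) by (simp add: sum_nonneg_eq_0_iff)
  qed
  have "\<exists>c0>0. \<forall>c\<le>c0. strict_local_cert M u (f - Const c * Q)" if "u \<in> S" for u
    unfolding QA using that q0 by (intro strict_local_cert_diff M locS fA) auto
  from eventually_small_scale[OF fS, of "\<lambda>u c. strict_local_cert M u (f - Const c * Q)", OF this] obtain c1 where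
    c1: "c1 > 0" "\<And>c u. c \<le> c1 \<Longrightarrow> u \<in> S \<Longrightarrow> strict_local_cert M u (f - Const c * Q)"
    by blast
  have "\<exists>e>0. \<forall>x\<in>K. dist x u < e \<longrightarrow> peval (f - Const c1 * Q) x \<ge> 0" if u: "u \<in> S" for u
  proof -
    obtain e c where e: "e > 0" "c > 0" "\<And>x. x \<in> K \<Longrightarrow> dist x u < e \<Longrightarrow> c * (dist x u)\<^sup>2 \<le> peval (f - Const c1 * Q) x"
      using strict_local_cert_growth[OF c1(2)[OF order_refl u], of K] unfolding K_def by blast
    have "peval (f - Const c1 * Q) x \<ge> 0" if "x \<in> K" "dist x u < e" for x
      using e(3)[OF that] e(2) by (intro order_trans[OF _ e(3)[OF that]]) simp
    then show ?thesis using e(1) by blast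
  qed
  then obtain e' where e': "\<And>u. u \<in> S \<Longrightarrow> e' u > 0"
    "\<And>u x. u \<in> S \<Longrightarrow> x \<in> K \<Longrightarrow> dist x u < e' u \<Longrightarrow> peval (f - Const c1 * Q) x \<ge> 0"
    by metis
  define K' where "K' = K - (\<Union>u\<in>S. ball u (e' u))"
  have cK': "compact K'" unfolding K'_def by (intro compact_diff K open_UN ballI open_ball)
  have fpos: "peval f x > 0" if "x \<in> K'" for x
  proof -
    have "x \<in> K" using that by (simp add: K'_def)
    moreover have "x \<notin> S" using that e'(1) by (force simp: K'_def)
    ultimately show ?thesis using nn[of x] by (auto simp: S K_def less_le)
  qed
  obtain \<delta> where \<delta>: "\<delta> > 0" "\<And>x. x \<in> K' \<Longrightarrow> \<delta> \<le> peval f x"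
  proof (cases "K' = {}")
    case True
    then show ?thesis using that[of 1] by simp
  next
    case False
    from continuous_attains_inf[OF cK' False continuous_on_peval] obtain x0
      where "x0 \<in> K'" "\<forall>x\<in>K'. peval f x0 \<le> peval f x" by blast
    then show ?thesis using that[of "peval f x0"] fpos by blast
  qed
  obtain b where b: "b > 0" "\<And>x. x \<in> K \<Longrightarrow> \<bar>peval Q x\<bar> \<le> b"
    using compact_imp_bounded[OF compact_continuous_image[OF continuous_on_peval[of K Q] K]]
    unfolding bounded_pos by auto
  \<comment> \<open>\<open>c \<le> c1\<close> serves the balls around the points of
    \<open>S\<close>, \<open>c * b \<le> \<delta>\<close> the compact rest, where
    \<open>f \<ge> \<delta>\<close>.\<close>
  define c where "c = min c1 (\<delta> / b)"
  have c: "c > 0" "c \<le> c1" "c * b \<le> \<delta>"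
    using c1 \<delta> b by (auto simp: c_def min_def field_simps)
  define F where "F = f - Const c * Q"
  have Fnn: "peval F x \<ge> 0" if x: "x \<in> K" for x
  proof (cases "x \<in> K'")
    case True
    have "c * peval Q x \<le> c * b" using b(2)[OF x] c(1) by (intro mult_left_mono) auto
    then show ?thesis using \<delta>(2)[OF True] c(3) by (simp add: F_def)
  next
    case False
    then obtain u where u: "u \<in> S" "dist x u < e' u" using x by (auto simp: K'_def dist_commute)
    have "peval (f - Const c1 * Q) x \<ge> 0" by (rule e'(2)[OF u(1) x u(2)])
    moreover have "c * peval Q x \<le> c1 * peval Q x" using c(2) Qnn by (intro mult_right_mono) auto
    ultimately show ?thesis by (simp add: F_def)
  qed
  have "F + Const (c / 2) * point_gens S T l \<in> M"
  proof (rule local_certificates_glue[OF M arch N fS, where \<rho> = \<rho>'])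
    show "S \<subseteq> qm_set M" by (auto simp: S_def)
    show "\<And>u v. u \<in> S \<Longrightarrow> v \<in> S \<Longrightarrow> peval (l u) v = (if u = v then 1 else 0)" using l by blast
    show "1 - (\<Sum>u\<in>S. (1 - (1 - (l u)\<^sup>2)\<^sup>2)\<^sup>2) = T\<^sup>2 * \<rho>'" by (rule \<rho>')
    show "\<And>x. (peval (point_gens S T l) x = 0) = (x \<in> S)" using zero by blast
    show "\<And>x. x \<in> qm_set M \<Longrightarrow> 0 \<le> peval F x" using Fnn by (simp add: K_def)
    show "peval F u = 0" if "u \<in> S" for u
      using that zero by (simp add: F_def Q_def S_def)
    show "0 < c / 2" using c by simp
    show "\<exists>m\<in>M. \<exists>\<tau>. ord3 u \<tau> \<and> F = m + \<tau>" if u: "u \<in> S" for u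
    proof -
      obtain c' m \<tau> where "c' > 0" "m \<in> M" "ord3 u \<tau>" "F = m + Const c' * norm_poly u + \<tau>"
        using c1(2)[OF c(2) u] unfolding strict_local_cert_def F_def[symmetric] by blast
      moreover from this have "m + Const c' * norm_poly u \<in> M"
        by (intro qm_add[OF M _ qm_Const_mult[OF M qm_SOS[OF M norm_poly_SOS]]]) auto
      ultimately show ?thesis by blast
    qed
  qed
  moreover have "F + Const (c / 2) * point_gens S T l = f - Const (c / 2) * point_gens S T l"
  proof -
    have "Const c = Const (c / 2) + (Const (c / 2) :: 'n mpoly)" by (simp flip: Const_add)
    then show ?thesis by (simp add: F_def Q_def algebra_simps)
  qed
  ultimately have "f - Const (c / 2) * point_gens S T l \<in> M" by simp
  then show ?thesis using fS l \<rho> c(1) by (intro conjI exI[of _ T] exI[of _ l] exI[of _ \<rho>] exI[of _ "c / 2"]) auto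
qed

text \<open>Finsler's lemma. On the unit sphere the open sets \<open>q + k s > 0\<close> grow with
  \<open>k\<close> and form a cover, so compactness yields one \<open>C\<close>; homogeneity extends
  the bound to all vectors.\<close>

lemma finsler:
  fixes H :: "'n::finite \<Rightarrow> 'n \<Rightarrow> real" and \<beta> :: "'l \<Rightarrow> 'n \<Rightarrow> real"
  assumes pos: "\<And>v :: real ^ 'n. v \<noteq> 0 \<Longrightarrow> (\<And>i. i \<in> A \<Longrightarrow> (\<Sum>a\<in>UNIV. \<beta> i a * v $ a) = 0) \<Longrightarrow> quad_form H (\<lambda>a. v $ a) > 0"
    and A: "finite A"
  shows "\<exists>C \<kappa>. C > 0 \<and> \<kappa> > 0 \<and> (\<forall>v :: 'n \<Rightarrow> real.
      quad_form H v + C * (\<Sum>i\<in>A. (\<Sum>a\<in>UNIV. \<beta> i a * v a)\<^sup>2) \<ge> \<kappa> * (\<Sum>a\<in>UNIV. (v a)\<^sup>2))"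
proof -
  define q where "q v = quad_form H (\<lambda>a. v $ a)" for v :: "real ^ 'n"
  define s where "s v = (\<Sum>i\<in>A. (\<Sum>a\<in>UNIV. \<beta> i a * v $ a)\<^sup>2)" for v :: "real ^ 'n"
  define B where "B = sphere (0 :: real ^ 'n) 1"
  have B: "compact B" by (simp add: B_def)
  have cq: "continuous_on U q" and cs: "continuous_on U s" for U
    unfolding q_def s_def quad_form_def by (intro continuous_intros)+
  have s0: "s v \<ge> 0" for v by (simp add: s_def sum_nonneg)
  have "B \<subseteq> (\<Union>k::nat. {v. 0 < q v + real k * s v})"
  proof
    fix v assume "v \<in> B"
    then have v: "v \<noteq> 0" by (auto simp: B_def)
    show "v \<in> (\<Union>k::nat. {v. 0 < q v + real k * s v})"
    proof (cases "s v = 0")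
      case True
      then have "(\<Sum>a\<in>UNIV. \<beta> i a * v $ a) = 0" if "i \<in> A" for i
        using that A unfolding s_def by (subst (asm) sum_nonneg_eq_0_iff) auto
      then have "q v > 0" unfolding q_def by (intro pos v)
      then show ?thesis by (auto intro!: exI[of _ 0])
    next
      case False
      then have "s v > 0" using s0[of v] by simp
      then obtain k :: nat where "real k * s v > - q v" using reals_Archimedean3 by blast
      then have "0 < q v + real k * s v" by linarith
      then show ?thesis by blast
    qed
  qed
  moreover have "open {v. 0 < q v + real k * s v}" for k :: nat
    by (intro open_Collect_less continuous_intros cq cs)
  ultimately obtain F :: "nat set" where F: "finite F" "B \<subseteq> (\<Union>k\<in>F. {v. 0 < q v + real k * s v})"
    using compactE_image[OF B, of UNIV "\<lambda>k. {v. 0 < q v + real k * s v}"] by auto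
  define C where "C = real (Max (insert 1 F))"
  have C: "C > 0" unfolding C_def using F(1) by (simp add: Max_gr_iff)
  have C': "q v + C * s v > 0" if v: "v \<in> B" for v
  proof -
    obtain k where k: "k \<in> F" "0 < q v + real k * s v" using v F(2) by blast
    have "k \<le> Max (insert 1 F)" using k F(1) by simp
    then have "real k * s v \<le> C * s v" unfolding C_def using s0 by (intro mult_right_mono) auto
    with k(2) show ?thesis by linarith
  qed
  have "axis undefined 1 \<in> B" by (simp add: B_def)
  then have "B \<noteq> {}" by blast
  moreover have "continuous_on B (\<lambda>v. q v + C * s v)" by (intro continuous_intros cq cs)
  ultimately obtain v0 where v0: "v0 \<in> B" "\<And>v. v \<in> B \<Longrightarrow> q v0 + C * s v0 \<le> q v + C * s v"
    using continuous_attains_inf[OF B] by blast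
  define \<kappa> where "\<kappa> = q v0 + C * s v0"
  have \<kappa>: "\<kappa> > 0" unfolding \<kappa>_def by (rule C'[OF v0(1)])
  have "\<kappa> * (\<Sum>a\<in>UNIV. (v a)\<^sup>2) \<le> quad_form H v + C * (\<Sum>i\<in>A. (\<Sum>a\<in>UNIV. \<beta> i a * v a)\<^sup>2)" for v :: "'n \<Rightarrow> real"
  proof -
    define w :: "real ^ 'n" where "w = (\<chi> a. v a)"
    have nw: "(norm w)\<^sup>2 = (\<Sum>a\<in>UNIV. (v a)\<^sup>2)"
      by (simp add: norm_vec_def L2_set_def w_def sum_nonneg)
    have qw: "q w = quad_form H v" and sw: "s w = (\<Sum>i\<in>A. (\<Sum>a\<in>UNIV. \<beta> i a * v a)\<^sup>2)"
      by (simp_all add: q_def s_def w_def)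
    show ?thesis
    proof (cases "w = 0")
      case True
      then have "v a = 0" for a by (metis w_def vec_lambda_beta zero_index)
      then show ?thesis by (simp add: quad_form_def)
    next
      case False
      define r where "r = norm w"
      have r: "r > 0" using False by (simp add: r_def)
      define x where "x = (1 / r) *\<^sub>R w"
      have x: "x \<in> B" using r by (simp add: B_def x_def r_def)
      have w: "w $ a = r * x $ a" for a using r by (simp add: x_def)
      have "q w = r\<^sup>2 * q x"
        unfolding q_def quad_form_def w sum_distrib_left by (intro sum.cong refl) (simp add: power2_eq_square)
      moreover have "s w = r\<^sup>2 * s x"
      proof -
        have eq: "(\<Sum>a\<in>UNIV. \<beta> i a * w $ a) = r * (\<Sum>a\<in>UNIV. \<beta> i a * x $ a)" for i
          unfolding w sum_distrib_left by (intro sum.cong refl) simp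
        show ?thesis unfolding s_def eq power_mult_distrib by (simp only: sum_distrib_left)
      qed
      moreover have "r\<^sup>2 * \<kappa> \<le> r\<^sup>2 * (q x + C * s x)"
        using v0(2)[OF x] by (intro mult_left_mono) (auto simp: \<kappa>_def)
      ultimately show ?thesis
        unfolding nw[symmetric] qw[symmetric] sw[symmetric] r_def[symmetric] by (simp add: algebra_simps)
    qed
  qed
  with C \<kappa> show ?thesis by blast
qed

section \<open>Optimality conditions\<close>

definition constraint_qm :: "('l \<Rightarrow> 'n::finite mpoly) \<Rightarrow> 'l set \<Rightarrow> 'l set \<Rightarrow> 'n mpoly set" where
  "constraint_qm c E I = {p + q | p q. p \<in> Ideal c E \<and> q \<in> QM c I}"

lemma constraint_qmI:
  "s0 \<in> SOS \<Longrightarrow> (\<And>j. j \<in> I \<Longrightarrow> s j \<in> SOS) \<Longrightarrow>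
   (\<Sum>i\<in>E. c i * p i) + (s0 + (\<Sum>j\<in>I. c j * s j)) \<in> constraint_qm c E I"
  unfolding constraint_qm_def Ideal_def QM_def by blast

lemma constraint_qmE:
  assumes "x \<in> constraint_qm c E I"
  obtains p s0 s where "x = (\<Sum>i\<in>E. c i * p i) + (s0 + (\<Sum>j\<in>I. c j * s j))" "s0 \<in> SOS" "\<forall>j\<in>I. s j \<in> SOS"
  using assms unfolding constraint_qm_def Ideal_def QM_def by blast

lemma quadratic_module_constraint_qm: "quadratic_module (constraint_qm c E I)"
  unfolding quadratic_module_def
proof (intro conjI ballI allI)
  show "1 \<in> constraint_qm c E I"
    using constraint_qmI[of 1 I "\<lambda>_. 0" c "\<lambda>_. 0" E] by simp
next
  fix x y assume "x \<in> constraint_qm c E I" "y \<in> constraint_qm c E I"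
  then obtain p s0 s p' s0' s' where
    x: "x = (\<Sum>i\<in>E. c i * p i) + (s0 + (\<Sum>j\<in>I. c j * s j))" "s0 \<in> SOS" "\<forall>j\<in>I. s j \<in> SOS" and
    y: "y = (\<Sum>i\<in>E. c i * p' i) + (s0' + (\<Sum>j\<in>I. c j * s' j))" "s0' \<in> SOS" "\<forall>j\<in>I. s' j \<in> SOS"
    by (elim constraint_qmE)
  have "x + y = (\<Sum>i\<in>E. c i * (p i + p' i)) + ((s0 + s0') + (\<Sum>j\<in>I. c j * (s j + s' j)))"
    unfolding x(1) y(1) by (simp add: distrib_left sum.distrib algebra_simps)
  also have "\<dots> \<in> constraint_qm c E I"
    using x y by (intro constraint_qmI SOS_add) auto
  finally show "x + y \<in> constraint_qm c E I" .
next
  fix x q assume "x \<in> constraint_qm c E I"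
  then obtain p s0 s where
    x: "x = (\<Sum>i\<in>E. c i * p i) + (s0 + (\<Sum>j\<in>I. c j * s j))" "s0 \<in> SOS" "\<forall>j\<in>I. s j \<in> SOS"
    by (elim constraint_qmE)
  have "q ^ 2 * x = (\<Sum>i\<in>E. c i * (q ^ 2 * p i)) + (q ^ 2 * s0 + (\<Sum>j\<in>I. c j * (q ^ 2 * s j)))"
    unfolding x(1) by (simp add: distrib_left sum_distrib_left mult.left_commute)
  also have "\<dots> \<in> constraint_qm c E I"
    using x by (intro constraint_qmI SOS_mult_square) auto
  finally show "q ^ 2 * x \<in> constraint_qm c E I" .
qed

lemma equality_mult_in_constraint_qm:
  assumes "finite E" "i \<in> E"
  shows "c i * p \<in> constraint_qm c E I"
proof -
  have "(\<Sum>k\<in>E. c k * (if k = i then p else 0)) = c i * p"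
    using assms by (simp add: if_distrib[of "\<lambda>q. _ * q"] cong: if_cong)
  then show ?thesis
    using constraint_qmI[of 0 I "\<lambda>_. 0" c "\<lambda>k. if k = i then p else 0" E] by simp
qed

lemma inequality_mult_in_constraint_qm:
  assumes "finite I" "j \<in> I" "s \<in> SOS"
  shows "c j * s \<in> constraint_qm c E I"
proof -
  have "(\<Sum>k\<in>I. c k * (if k = j then s else 0)) = c j * s"
    using assms by (simp add: if_distrib[of "\<lambda>q. _ * q"] cong: if_cong)
  then show ?thesis
    using constraint_qmI[of 0 I "\<lambda>k. if k = j then s else 0" c "\<lambda>_. 0" E] assms(3) by simp
qed

lemma qm_set_constraint_qm:
  assumes "finite E" "finite I"
  shows "qm_set (constraint_qm c E I) = semialg c E I"
proof (intro equalityI subsetI)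
  fix x assume x: "x \<in> qm_set (constraint_qm c E I)"
  have "peval (c i) x = 0" if "i \<in> E" for i
  proof -
    have "peval (c i * 1) x \<ge> 0" "peval (c i * (- 1)) x \<ge> 0"
      using x equality_mult_in_constraint_qm[OF assms(1) that] unfolding qm_set_def by blast+
    then show ?thesis by simp
  qed
  moreover have "peval (c j) x \<ge> 0" if "j \<in> I" for j
  proof -
    have "peval (c j * 1) x \<ge> 0"
      using x inequality_mult_in_constraint_qm[OF assms(2) that SOS_1] unfolding qm_set_def by blast
    then show ?thesis by simp
  qed
  ultimately show "x \<in> semialg c E I" by (simp add: semialg_def)
next
  fix x assume "x \<in> semialg c E I"
  then have x: "\<And>i. i \<in> E \<Longrightarrow> peval (c i) x = 0" "\<And>j. j \<in> I \<Longrightarrow> peval (c j) x \<ge> 0"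
    by (auto simp: semialg_def)
  show "x \<in> qm_set (constraint_qm c E I)"
    unfolding qm_set_def
  proof (intro CollectI ballI)
    fix q assume "q \<in> constraint_qm c E I"
    then obtain p s0 s where
      q: "q = (\<Sum>i\<in>E. c i * p i) + (s0 + (\<Sum>j\<in>I. c j * s j))" "s0 \<in> SOS" "\<forall>j\<in>I. s j \<in> SOS"
      by (elim constraint_qmE)
    have "peval q x = peval s0 x + (\<Sum>j\<in>I. peval (c j) x * peval (s j) x)"
      using x by (simp add: q(1))
    also have "\<dots> \<ge> 0"
      by (rule add_nonneg_nonneg[OF SOS_nonneg[OF q(2)] sum_nonneg[OF mult_nonneg_nonneg[OF x(2) SOS_nonneg]]])
        (use q in auto)
    finally show "peval q x \<ge> 0" .
  qed
qed

lemma pdiff_commute: "pdiff i (pdiff j p) = pdiff j (pdiff i p)"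
  by (induction p rule: mpoly_induct) (auto simp: algebra_simps simp flip: Const_1)

text \<open>For an equality any multiplier is allowed; for an inequality it has to be a square. The
  square of \<open>sqrt \<nu> - C L / (2 sqrt \<nu>)\<close> agrees with \<open>\<nu> - C L\<close>
  up to a multiple of \<open>L^2\<close>, whose product with \<open>c\<close> is of third order.
  Dividing by the root needs \<nu> > 0, which strict complementarity provides.\<close>

lemma multiplier_expansion:
  assumes c: "peval c u = 0"
  defines "L \<equiv> lin_poly u (\<lambda>a. peval (pdiff a c) u)"
    and "q \<equiv> quad_poly u (\<lambda>a b. peval (pdiff b (pdiff a c)) u / 2)"
  shows "ord3 u (c * (Const \<nu> - Const C * L) - (Const \<nu> * L + Const \<nu> * q - Const C * L ^ 2))"
    and "\<nu> > 0 \<Longrightarrow> ord3 u (c * (Const (sqrt \<nu>) - Const (C / (2 * sqrt \<nu>)) * L) ^ 2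
      - (Const \<nu> * L + Const \<nu> * q - Const C * L ^ 2))"
proof -
  obtain \<tau> where \<tau>: "ord3 u \<tau>" "c = L + q + \<tau>"
    using Taylor2[of u c] c unfolding L_def q_def by auto
  have r: "ord2 u (q + \<tau>)"
    unfolding q_def by (intro ord2_add ord2_quad_poly ord3_imp_ord2 \<tau>(1))
  have L0: "peval L u = 0" by (simp add: L_def)
  have "c * (Const \<nu> - Const C * L) - (Const \<nu> * L + Const \<nu> * q - Const C * L ^ 2) =
      Const \<nu> * \<tau> - Const C * ((q + \<tau>) * L)"
    by (subst \<tau>(2)) (simp add: power2_eq_square algebra_simps)
  also have "ord3 u \<dots>"
    by (intro ord3_diff ord3_mult ord2_mult_vanish \<tau>(1) r L0)
  finally show 1: "ord3 u (c * (Const \<nu> - Const C * L) - (Const \<nu> * L + Const \<nu> * q - Const C * L ^ 2))" .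
  assume "\<nu> > 0"
  define s where "s = sqrt \<nu>"
  define k where "k = C / (2 * sqrt \<nu>)"
  have sk: "s * s = \<nu>" "s * k + s * k = C" using \<open>\<nu> > 0\<close> by (auto simp: s_def k_def)
  have sq: "(Const s - Const k * L) ^ 2 = Const (s * s) - Const (s * k + s * k) * L + Const k ^ 2 * L ^ 2"
    by (simp add: Const_mult Const_add Const_numeral power2_eq_square algebra_simps)
  have eq: "c * (Const s - Const k * L) ^ 2 - (Const \<nu> * L + Const \<nu> * q - Const C * L ^ 2) =
      (c * (Const \<nu> - Const C * L) - (Const \<nu> * L + Const \<nu> * q - Const C * L ^ 2)) + Const k ^ 2 * (L ^ 2 * c)"
    unfolding sq sk by (simp add: algebra_simps)
  have "ord2 u (L ^ 2)" unfolding power2_eq_square by (intro vanish_mult_vanish L0)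
  then have "ord3 u (Const k ^ 2 * (L ^ 2 * c))" by (intro ord3_mult ord2_mult_vanish c)
  from ord3_add[OF 1 this] show "ord3 u (c * (Const (sqrt \<nu>) - Const (C / (2 * sqrt \<nu>)) * L) ^ 2
      - (Const \<nu> * L + Const \<nu> * q - Const C * L ^ 2))"
    unfolding eq[unfolded s_def k_def] k_def .
qed

text \<open>Subtracting the expanded products from \<open>f\<close> cancels the linear terms by
  stationarity. It leaves the quadratic form of the Lagrangian plus \<open>C\<close> times the sum
  of the \<open>L i ^ 2\<close>, positive definite by Finsler's lemma and the second order
  condition.\<close>

lemma opt_conditions_imp_strict_local_cert:
  fixes c :: "'l \<Rightarrow> 'n::finite mpoly"
  assumes fin: "finite E" "finite I" and disj: "E \<inter> I = {}"
    and u: "u \<in> semialg c E I" and f0: "peval f u = 0"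
    and opt: "opt_conditions f c E I u"
  shows "strict_local_cert (constraint_qm c E I) u f"
proof -
  let ?M = "constraint_qm c E I"
  note M = quadratic_module_constraint_qm[of c E I]
  define A where "A = E \<union> active c I u"
  obtain \<nu> where lag: "lagrange_mult f c E I u \<nu>" and scc: "SCC c I u \<nu>" and sosc: "SOSC f c E I u \<nu>"
    using opt by (auto simp: opt_conditions_def)
  have fA: "finite A" and AE: "A \<subseteq> E \<union> I" using fin by (auto simp: A_def active_def)
  have cA: "peval (c i) u = 0" if "i \<in> A" for i
    using that u by (auto simp: A_def active_def semialg_def)
  \<comment> \<open>Inactive inequalities drop out, as complementarity gives them multiplier
    0.\<close>
  have \<nu>0: "\<nu> i = 0" if "i \<in> (E \<union> I) - A" for i
    using that lag by (auto simp: A_def active_def lagrange_mult_def)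
  have \<nu>pos: "\<nu> i > 0" if "i \<in> A - E" for i
    using that scc by (auto simp: A_def active_def SCC_def)
  have sumA: "(\<Sum>i\<in>E \<union> I. \<nu> i * g i) = (\<Sum>i\<in>A. \<nu> i * g i)" for g :: "'l \<Rightarrow> real"
    using fin AE \<nu>0 by (intro sum.mono_neutral_right) auto
  define \<beta> where "\<beta> i a = peval (pdiff a (c i)) u" for i a
  \<comment> \<open>Half Hessians, as they occur in the Taylor expansion; hence the factor 2 in
    \<open>hess_eq\<close>.\<close>
  define h where "h i a b = peval (pdiff b (pdiff a (c i))) u / 2" for i a b
  define hf where "hf a b = peval (pdiff b (pdiff a f)) u / 2" for a b
  define H where "H a b = hf a b - (\<Sum>i\<in>A. \<nu> i * h i a b)" for a b
  have grad_eq: "peval (pdiff a f) u = (\<Sum>i\<in>A. \<nu> i * \<beta> i a)" for a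
  proof -
    have "grad (peval f) u $ a = (\<Sum>i\<in>E \<union> I. \<nu> i *\<^sub>R grad (peval (c i)) u) $ a"
      using lag by (simp add: lagrange_mult_def)
    then show ?thesis by (simp add: grad_peval sumA \<beta>_def)
  qed
  have hess_eq: "inner v ((hessian (peval f) u - (\<Sum>i\<in>E \<union> I. \<nu> i *\<^sub>R hessian (peval (c i)) u)) *v v)
      = 2 * quad_form H (\<lambda>a. v $ a)" for v
  proof -
    have "(hessian (peval f) u - (\<Sum>i\<in>E \<union> I. \<nu> i *\<^sub>R hessian (peval (c i)) u)) $ a $ b = 2 * H a b" for a b
      by (simp add: hessian_peval H_def hf_def h_def sumA sum_divide_distrib[symmetric])
    then show ?thesis
      by (simp add: inner_vec_def matrix_vector_mult_def quad_form_def sum_distrib_left mult_ac)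
  qed
  have "quad_form H (\<lambda>a. v $ a) > 0" if "v \<noteq> 0" "\<And>i. i \<in> A \<Longrightarrow> (\<Sum>a\<in>UNIV. \<beta> i a * v $ a) = 0" for v
  proof -
    have "inner v (grad (peval (c i)) u) = 0" if "i \<in> A" for i
      using \<open>\<And>i. i \<in> A \<Longrightarrow> (\<Sum>a\<in>UNIV. \<beta> i a * v $ a) = 0\<close>[OF that]
      by (simp add: inner_vec_def grad_peval \<beta>_def mult.commute)
    then have "inner v ((hessian (peval f) u - (\<Sum>i\<in>E \<union> I. \<nu> i *\<^sub>R hessian (peval (c i)) u)) *v v) > 0"
      using sosc that(1) unfolding SOSC_def A_def by blast
    then show ?thesis by (simp add: hess_eq)
  qed
  from finsler[OF this fA] obtain C \<kappa> where C: "C > 0" and \<kappa>: "\<kappa> > 0"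
    and pd: "\<And>v. quad_form H v + C * (\<Sum>i\<in>A. (\<Sum>a\<in>UNIV. \<beta> i a * v a)\<^sup>2) \<ge> \<kappa> * (\<Sum>a\<in>UNIV. (v a)\<^sup>2)"
    by blast
  define L where "L i = lin_poly u (\<beta> i)" for i
  define mult where "mult i = (if i \<in> E then Const (\<nu> i) - Const C * L i
      else (Const (sqrt (\<nu> i)) - Const (C / (2 * sqrt (\<nu> i))) * L i) ^ 2)" for i
  define exp where "exp i = Const (\<nu> i) * L i + Const (\<nu> i) * quad_poly u (h i) - Const C * L i ^ 2" for i
  have ex: "ord3 u (c i * mult i - exp i)" if "i \<in> A" for i
    using multiplier_expansion[OF cA[OF that], where \<nu> = "\<nu> i" and C = C] \<nu>pos[of i] that
    by (auto simp: mult_def exp_def L_def \<beta>_def[abs_def] h_def[abs_def])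
  have mM: "(\<Sum>i\<in>A. c i * mult i) \<in> ?M"
  proof (rule qm_sum[OF M])
    fix i assume i: "i \<in> A"
    show "c i * mult i \<in> ?M"
    proof (cases "i \<in> E")
      case True
      then show ?thesis by (intro equality_mult_in_constraint_qm fin)
    next
      case False
      then show ?thesis using i
        by (auto simp: A_def active_def mult_def intro!: inequality_mult_in_constraint_qm fin SOS_square)
    qed
  qed
  \<comment> \<open>What remains of the quadratic part after the reserve
    \<open>\<kappa> |x - u|^2\<close> is set aside; by the choice of \<kappa> it is still
    nonnegative.\<close>
  define B where "B a b = (H a b + C * (\<Sum>i\<in>A. \<beta> i a * \<beta> i b)) - \<kappa> * (if a = b then 1 else 0)" for a b
  have BS: "quad_poly u B \<in> SOS"
  proof (rule psd_quad_poly_SOS)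
    show "B a b = B b a" for a b
      by (simp add: B_def H_def hf_def h_def pdiff_commute[of a b] mult.commute)
    fix v
    have "quad_form B v = quad_form H v + C * (\<Sum>i\<in>A. (\<Sum>a\<in>UNIV. \<beta> i a * v a)\<^sup>2) - \<kappa> * (\<Sum>a\<in>UNIV. (v a)\<^sup>2)"
    proof -
      have "(\<Sum>a\<in>UNIV. \<Sum>b\<in>UNIV. (\<Sum>i\<in>A. \<beta> i a * \<beta> i b) * (v a * v b)) = (\<Sum>i\<in>A. (\<Sum>a\<in>UNIV. \<beta> i a * v a)\<^sup>2)"
      proof -
        have "(\<Sum>i\<in>A. (\<Sum>a\<in>UNIV. \<beta> i a * v a)\<^sup>2) = (\<Sum>i\<in>A. \<Sum>a\<in>UNIV. \<Sum>b\<in>UNIV. \<beta> i a * \<beta> i b * (v a * v b))"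
          unfolding power2_eq_square sum_product by (intro sum.cong refl) simp
        also have "\<dots> = (\<Sum>a\<in>UNIV. \<Sum>i\<in>A. \<Sum>b\<in>UNIV. \<beta> i a * \<beta> i b * (v a * v b))"
          by (rule sum.swap)
        also have "\<dots> = (\<Sum>a\<in>UNIV. \<Sum>b\<in>UNIV. \<Sum>i\<in>A. \<beta> i a * \<beta> i b * (v a * v b))"
          by (intro sum.cong refl sum.swap)
        finally show ?thesis by (simp add: sum_distrib_right)
      qed
      moreover have "(\<Sum>a\<in>UNIV. \<Sum>b\<in>UNIV. (if a = b then 1 else 0) * (v a * v b)) = (\<Sum>a\<in>UNIV. (v a)\<^sup>2)"
        by (simp add: if_distrib[of "\<lambda>r. r * _"] power2_eq_square cong: if_cong)
      moreover have "quad_form B v = quad_form H v + C * (\<Sum>a\<in>UNIV. \<Sum>b\<in>UNIV. (\<Sum>i\<in>A. \<beta> i a * \<beta> i b) * (v a * v b))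
         - \<kappa> * (\<Sum>a\<in>UNIV. \<Sum>b\<in>UNIV. (if a = b then 1 else 0) * (v a * v b))"
      proof -
        define G where "G a b = (\<Sum>i\<in>A. \<beta> i a * \<beta> i b)" for a b
        have "quad_form (\<lambda>a b. (H a b + C * G a b) - \<kappa> * (if a = b then 1 else 0)) v =
          quad_form H v + C * (\<Sum>a\<in>UNIV. \<Sum>b\<in>UNIV. G a b * (v a * v b))
           - \<kappa> * (\<Sum>a\<in>UNIV. \<Sum>b\<in>UNIV. (if a = b then 1 else 0) * (v a * v b))"
          unfolding quad_form_def sum_distrib_left sum.distrib[symmetric] sum_subtractf[symmetric]
          by (intro sum.cong refl) (simp only: left_diff_distrib distrib_right mult.assoc)
        then show ?thesis unfolding G_def B_def[abs_def] .
      qed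
      ultimately show ?thesis by simp
    qed
    then show "quad_form B v \<ge> 0" using pd[of v] by simp
  qed
  have B: "quad_poly u B = quad_poly u hf - (\<Sum>i\<in>A. Const (\<nu> i) * quad_poly u (h i)) + Const C * (\<Sum>i\<in>A. L i ^ 2)
      - Const \<kappa> * norm_poly u"
    unfolding B_def H_def L_def lin_poly_square norm_poly_quad
    by (simp only: quad_poly_diff quad_poly_add quad_poly_scale quad_poly_sum)
  obtain \<tau> where \<tau>: "ord3 u \<tau>" "f = lin_poly u (\<lambda>a. peval (pdiff a f) u) + quad_poly u hf + \<tau>"
    using Taylor2[of u f] f0 unfolding hf_def by auto
  have "lin_poly u (\<lambda>a. peval (pdiff a f) u) = (\<Sum>i\<in>A. Const (\<nu> i) * L i)"
    unfolding grad_eq L_def lin_poly_sum ..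
  with \<tau>(2) have f: "f = (\<Sum>i\<in>A. Const (\<nu> i) * L i) + quad_poly u hf + \<tau>" by simp
  have "(\<Sum>i\<in>A. exp i) = (\<Sum>i\<in>A. Const (\<nu> i) * L i) + (\<Sum>i\<in>A. Const (\<nu> i) * quad_poly u (h i)) - Const C * (\<Sum>i\<in>A. L i ^ 2)"
    by (simp add: exp_def sum.distrib sum_subtractf sum_distrib_left)
  then have "f = (\<Sum>i\<in>A. exp i) + quad_poly u B + Const \<kappa> * norm_poly u + \<tau>"
    unfolding B by (subst f) simp
  moreover have "(\<Sum>i\<in>A. exp i) = (\<Sum>i\<in>A. c i * mult i) - (\<Sum>i\<in>A. c i * mult i - exp i)"
    by (simp add: sum_subtractf)
  ultimately have "f = ((\<Sum>i\<in>A. c i * mult i) + quad_poly u B) + Const \<kappa> * norm_poly u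
      + (\<tau> - (\<Sum>i\<in>A. c i * mult i - exp i))"
    by (simp add: algebra_simps)
  moreover have "(\<Sum>i\<in>A. c i * mult i) + quad_poly u B \<in> ?M"
    by (intro qm_add[OF M] mM qm_SOS[OF M] BS)
  moreover have "ord3 u (\<tau> - (\<Sum>i\<in>A. c i * mult i - exp i))"
    by (intro ord3_diff \<tau>(1) ord3_sum ex)
  ultimately show ?thesis using \<kappa> unfolding strict_local_cert_def by blast
qed

section \<open>Duality and genericity\<close>

text \<open>Induction on the generators. If dropping \<open>s\<close> admits a separating
  \<open>h0\<close>, all vectors are projected along \<open>a s\<close> into the kernel of
  \<open>h0\<close>, and the induction hypothesis applies to the projections.\<close>

lemma farkas_finite:
  fixes a :: "'s \<Rightarrow> 'i \<Rightarrow> real"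
  assumes "finite S" "\<And>h. (\<And>u. u \<in> S \<Longrightarrow> (\<Sum>i\<in>A. h i * a u i) \<le> 0) \<Longrightarrow> (\<Sum>i\<in>A. h i * b i) \<le> 0"
    and A: "finite A"
  shows "\<exists>c. (\<forall>u\<in>S. c u \<ge> 0) \<and> (\<forall>i\<in>A. b i = (\<Sum>u\<in>S. c u * a u i))"
  using assms(1,2)
proof (induction S arbitrary: a b)
  case empty
  from empty[of b] have "(\<Sum>i\<in>A. b i * b i) = 0"
    by (intro antisym sum_nonneg) auto
  then show ?case using A by (simp add: sum_nonneg_eq_0_iff)
next
  case (insert s S)
  define ip where "ip h v = (\<Sum>i\<in>A. h i * v i)" for h v :: "'i \<Rightarrow> real"
  have ip1: "ip (\<lambda>i. h i - r * g i) v = ip h v - r * ip g v" for h g v r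
    by (simp add: ip_def left_diff_distrib sum_subtractf sum_distrib_left mult.assoc)
  have ip2: "ip h (\<lambda>i. v i - r * w i) = ip h v - r * ip h w" for h v w r
    by (simp add: ip_def right_diff_distrib sum_subtractf sum_distrib_left mult.left_commute)
  note H = insert.prems[folded ip_def]
  show ?case
  proof (cases "\<forall>h. (\<forall>u\<in>S. ip h (a u) \<le> 0) \<longrightarrow> ip h b \<le> 0")
    case True
    then obtain c where "\<forall>u\<in>S. c u \<ge> 0" "\<forall>i\<in>A. b i = (\<Sum>u\<in>S. c u * a u i)"
      using insert.IH[of a b] unfolding ip_def by blast
    moreover have "(\<Sum>u\<in>S. (if u = s then 0 else c u) * a u i) = (\<Sum>u\<in>S. c u * a u i)" for i
      using insert.hyps by (intro sum.cong) auto
    ultimately show ?thesis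
      using insert.hyps by (intro exI[of _ "\<lambda>u. if u = s then 0 else c u"]) auto
  next
    case False
    then obtain h0 where h0: "\<And>u. u \<in> S \<Longrightarrow> ip h0 (a u) \<le> 0" "ip h0 b > 0"
      by (auto simp: not_le)
    \<comment> \<open>Otherwise \<open>h0\<close> would separate \<open>b\<close> from all
      generators, \<open>a s\<close> included.\<close>
    have t: "ip h0 (a s) > 0"
    proof (rule ccontr)
      assume "\<not> ?thesis"
      then have "ip h0 b \<le> 0" using h0 by (intro H) auto
      with h0 show False by simp
    qed
    define t where "t = ip h0 (a s)"
    define a' where "a' u = (\<lambda>i. a u i - (ip h0 (a u) / t) * a s i)" for u
    define b' where "b' = (\<lambda>i. b i - (ip h0 b / t) * a s i)"
    have "\<exists>c. (\<forall>u\<in>S. c u \<ge> 0) \<and> (\<forall>i\<in>A. b' i = (\<Sum>u\<in>S. c u * a' u i))"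
    proof (rule insert.IH, fold ip_def)
      fix h assume h: "\<And>u. u \<in> S \<Longrightarrow> ip h (a' u) \<le> 0"
      \<comment> \<open>A multiple of \<open>h0\<close> is subtracted to make \<open>y\<close>
        vanish on \<open>a s\<close>; on the original vectors \<open>y\<close> then takes the values
        of \<open>h\<close> on the projected ones.\<close>
      define y where "y = (\<lambda>i. h i - (ip h (a s) / t) * h0 i)"
      have "ip y b \<le> 0"
      proof (rule H)
        fix u assume "u \<in> insert s S"
        then show "ip y (a u) \<le> 0"
        proof
          assume "u = s"
          then show ?thesis using t unfolding y_def ip1 by (simp add: t_def)
        next
          assume "u \<in> S"
          from h[OF this] show ?thesis unfolding y_def ip1 a'_def ip2 by (simp add: mult.commute)
        qed
      qed
      then show "ip h b' \<le> 0" unfolding y_def ip1 b'_def ip2 by (simp add: mult.commute)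
    qed
    then obtain c where c: "\<And>u. u \<in> S \<Longrightarrow> c u \<ge> 0" "\<And>i. i \<in> A \<Longrightarrow> b' i = (\<Sum>u\<in>S. c u * a' u i)" by blast
    \<comment> \<open>The weight of \<open>a s\<close>; nonnegative because \<open>h0\<close> is
      positive on \<open>b\<close> and nonpositive on the old generators.\<close>
    define r where "r = ip h0 b / t - (\<Sum>u\<in>S. c u * (ip h0 (a u) / t))"
    have "r \<ge> 0"
    proof -
      have "(\<Sum>u\<in>S. c u * (ip h0 (a u) / t)) \<le> 0"
        using c(1) h0(1) t by (intro sum_nonpos mult_nonneg_nonpos divide_nonpos_pos) (auto simp: t_def)
      moreover have "ip h0 b / t \<ge> 0" using h0(2) t by (simp add: t_def)
      ultimately show ?thesis by (simp add: r_def)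
    qed
    moreover have "b i = r * a s i + (\<Sum>u\<in>S. c u * a u i)" if "i \<in> A" for i
    proof -
      have "b i = b' i + (ip h0 b / t) * a s i" by (simp add: b'_def)
      also have "b' i = (\<Sum>u\<in>S. c u * a u i) - (\<Sum>u\<in>S. c u * (ip h0 (a u) / t)) * a s i"
        unfolding c(2)[OF that] a'_def by (simp add: right_diff_distrib sum_subtractf sum_distrib_right mult.assoc)
      finally show ?thesis by (simp add: r_def algebra_simps)
    qed
    moreover have "(\<Sum>u\<in>S. (if u = s then r else c u) * a u i) = (\<Sum>u\<in>S. c u * a u i)" for i
      using insert.hyps by (intro sum.cong) auto
    ultimately show ?thesis
      using insert.hyps c(1) by (intro exI[of _ "\<lambda>u. if u = s then r else c u"]) auto
  qed
qed

text \<open>A violated Farkas inequality gives a direction \<open>h\<close> that raises the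
  objective without lowering the dual polynomial at its zeros. Positivity of \<open>R\<close> makes
  the change strict there, and compactness then permits a step of positive length, against
  optimality.\<close>

lemma optimal_dual_atomic_certificate:
  fixes a :: "nat \<Rightarrow> 'n::finite mpoly" and m :: nat and lam b :: "nat \<Rightarrow> real" and R :: "'n mpoly"
  defines "f \<equiv> R - (\<Sum>i=1..m. Const (lam i) * a i)"
  assumes K: "compact K" and nn: "\<And>x. x \<in> K \<Longrightarrow> peval f x \<ge> 0"
    and R: "\<And>x. x \<in> K \<Longrightarrow> peval R x > 0"
    and fin: "finite {u \<in> K. peval f u = 0}"
    and opt: "\<And>lam'. (\<And>x. x \<in> K \<Longrightarrow> peval (R - (\<Sum>i=1..m. Const (lam' i) * a i)) x \<ge> 0) \<Longrightarrow>
       (\<Sum>i=1..m. b i * lam' i) \<le> (\<Sum>i=1..m. b i * lam i)"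
  shows "\<exists>c. (\<forall>u\<in>{u \<in> K. peval f u = 0}. c u \<ge> 0) \<and>
    (\<forall>i\<in>{1..m}. b i = (\<Sum>u\<in>{u \<in> K. peval f u = 0}. c u * peval (a i) u))"
proof (rule farkas_finite[OF fin, where a = "\<lambda>u i. peval (a i) u"])
  fix h :: "nat \<Rightarrow> real"
  assume h: "\<And>u. u \<in> {u \<in> K. peval f u = 0} \<Longrightarrow> (\<Sum>i=1..m. h i * peval (a i) u) \<le> 0"
  show "(\<Sum>i=1..m. h i * b i) \<le> 0"
  proof (rule ccontr)
    assume "\<not> ?thesis"
    then have hb: "(\<Sum>i=1..m. h i * b i) > 0" by simp
    define B where "B = (\<Sum>i=1..m. lam i * b i)"
    \<comment> \<open>Small enough that tilting \<open>h\<close> by \<open>- s * lam\<close> keeps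
      the objective increasing: \<open>s * B\<close> is at most half of the gain.\<close>
    define s where "s = (\<Sum>i=1..m. h i * b i) / (2 * (\<bar>B\<bar> + 1))"
    have s: "s > 0" using hb by (simp add: s_def)
    have "s * B \<le> s * (\<bar>B\<bar> + 1)" using s by (intro mult_left_mono) auto
    also have "\<dots> = (\<Sum>i=1..m. h i * b i) / 2" by (simp add: s_def field_simps)
    finally have sB: "s * B < (\<Sum>i=1..m. h i * b i)" using hb by simp
    define h' where "h' i = h i - s * lam i" for i
    have hb': "(\<Sum>i=1..m. h' i * b i) > 0"
      using sB by (simp add: h'_def B_def left_diff_distrib sum_subtractf sum_distrib_left mult.assoc)
    define g where "g = - (\<Sum>i=1..m. Const (h' i) * a i)"
    \<comment> \<open>At a zero of \<open>f\<close> the combination of the \<open>a i\<close> with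
      weights \<open>lam i\<close> equals \<open>R\<close>, so the tilt contributes
      \<open>s * peval R u > 0\<close>.\<close>
    have gpos: "peval g u > 0" if "u \<in> K" "peval f u = 0" for u
    proof -
      have "(\<Sum>i=1..m. lam i * peval (a i) u) = peval R u"
        using that(2) by (simp add: f_def)
      moreover have "peval g u = s * (\<Sum>i=1..m. lam i * peval (a i) u) - (\<Sum>i=1..m. h i * peval (a i) u)"
        by (simp add: g_def h'_def left_diff_distrib sum_subtractf sum_distrib_left mult.assoc)
      moreover have "(\<Sum>i=1..m. h i * peval (a i) u) \<le> 0" using h that by simp
      ultimately show ?thesis using mult_pos_pos[OF s R[OF that(1)]] by simp
    qed
    define K' where "K' = K \<inter> {x. peval g x \<le> 0}"
    have cK': "compact K'" unfolding K'_def
      by (intro compact_Int_closed K closed_Collect_le continuous_intros)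
    obtain \<delta> where \<delta>: "\<delta> > 0" "\<And>x. x \<in> K' \<Longrightarrow> \<delta> \<le> peval f x"
    proof (cases "K' = {}")
      case True
      then show ?thesis using that[of 1] by simp
    next
      case False
      from continuous_attains_inf[OF cK' False continuous_on_peval] obtain x0
        where x0: "x0 \<in> K'" "\<forall>x\<in>K'. peval f x0 \<le> peval f x" by blast
      then have "peval f x0 > 0" using nn[of x0] gpos[of x0] by (force simp: K'_def less_le)
      then show ?thesis using that[of "peval f x0"] x0 by blast
    qed
    obtain \<beta> where \<beta>: "\<beta> > 0" "\<And>x. x \<in> K \<Longrightarrow> \<bar>peval g x\<bar> \<le> \<beta>"
      using compact_imp_bounded[OF compact_continuous_image[OF continuous_on_peval[of K g] K]]
      unfolding bounded_pos by auto
    \<comment> \<open>On \<open>K'\<close>, where \<open>g\<close> is nonpositive,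
      \<open>f \<ge> \<delta>\<close>, and the step changes \<open>f\<close> by at most
      \<open>t * \<beta> = \<delta>\<close>.\<close>
    define t where "t = \<delta> / \<beta>"
    have t: "t > 0" using \<delta> \<beta> by (simp add: t_def)
    have "(\<Sum>i=1..m. b i * (lam i + t * h' i)) \<le> (\<Sum>i=1..m. b i * lam i)"
    proof (rule opt)
      fix x assume x: "x \<in> K"
      have eq: "peval (R - (\<Sum>i=1..m. Const (lam i + t * h' i) * a i)) x = peval f x + t * peval g x"
        by (simp add: f_def g_def distrib_right sum.distrib sum_distrib_left mult.assoc)
      show "0 \<le> peval (R - (\<Sum>i=1..m. Const (lam i + t * h' i) * a i)) x"
      proof (cases "x \<in> K'")
        case True
        have "t * \<bar>peval g x\<bar> \<le> t * \<beta>" using \<beta>(2)[OF x] t by (intro mult_left_mono) auto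
        also have "t * \<beta> = \<delta>" using \<beta> by (simp add: t_def)
        finally have "- (t * peval g x) \<le> \<delta>"
          using t abs_ge_minus_self[of "t * peval g x"] by (simp add: abs_mult)
        then show ?thesis using \<delta>(2)[OF True] unfolding eq by linarith
      next
        case False
        then have "peval g x > 0" using x by (simp add: K'_def)
        then show ?thesis using nn[OF x] t unfolding eq by simp
      qed
    qed
    moreover have "(\<Sum>i=1..m. b i * (lam i + t * h' i)) = (\<Sum>i=1..m. b i * lam i) + t * (\<Sum>i=1..m. h' i * b i)"
      by (simp add: distrib_left sum.distrib sum_distrib_left mult_ac)
    ultimately show False using mult_pos_pos[OF t hb'] by simp
  qed
qed simp

text \<open>A sum of squares is nonnegative, so a zero in \<open>K\<close> means infimum 0 there.
  Along the constant coefficient at most one value has this infimum; every fibre is a null set and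
  Fubini's theorem applies.\<close>

lemma generic_SOS_positive_on_compact:
  fixes K :: "(real ^ 'n::finite) set"
  shows "generic_in_SOS_le d (\<lambda>R. \<forall>x\<in>K. peval R x > 0)"
proof -
  obtain D where D: "countable D" "D \<subseteq> K" "K \<subseteq> closure D" using separable[of K] by blast
  let ?I = "expos d - {0} :: 'n expo set"
  have I: "expos d = insert (0 :: 'n expo) ?I" by (auto simp: expos_def)
  have fI: "finite ?I" using finite_expos by blast
  define M where "M = Pi\<^sub>M (expos d :: 'n expo set) (\<lambda>_. lborel :: real measure)"
  define P where "P y x = (\<Sum>\<alpha>\<in>expos d. y \<alpha> * monom_eval \<alpha> x)" for y :: "'n expo \<Rightarrow> real" and x
  \<comment> \<open>Coefficient vectors with infimum exactly 0. Replacing \<open>K\<close> by the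
    countable dense \<open>D\<close> makes the set measurable.\<close>
  define N where "N = {y \<in> space M. (\<forall>x\<in>D. P y x \<ge> 0) \<and> (\<forall>n::nat. \<exists>x\<in>D. P y x < 1 / (real n + 1))}"
  have Pm: "(\<lambda>y. P y x) \<in> borel_measurable M" for x
    unfolding P_def M_def by measurable
  have Nm: "N \<in> sets M"
  proof -
    have [measurable]: "(\<lambda>y. P y x) \<in> borel_measurable M" for x by (rule Pm)
    have "{y \<in> space M. P y x \<ge> 0} \<in> sets M" "{y \<in> space M. P y x < r} \<in> sets M" for x r
      by measurable
    then show ?thesis unfolding N_def
      by (intro sets.sets_Collect_conj sets.sets_Collect_countable_All' sets.sets_Collect_countable_All
        sets.sets_Collect_countable_Ex' D(1))
  qed
  have shift: "P (y(0 := r)) x = r + (\<Sum>\<alpha>\<in>?I. y \<alpha> * monom_eval \<alpha> x)" for y r x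
  proof -
    have "P (y(0 := r)) x = (\<Sum>\<alpha>\<in>insert 0 ?I. (y(0 := r)) \<alpha> * monom_eval \<alpha> x)"
      unfolding P_def using I by simp
    also have "\<dots> = r + (\<Sum>\<alpha>\<in>?I. (y(0 := r)) \<alpha> * monom_eval \<alpha> x)"
      using fI by (subst sum.insert) auto
    also have "(\<Sum>\<alpha>\<in>?I. (y(0 := r)) \<alpha> * monom_eval \<alpha> x) = (\<Sum>\<alpha>\<in>?I. y \<alpha> * monom_eval \<alpha> x)"
      by (intro sum.cong) auto
    finally show ?thesis .
  qed
  have nless: "\<not> r < r'" if y: "y(0 := r) \<in> N" "y(0 := r') \<in> N" for y r r'
  proof
    assume less: "r < r'"
    obtain n :: nat where n: "1 / (real n + 1) < r' - r"
      using reals_Archimedean[of "r' - r"] less by (auto simp: inverse_eq_divide add.commute)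
    obtain x where x: "x \<in> D" "P (y(0 := r')) x < 1 / (real n + 1)" using y(2) by (auto simp: N_def)
    have "P (y(0 := r)) x \<ge> 0" using y(1) x(1) by (auto simp: N_def)
    with x(2) n show False by (simp add: shift)
  qed
  interpret product_sigma_finite "\<lambda>_ :: 'n expo. lborel :: real measure" ..
  have M: "M = Pi\<^sub>M (insert 0 ?I) (\<lambda>_. lborel)"
    unfolding M_def using I by simp
  have "emeasure M N = (\<integral>\<^sup>+ y. indicator N y \<partial>M)" using Nm by simp
  also have "\<dots> = (\<integral>\<^sup>+ y. (\<integral>\<^sup>+ r. indicator N (y(0 := r)) \<partial>lborel) \<partial>(Pi\<^sub>M ?I (\<lambda>_. lborel)))"
    unfolding M using Nm fI by (intro product_nn_integral_insert) (auto simp: M)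
  also have "\<dots> = (\<integral>\<^sup>+ y. 0 \<partial>(Pi\<^sub>M ?I (\<lambda>_. lborel :: real measure)))"
  proof (rule nn_integral_cong)
    fix y
    have "\<exists>r0. \<forall>r. y(0 := r) \<in> N \<longrightarrow> r = r0"
    proof (cases "\<exists>r0. y(0 := r0) \<in> N")
      case True
      then obtain r0 where r0: "y(0 := r0) \<in> N" ..
      have "r = r0" if r: "y(0 := r) \<in> N" for r
        using nless[OF r r0] nless[OF r0 r] by linarith
      then show ?thesis by (intro exI[of _ r0] allI impI)
    next
      case False
      then show ?thesis by simp
    qed
    then obtain r0 where r0: "\<forall>r. y(0 := r) \<in> N \<longrightarrow> r = r0" ..
    have "indicator N (y(0 := r)) \<le> (indicator {r0} r :: ennreal)" for r
      using spec[OF r0, of r] by (simp add: indicator_def)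
    then have "(\<integral>\<^sup>+ r. indicator N (y(0 := r)) \<partial>lborel) \<le> (\<integral>\<^sup>+ r. indicator {r0} r \<partial>(lborel :: real measure))"
      by (intro nn_integral_mono)
    also have "\<dots> = 0" by simp
    finally show "(\<integral>\<^sup>+ r. indicator N (y(0 := r)) \<partial>(lborel :: real measure)) = 0" by simp
  qed
  finally have "N \<in> null_sets M" using Nm by (simp add: null_sets_def)
  moreover have "peval R x > 0"
    if R: "R \<in> SOS_le d" "restrict (lookup R) (expos d) \<notin> N" and x: "x \<in> K" for R x
  proof (rule ccontr)
    assume "\<not> ?thesis"
    moreover have RS: "peval R x \<ge> 0" for x using R(1) by (simp add: SOS_le_def SOS_nonneg)
    ultimately have R0: "peval R x = 0" by (simp add: antisym not_less)
    have PR: "P (restrict (lookup R) (expos d)) x = peval R x" for x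
    proof -
      have "peval R x = (\<Sum>\<alpha>\<in>expos d. lookup R \<alpha> * monom_eval \<alpha> x)"
        unfolding peval_pairing using R(1) by (intro pairing_superset finite_expos) (simp add: SOS_le_def polys_def)
      then show ?thesis by (simp add: P_def)
    qed
    have "restrict (lookup R) (expos d) \<in> space M"
      by (simp add: M_def space_PiM)
    moreover have "\<exists>z\<in>D. peval R z < 1 / (real n + 1)" for n :: nat
    proof -
      \<comment> \<open>The zero \<open>x\<close> has a neighbourhood on which \<open>R\<close> is
        small, and this neighbourhood meets \<open>D\<close>.\<close>
      have "open {z. peval R z < 1 / (real n + 1)}" by (intro open_Collect_less continuous_intros)
      moreover have "x \<in> {z. peval R z < 1 / (real n + 1)}" using R0 by simp
      moreover have "x \<in> closure D" using x D(3) by blast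
      ultimately have "{z. peval R z < 1 / (real n + 1)} \<inter> D \<noteq> {}"
        by (meson disjoint_iff open_Int_closure_eq_empty)
      then show ?thesis by blast
    qed
    ultimately have "restrict (lookup R) (expos d) \<in> N"
      using RS by (simp add: N_def PR)
    with R(2) show False by contradiction
  qed
  ultimately show ?thesis unfolding generic_in_SOS_le_def M_def by blast
qed

section \<open>Moment matrices and their ranks\<close>

lemma ceil_half_eq: "ceil_half n = (n + 1) div 2"
proof (cases "even n")
  case True
  then obtain k where "n = 2 * k" by (rule evenE)
  then show ?thesis by (simp add: ceil_half_def)
next
  case False
  then obtain k where n: "n = 2 * k + 1" by (rule oddE)
  have "\<lceil>real n / 2\<rceil> = int k + 1"
    by (rule ceiling_unique) (auto simp: n)
  then show ?thesis by (simp add: ceil_half_def n nat_add_distrib)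
qed

lemma is_loc_mat_loc_mat: "is_loc_mat q k y (loc_mat q k y)"
  unfolding loc_mat_def by (rule theI'[OF ex1_loc_mat])

lemma loc_mat_quad:
  "p \<in> polys (k - ceil_half (tdeg q)) \<Longrightarrow> pairing (q * p ^ 2) y =
    coeff_vec (k - ceil_half (tdeg q)) p \<bullet> (loc_mat q k y *\<^sub>v coeff_vec (k - ceil_half (tdeg q)) p)"
  using is_loc_mat_loc_mat[of q k y] unfolding is_loc_mat_def Let_def by blast

lemma loc_mat_carrier:
  fixes q :: "'n::{finite,linorder} mpoly"
  shows "loc_mat q k y \<in> carrier_mat (length (grlex (k - ceil_half (tdeg q)) :: 'n expo list))
    (length (grlex (k - ceil_half (tdeg q)) :: 'n expo list))"
    and "transpose_mat (loc_mat q k y) = loc_mat q k y"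
  using is_loc_mat_loc_mat[of q k y] unfolding is_loc_mat_def Let_def by blast+

text \<open>From here on matrix constraints are used only through the functional, since every vector
  is the coefficient vector of a polynomial.\<close>

lemma psd_loc_mat_iff:
  fixes q :: "'n::{finite,linorder} mpoly"
  shows "psd (loc_mat q k y) \<longleftrightarrow> (\<forall>p\<in>polys (k - ceil_half (tdeg q)). pairing (q * p ^ 2) y \<ge> 0)"
proof
  assume psd: "psd (loc_mat q k y)"
  show "\<forall>p\<in>polys (k - ceil_half (tdeg q)). pairing (q * p ^ 2) y \<ge> 0"
  proof
    fix p :: "'n mpoly" assume p: "p \<in> polys (k - ceil_half (tdeg q))"
    show "pairing (q * p ^ 2) y \<ge> 0"
      unfolding loc_mat_quad[OF p] using psd loc_mat_carrier(1)[of q k y] coeff_vec_simps(1)[of "k - ceil_half (tdeg q)" p]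
      unfolding psd_def by (metis carrier_matD(2))
  qed
next
  assume nn: "\<forall>p\<in>polys (k - ceil_half (tdeg q)). pairing (q * p ^ 2) y \<ge> 0"
  show "psd (loc_mat q k y)"
    unfolding psd_def
  proof (intro conjI ballI)
    show "dim_row (loc_mat q k y) = dim_col (loc_mat q k y)"
      using loc_mat_carrier(1)[of q k y] by auto
    show "transpose_mat (loc_mat q k y) = loc_mat q k y" by (rule loc_mat_carrier)
    fix v :: "real Matrix.vec" assume "v \<in> carrier_vec (dim_col (loc_mat q k y))"
    then have "v \<in> carrier_vec (length (grlex (k - ceil_half (tdeg q)) :: 'n expo list))"
      using loc_mat_carrier(1)[of q k y] by auto
    then obtain p :: "'n mpoly" where p: "p \<in> polys (k - ceil_half (tdeg q))" "coeff_vec (k - ceil_half (tdeg q)) p = v"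
      using coeff_vec_surj by blast
    show "0 \<le> v \<bullet> (loc_mat q k y *\<^sub>v v)"
      using loc_mat_quad[OF p(1), of y] nn p by auto
  qed
qed

text \<open>A symmetric matrix is determined by its quadratic form, so testing squares
  suffices.\<close>

lemma loc_mat_zero_iff:
  fixes q :: "'n::{finite,linorder} mpoly"
  shows "loc_mat q k y = 0\<^sub>m (dim_row (loc_mat q k y)) (dim_col (loc_mat q k y)) \<longleftrightarrow>
    (\<forall>p\<in>polys (k - ceil_half (tdeg q)). pairing (q * p ^ 2) y = 0)"
proof -
  define N where "N = length (grlex (k - ceil_half (tdeg q)) :: 'n expo list)"
  define L where "L = loc_mat q k y"
  have L: "L \<in> carrier_mat N N" "transpose_mat L = L"
    unfolding L_def N_def by (rule loc_mat_carrier)+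
  have zero: "v \<bullet> (0\<^sub>m N N *\<^sub>v v) = 0" if "v \<in> carrier_vec N" for v :: "real Matrix.vec"
    using that by (simp add: quad_form_expand[of _ N])
  have quad: "pairing (q * p ^ 2) y = coeff_vec (k - ceil_half (tdeg q)) p \<bullet> (L *\<^sub>v coeff_vec (k - ceil_half (tdeg q)) p)"
    "coeff_vec (k - ceil_half (tdeg q)) p \<in> carrier_vec N"
    if "p \<in> polys (k - ceil_half (tdeg q))" for p
    using loc_mat_quad[OF that] coeff_vec_simps(1) by (auto simp: L_def N_def)
  have "L = 0\<^sub>m N N \<longleftrightarrow> (\<forall>p\<in>polys (k - ceil_half (tdeg q)). pairing (q * p ^ 2) y = 0)"
  proof
    assume "L = 0\<^sub>m N N"
    then show "\<forall>p\<in>polys (k - ceil_half (tdeg q)). pairing (q * p ^ 2) y = 0"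
      using quad zero by simp
  next
    assume h: "\<forall>p\<in>polys (k - ceil_half (tdeg q)). pairing (q * p ^ 2) y = 0"
    show "L = 0\<^sub>m N N"
    proof (rule sym_quad_form_unique[OF L])
      fix v :: "real Matrix.vec" assume v: "v \<in> carrier_vec N"
      then obtain p :: "'n mpoly" where p: "p \<in> polys (k - ceil_half (tdeg q))" "coeff_vec (k - ceil_half (tdeg q)) p = v"
        using coeff_vec_surj unfolding N_def by blast
      then show "v \<bullet> (L *\<^sub>v v) = v \<bullet> (0\<^sub>m N N *\<^sub>v v)"
        using quad(1)[OF p(1)] h zero[OF v] by simp
    qed simp_all
  qed
  then show ?thesis using L(1) unfolding L_def by auto
qed

lemma tdeg_1: "tdeg (1 :: 'n::finite mpoly) = 0"
  using polys_1[of 0] by (simp add: mem_polys_iff del: polys_1)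

lemma psd_mom_mat_iff: "psd (mom_mat k y) \<longleftrightarrow> (\<forall>p\<in>polys k. pairing (p ^ 2) y \<ge> 0)"
  using psd_loc_mat_iff[of 1 k y] by (simp add: mom_mat_def tdeg_1 ceil_half_eq)

lemma pairing_Mon: "pairing (Mon \<alpha>) y = y \<alpha>"
  by (simp add: pairing_def)

lemma Mon_mult: "Mon \<alpha> * Mon \<beta> = Mon (\<alpha> + \<beta>)"
  by (simp add: mult_single)

lemma pairing_diff: "pairing (p - q) y = pairing p y - pairing q y"
  using pairing_add[of "p - q" q y] by simp

text \<open>Otherwise the pairing of \<open>(q + t p) ^ 2\<close> would be affine and nonconstant in
  \<open>t\<close>, hence negative somewhere.\<close>

lemma mom_mat_kernel:
  assumes psd: "psd (mom_mat k y)" and p: "p \<in> polys k" "pairing (p ^ 2) y = 0" and q: "q \<in> polys k"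
  shows "pairing (p * q) y = 0"
proof (rule ccontr)
  define b where "b = pairing (p * q) y"
  define c where "c = pairing (q ^ 2) y"
  assume "pairing (p * q) y \<noteq> 0"
  then have b: "b \<noteq> 0" by (simp add: b_def)
  have c: "c \<ge> 0" using psd q by (simp add: c_def psd_mom_mat_iff)
  have "0 \<le> pairing ((q + Const t * p) ^ 2) y" for t
    using psd p(1) q polys_mult_le[OF polys_Const[of t 0] p(1)] by (intro psd[unfolded psd_mom_mat_iff, rule_format] polys_add) auto
  also have "pairing ((q + Const t * p) ^ 2) y = c + 2 * t * b" for t
  proof -
    have "(q + Const t * p) ^ 2 = q ^ 2 + (Const (2 * t) * (p * q) + Const (t\<^sup>2) * p ^ 2)"
      by (simp add: Const_mult Const_numeral power2_eq_square algebra_simps)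
    then show ?thesis
      by (simp add: pairing_add pairing_Const_mult p(2) b_def c_def)
  qed
  finally have "0 \<le> c + 2 * t * b" for t .
  \<comment> \<open>The value of \<open>t\<close> at which the affine function equals -1.\<close>
  from this[of "- (c + 1) / (2 * b)"] have "0 \<le> c + 2 * (- (c + 1) / (2 * b)) * b" .
  moreover have "2 * (- (c + 1) / (2 * b)) * b = - (c + 1)" using b by (simp add: field_simps)
  ultimately show False by linarith
qed

text \<open>A zero diagonal entry kills its row. For \<open>\<alpha> = \<gamma> + e_i\<close> the
  diagonal entry at \<alpha> also stands in row \<gamma> and column \<open>\<alpha> + e_i\<close>,
  so zeros spread from \<open>y 0\<close>. That column exists only for
  \<open>mdeg \<alpha> < k\<close>, and the diagonal of degree \<open>2 * k\<close> is not
  reached.\<close>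

lemma moment_matrix_vanishes:
  fixes y :: "'n::{finite,linorder} expo \<Rightarrow> real"
  assumes psd: "psd (mom_mat k y)" and y0: "y 0 = 0"
    and \<alpha>: "mdeg \<alpha> < k" and \<beta>: "mdeg \<beta> \<le> k"
  shows "y (\<alpha> + \<beta>) = 0"
proof -
  have step: "y (\<gamma> + \<delta>) = 0" if "y (\<gamma> + \<gamma>) = 0" "mdeg \<gamma> \<le> k" "mdeg \<delta> \<le> k" for \<gamma> \<delta>
    using mom_mat_kernel[OF psd, of "Mon \<gamma>" "Mon \<delta>"] that
    by (simp add: power2_eq_square Mon_mult pairing_Mon)
  have "y (\<alpha> + \<alpha>) = 0" using \<alpha>
  proof (induction "mdeg \<alpha>" arbitrary: \<alpha> rule: less_induct)
    case less
    show ?case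
    proof (cases "\<alpha> = 0")
      case True
      then show ?thesis using y0 by simp
    next
      case False
      then obtain i where i: "lookup \<alpha> i \<noteq> 0" by (metis lookup_zero poly_mapping_eqI)
      define \<gamma> where "\<gamma> = \<alpha> - Poly_Mapping.single i 1"
      have \<alpha>: "\<alpha> = \<gamma> + Poly_Mapping.single i 1"
        using i by (intro poly_mapping_eqI) (auto simp: \<gamma>_def lookup_add lookup_minus lookup_single when_def)
      then have "mdeg \<gamma> < mdeg \<alpha>" by (simp add: mdeg_add)
      then have "y (\<gamma> + \<gamma>) = 0" using less by simp
      moreover have "mdeg \<gamma> \<le> k" using less.prems \<open>mdeg \<gamma> < mdeg \<alpha>\<close> by linarith
      moreover have "mdeg (\<alpha> + Poly_Mapping.single i 1) \<le> k"
        unfolding mdeg_add mdeg_single using less.prems by linarith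
      ultimately have "y (\<gamma> + (\<alpha> + Poly_Mapping.single i 1)) = 0"
        by (rule step)
      also have "\<gamma> + (\<alpha> + Poly_Mapping.single i 1) = \<alpha> + \<alpha>"
        by (subst (2) \<alpha>) (simp only: add_ac)
      finally show ?thesis .
    qed
  qed
  from step[OF this] show ?thesis using \<alpha> \<beta> by simp
qed

section \<open>Ranks of moment matrices\<close>

lemma mom_mat_carrier:
  fixes y :: "'n::{finite,linorder} expo \<Rightarrow> real"
  shows "mom_mat t y \<in> carrier_mat (length (grlex t :: 'n expo list)) (length (grlex t :: 'n expo list))"
  using loc_mat_carrier(1)[of 1 t y] by (simp add: mom_mat_def tdeg_1 ceil_half_eq)

lemma mom_mat_entry:
  fixes y :: "'n::{finite,linorder} expo \<Rightarrow> real"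
  assumes "i < length (grlex t :: 'n expo list)" "j < length (grlex t :: 'n expo list)"
  shows "mom_mat t y $$ (i, j) = y (grlex t ! i + grlex t ! j)"
  using assms unfolding mom_mat_def loc_mat_eq_entries
  by (simp add: tdeg_1 ceil_half_eq loc_mat_entries_def Let_def Mon_mult pairing_Mon)

lemma rank_le_sum_of_products:
  fixes A :: "real mat"
  assumes "finite S" "A \<in> carrier_mat n n"
    "\<And>i j. i < n \<Longrightarrow> j < n \<Longrightarrow> A $$ (i, j) = (\<Sum>u\<in>S. f u i * g u j)"
  shows "vec_space.rank n A \<le> card S"
  using assms
proof (induction S arbitrary: A)
  case empty
  then have "A = 0\<^sub>m n n" by (intro eq_matI) auto
  then show ?case by (simp add: vec_space.rank_0I)
next
  case (insert s S)
  define A1 where "A1 = Matrix.mat n n (\<lambda>(i, j). f s i * g s j)"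
  define A2 where "A2 = Matrix.mat n n (\<lambda>(i, j). \<Sum>u\<in>S. f u i * g u j)"
  have car: "A1 \<in> carrier_mat n n" "A2 \<in> carrier_mat n n" by (auto simp: A1_def A2_def)
  have "A = A1 + A2"
    using insert by (intro eq_matI) (auto simp: A1_def A2_def)
  then have "vec_space.rank n A \<le> vec_space.rank n A1 + vec_space.rank n A2"
    using vec_space.rank_subadditive[OF car] by simp
  also have "vec_space.rank n A1 \<le> 1"
    by (rule vec_space.rank_le_1_product_entries[OF car(1), of "f s" "g s"]) (auto simp: A1_def)
  also have "vec_space.rank n A2 \<le> card S"
    by (rule insert.IH[OF car(2)]) (simp add: A2_def)
  finally show ?case using insert.hyps by simp
qed

text \<open>Independent columns of \<open>A\<close> extend to columns of \<open>B\<close>; a linear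
  dependency of the extended columns would restrict to the first \<open>n\<close> rows.\<close>

lemma rank_leading_submatrix:
  fixes A B :: "real mat"
  assumes A: "A \<in> carrier_mat n n" and B: "B \<in> carrier_mat N N" and nN: "n \<le> N"
    and eq: "\<And>i j. i < n \<Longrightarrow> j < n \<Longrightarrow> A $$ (i, j) = B $$ (i, j)"
  shows "vec_space.rank n A \<le> vec_space.rank N B"
proof -
  interpret a: vec_space "TYPE(real)" n .
  interpret b: vec_space "TYPE(real)" N .
  have "a.lin_indpt {}" by (simp add: a.finite_lin_indpt2)
  then obtain U where U: "finite U" "maximal U (\<lambda>T. T \<subseteq> set (cols A) \<and> a.lin_indpt T)"
    using maximal_exists_superset[of "set (cols A)" "\<lambda>T. T \<subseteq> set (cols A) \<and> a.lin_indpt T" "{}"] by auto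
  then have Uc: "U \<subseteq> set (cols A)" and Ui: "a.lin_indpt U" by (auto simp: maximal_def)
  have rank: "a.rank A = card U" by (rule a.rank_card_indpt[OF A U(2)])
  obtain us where us: "distinct us" "set us = U" using U(1) finite_distinct_list by blast
  have "\<forall>x\<in>U. \<exists>j<n. x = col A j"
    using Uc A by (force simp: cols_def)
  then obtain J where J: "\<And>x. x \<in> U \<Longrightarrow> J x < n \<and> x = col A (J x)" by metis
  have Ucar: "U \<subseteq> carrier_vec n" using Uc cols_dim[of A] A by auto
  define ws where "ws = map (\<lambda>x. col B (J x)) us"
  define A' where "A' = mat_of_cols n us"
  define B' where "B' = mat_of_cols N ws"
  define r where "r = length us"
  have A': "A' \<in> carrier_mat n r" and B': "B' \<in> carrier_mat N r"
    by (auto simp: A'_def B'_def r_def ws_def)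
  have cA': "cols A' = us"
    unfolding A'_def using us Ucar by (intro cols_mat_of_cols) auto
  have cB': "cols B' = ws"
    unfolding B'_def ws_def using B by (intro cols_mat_of_cols) auto
  have idx: "vec_index (col B (J x)) i = vec_index x i" if "x \<in> U" "i < n" for x i
  proof -
    have "J x < n" "x = col A (J x)" using J[OF that(1)] by auto
    then have "vec_index x i = A $$ (i, J x)"
      using A that(2) by (metis carrier_matD index_col)
    also have "\<dots> = vec_index (col B (J x)) i"
      using eq[of i "J x"] \<open>J x < n\<close> that(2) nN B by simp
    finally show ?thesis ..
  qed
  have "inj_on (\<lambda>x. col B (J x)) U"
  proof (rule inj_onI)
    fix x y assume xy: "x \<in> U" "y \<in> U" "col B (J x) = col B (J y)"
    show "x = y"
    proof (rule eq_vecI)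
      have dims: "dim_vec x = n" "dim_vec y = n"
        using subsetD[OF Ucar xy(1)] subsetD[OF Ucar xy(2)] by auto
      then show "dim_vec x = dim_vec y" by simp
      fix i assume "i < dim_vec y"
      then have "i < n" using dims by simp
      then show "vec_index x i = vec_index y i"
        using idx[OF xy(1)] idx[OF xy(2)] xy(3) by metis
    qed
  qed
  then have dw: "distinct ws" using us by (simp add: ws_def distinct_map)
  have "b.lin_indpt (set ws)"
  proof
    assume dep: "b.lin_dep (set ws)"
    then obtain v where v: "v \<in> carrier_vec r" "v \<noteq> 0\<^sub>v r" "B' *\<^sub>v v = 0\<^sub>v N"
      using b.lin_depE[OF B'] cB' dw by metis
    have "A' *\<^sub>v v = 0\<^sub>v n"
    proof (rule eq_vecI)
      fix i assume "i < dim_vec (0\<^sub>v n :: real Matrix.vec)"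
      then have i: "i < n" by simp
      have "row A' i = row B' i"
      proof (rule eq_vecI)
        show "dim_vec (row A' i) = dim_vec (row B' i)" using A' B' by simp
        fix j assume "j < dim_vec (row B' i)"
        then have j: "j < r" using B' by simp
        then have "us ! j \<in> U" using us by (auto simp: r_def)
        then show "vec_index (row A' i) j = vec_index (row B' i) j"
          using i j nN idx by (simp add: A'_def B'_def r_def ws_def mat_of_cols_index)
      qed
      then have "vec_index (A' *\<^sub>v v) i = vec_index (B' *\<^sub>v v) i"
        using i nN A' B' by simp
      then show "vec_index (A' *\<^sub>v v) i = vec_index (0\<^sub>v n) i"
        using i nN by (simp add: v(3))
    qed (use A' in simp)
    then have "a.lin_dep (set (cols A'))"
      using a.lin_depI[OF A' v(1,2)] cA' us by simp
    with Ui show False by (simp add: cA' us)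
  qed
  moreover have "set ws \<subseteq> set (cols B)"
  proof
    fix x assume "x \<in> set ws"
    then obtain z where "z \<in> U" "x = col B (J z)" using us by (auto simp: ws_def)
    then show "x \<in> set (cols B)" using J[of z] nN B by (auto simp: cols_def)
  qed
  ultimately have "card (set ws) \<le> b.rank B" by (intro b.rank_ge_card_indpt[OF B])
  moreover have "card (set ws) = card U"
    using dw us by (metis distinct_card length_map ws_def)
  ultimately show ?thesis by (simp add: rank)
qed

text \<open>Listing monomials by degree makes moment matrices of lower order leading
  submatrices.\<close>

lemma grlex_prefix: "s \<le> t \<Longrightarrow> \<exists>xs. (grlex t :: 'n::{finite,linorder} expo list) = grlex s @ xs"
proof -
  assume "s \<le> t"
  then have "[0..<Suc t] = [0..<Suc s] @ [Suc s..<Suc t]"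
    using upt_add_eq_append[of 0 "Suc s" "t - s"] by simp
  then show ?thesis unfolding grlex_def by simp
qed

lemma mat_rank_mom_mat:
  fixes y :: "'n::{finite,linorder} expo \<Rightarrow> real"
  shows "mat_rank (mom_mat t y) = vec_space.rank (length (grlex t :: 'n expo list)) (mom_mat t y)"
  unfolding mat_rank_def using mom_mat_carrier[of t y] by simp

lemma mat_rank_mom_mat_mono:
  fixes y :: "'n::{finite,linorder} expo \<Rightarrow> real"
  assumes "s \<le> t"
  shows "mat_rank (mom_mat s y) \<le> mat_rank (mom_mat t y)"
proof -
  obtain xs where xs: "(grlex t :: 'n expo list) = grlex s @ xs" using grlex_prefix[OF assms] by blast
  show ?thesis unfolding mat_rank_mom_mat
  proof (rule rank_leading_submatrix[OF mom_mat_carrier mom_mat_carrier])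
    show "length (grlex s :: 'n expo list) \<le> length (grlex t :: 'n expo list)" by (simp add: xs)
    fix i j assume "i < length (grlex s :: 'n expo list)" "j < length (grlex s :: 'n expo list)"
    then show "mom_mat s y $$ (i, j) = mom_mat t y $$ (i, j)"
      by (simp add: mom_mat_entry xs nth_append)
  qed
qed

lemma mat_rank_mom_mat_le:
  fixes y :: "'n::{finite,linorder} expo \<Rightarrow> real"
  assumes "finite S" "\<And>\<alpha> \<beta>. \<alpha> \<in> expos t \<Longrightarrow> \<beta> \<in> expos t \<Longrightarrow> y (\<alpha> + \<beta>) = (\<Sum>u\<in>S. f u \<alpha> * g u \<beta>)"
  shows "mat_rank (mom_mat t y) \<le> card S"
  unfolding mat_rank_mom_mat
proof (rule rank_le_sum_of_products[OF assms(1) mom_mat_carrier])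
  fix i j assume ij: "i < length (grlex t :: 'n expo list)" "j < length (grlex t :: 'n expo list)"
  then have "(grlex t ! i :: 'n expo) \<in> expos t" "(grlex t ! j :: 'n expo) \<in> expos t"
    by (auto simp flip: set_grlex)
  then show "mom_mat t y $$ (i, j) = (\<Sum>u\<in>S. f u (grlex t ! i) * g u (grlex t ! j))"
    using ij by (simp add: mom_mat_entry assms(2))
qed

text \<open>All entries of the moment matrix of order \<open>k - 1\<close> vanish, so both ranks in
  the flatness condition are 0 there. Order \<open>k\<close> itself is unsuitable, since diagonal
  entries of degree \<open>2 * k\<close> may be nonzero; hence \<open>d_K < k\<close>.\<close>

lemma flat_truncation_zero_moment:
  fixes w :: "'n::{finite,linorder} expo \<Rightarrow> real"
  assumes "psd (mom_mat k w)" "w 0 = 0" "d_K c E I < k"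
  shows "flat_truncation c E I k w"
proof -
  have "mat_rank (mom_mat t w) \<le> card ({} :: nat set)" if "t < k" for t
  proof (rule mat_rank_mom_mat_le)
    fix \<alpha> \<beta> :: "'n expo" assume "\<alpha> \<in> expos t" "\<beta> \<in> expos t"
    then show "w (\<alpha> + \<beta>) = (\<Sum>u\<in>{}. 0 * 0)"
      using moment_matrix_vanishes[OF assms(1,2), of \<alpha> \<beta>] that by (simp add: expos_def)
  qed simp
  from this[of "k - 1"] this[of "k - 1 - d_K c E I"] assms(3) show ?thesis
    unfolding flat_truncation_def by (intro exI[of _ "k - 1"]) auto
qed

text \<open>The ranks of the moment matrices of orders \<open>0, d_K, 2 d_K, \<dots>\<close> increase weakly and are
  bounded by the number of atoms, so two consecutive ones agree.\<close>

lemma flat_truncation_of_low_rank: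
  fixes w :: "'n::{finite,linorder} expo \<Rightarrow> real"
  assumes k: "(n + 1) * d_K c E I \<le> k"
    and rank: "mat_rank (mom_mat ((n + 1) * d_K c E I) w) \<le> n"
  shows "flat_truncation c E I k w"
proof (rule ccontr)
  assume nf: "\<not> flat_truncation c E I k w"
  define D where "D = d_K c E I"
  define r where "r i = mat_rank (mom_mat (i * D) w)" for i
  have "r i < r (Suc i)" if "i \<le> n" for i
  proof -
    have "Suc i * D \<le> k"
      using order_trans[OF mult_le_mono1 k[folded D_def], of "Suc i"] that by simp
    then have "r i \<noteq> r (Suc i)"
      using nf unfolding flat_truncation_def r_def D_def[symmetric] by (auto dest!: spec[of _ "Suc i * D"])
    moreover have "r i \<le> r (Suc i)" unfolding r_def by (intro mat_rank_mom_mat_mono) simp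
    ultimately show ?thesis by simp
  qed
  note less = this
  \<comment> \<open>Strict growth at each of the \<open>n + 1\<close> steps would bring the last
    rank to at least \<open>n + 1\<close>, above the bound.\<close>
  have "i \<le> n + 1 \<Longrightarrow> i \<le> r i" for i
  proof (induction i)
    case (Suc i)
    then have "i \<le> r i" "r i < r (Suc i)" using less[of i] by simp_all
    then show ?case by simp
  qed simp
  from this[of "n + 1"] rank show False by (simp add: r_def D_def)
qed

section \<open>The hierarchy\<close>

lemma eventually_mem_polys: "\<forall>\<^sub>F k in sequentially. p \<in> polys k"
  by (simp add: mem_polys_iff eventually_ge_at_top)

lemma eventually_mem_polys_diff: "\<forall>\<^sub>F k in sequentially. p \<in> polys (k - d)"
proof -
  have "\<forall>\<^sub>F k in sequentially. tdeg p + d \<le> k" by (rule eventually_ge_at_top)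
  then show ?thesis by eventually_elim (simp add: mem_polys_iff)
qed

lemma feas_Pk_psd: "w \<in> feas_Pk m a b c E I k \<Longrightarrow> psd (mom_mat k w)"
  by (simp add: feas_Pk_def)

text \<open>A fixed certificate can be tested on every feasible \<open>w\<close> as soon as its
  multipliers fit into the localizing matrices, so the threshold does not depend on
  \<open>w\<close>.\<close>

lemma constraint_qm_eventually_nonneg:
  fixes c :: "'l \<Rightarrow> 'n::{finite,linorder} mpoly"
  assumes fin: "finite E" "finite I" and g: "g \<in> constraint_qm c E I"
  shows "\<forall>\<^sub>F k in sequentially. \<forall>w\<in>feas_Pk m a b c E I k. pairing g w \<ge> 0"
proof -
  define ev where "ev g \<longleftrightarrow> (\<forall>\<^sub>F k in sequentially. \<forall>w\<in>feas_Pk m a b c E I k. pairing g w \<ge> 0)" for g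
  have add: "ev (g + h)" if "ev g" "ev h" for g h
    using that unfolding ev_def
    by eventually_elim (simp add: pairing_add add_nonneg_nonneg)
  have zero: "ev 0" by (simp add: ev_def pairing_def)
  have sum: "ev (\<Sum>i\<in>A. f i)" if "\<And>i. i \<in> A \<Longrightarrow> ev (f i)" for f and A :: "'l set"
    using that by (induction A rule: infinite_finite_induct) (auto intro: add zero)
  \<comment> \<open>Localizing matrices test squares only; an arbitrary multiplier is a difference
    of two by \<open>4 p = (p + 1)^2 - (p - 1)^2\<close>.\<close>
  have eq: "ev (c i * p)" if i: "i \<in> E" for i p
    unfolding ev_def
    using eventually_mem_polys_diff[of "p + 1" "ceil_half (tdeg (c i))"]
      eventually_mem_polys_diff[of "p - 1" "ceil_half (tdeg (c i))"]
  proof eventually_elim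
    case (elim k)
    show ?case
    proof
      fix w assume "w \<in> feas_Pk m a b c E I k"
      then have "loc_mat (c i) k w = 0\<^sub>m (dim_row (loc_mat (c i) k w)) (dim_col (loc_mat (c i) k w))"
        using i by (auto simp: feas_Pk_def)
      then have 0: "pairing (c i * (p + 1) ^ 2) w = 0" "pairing (c i * (p - 1) ^ 2) w = 0"
        using elim unfolding loc_mat_zero_iff by blast+
      have "c i * (p + 1) ^ 2 - c i * (p - 1) ^ 2 = Const 4 * (c i * p)"
        by (simp add: Const_numeral power2_eq_square algebra_simps)
      then have "4 * pairing (c i * p) w = 0"
        using 0 by (metis pairing_diff pairing_Const_mult diff_zero)
      then show "pairing (c i * p) w \<ge> 0" by simp
    qed
  qed
  have sq: "ev (q ^ 2)" for q
    unfolding ev_def using eventually_mem_polys[of q]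
    by eventually_elim (auto simp: feas_Pk_def psd_mom_mat_iff)
  have ineq: "ev (c j * q ^ 2)" if "j \<in> I" for j q
    unfolding ev_def using eventually_mem_polys_diff[of q "ceil_half (tdeg (c j))"]
    by eventually_elim (use that in \<open>auto simp: feas_Pk_def psd_loc_mat_iff\<close>)
  have sos: "ev s" if "s \<in> SOS" for s
    using that by (induction rule: SOS_induct) (auto intro: zero add sq)
  have sosj: "ev (c j * s)" if j: "j \<in> I" and s: "s \<in> SOS" for j s
    using s by (induction rule: SOS_induct) (auto simp: distrib_left intro: zero add ineq j)
  obtain p s0 s where "g = (\<Sum>i\<in>E. c i * p i) + (s0 + (\<Sum>j\<in>I. c j * s j))" "s0 \<in> SOS" "\<forall>j\<in>I. s j \<in> SOS"
    using g by (elim constraint_qmE)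
  then have "ev g" by (simp, intro add sum eq sos sosj) auto
  then show ?thesis by (simp add: ev_def)
qed

lemma constraint_qm_eventually_truncated:
  fixes c :: "'l \<Rightarrow> 'n::finite mpoly"
  assumes fin: "finite E" "finite I" and g: "g \<in> constraint_qm c E I"
  shows "\<forall>\<^sub>F k in sequentially. g \<in> {p + q | p q. p \<in> Ideal_le c E (2 * k) \<and> q \<in> QM_le c I (2 * k)}"
proof -
  obtain p s0 s where g: "g = (\<Sum>i\<in>E. c i * p i) + (s0 + (\<Sum>j\<in>I. c j * s j))" "s0 \<in> SOS" "\<forall>j\<in>I. s j \<in> SOS"
    using g by (elim constraint_qmE)
  have "\<forall>\<^sub>F k in sequentially. \<forall>i\<in>E. tdeg (c i) + tdeg (p i) \<le> k"
    by (intro eventually_ball_finite fin ballI eventually_ge_at_top)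
  moreover have "\<forall>\<^sub>F k in sequentially. \<forall>j\<in>I. tdeg (c j) + tdeg (s j) \<le> k"
    by (intro eventually_ball_finite fin ballI eventually_ge_at_top)
  ultimately show ?thesis
    using eventually_mem_polys[of s0]
  proof eventually_elim
    case (elim k)
    have 1: "\<forall>i\<in>E. p i = 0 \<or> tdeg (c i) + tdeg (p i) \<le> 2 * k" using elim(1) by fastforce
    have 2: "\<forall>j\<in>I. s j \<in> SOS \<and> (s j = 0 \<or> tdeg (c j) + tdeg (s j) \<le> 2 * k)" using elim(2) g(3) by fastforce
    have "s0 \<in> SOS_le (2 * k)"
      using g(2) elim(3) polys_mono[of s0 k "2 * k"] by (simp add: SOS_le_def)
    then have "s0 + (\<Sum>j\<in>I. c j * s j) \<in> QM_le c I (2 * k)"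
      unfolding QM_le_def using 2 by blast
    moreover have "(\<Sum>i\<in>E. c i * p i) \<in> Ideal_le c E (2 * k)"
      unfolding Ideal_le_def using 1 by blast
    ultimately show ?case unfolding g(1) by blast
  qed
qed

text \<open>Soundness of the truncation, used to bound \<open>psi\<close> from above.\<close>

lemma truncated_in_constraint_qm:
  assumes "g \<in> {p + q | p q. p \<in> Ideal_le c E k \<and> q \<in> QM_le c I k}"
  shows "g \<in> constraint_qm c E I"
  using assms unfolding constraint_qm_def Ideal_le_def QM_le_def Ideal_def QM_def SOS_le_def by blast

lemma pairing_0 [simp]: "pairing 0 y = 0"
  by (simp add: pairing_def)

text \<open>Modulo the generators every \<open>p\<close> equals the sum of the
  \<open>p(u) * l u\<close>, and the generators lie in the kernel of the moment matrix. For
  monomials this gives one product per point of \<open>S\<close>, so the moment matrix of order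
  \<open>t\<close> has rank at most \<open>card S\<close>. The threshold depends on \<open>t\<close>
  but not on \<open>w\<close>.\<close>

lemma atomic_moments_of_kernel:
  fixes S :: "(real ^ 'n::{finite,linorder}) set"
  assumes S: "finite S" and \<rho>: "1 - (\<Sum>u\<in>S. l u) = T * \<rho>"
  shows "\<forall>\<^sub>F k in sequentially. \<forall>w. psd (mom_mat k w) \<and> pairing (point_gens S T l) w \<le> 0 \<longrightarrow>
    (\<forall>\<alpha>\<in>expos t. \<forall>\<beta>\<in>expos t. w (\<alpha> + \<beta>) = (\<Sum>u\<in>S. monom_eval \<alpha> u * pairing (l u * Mon \<beta>) w))"
proof -
  define ker where "ker q \<longleftrightarrow> (\<forall>\<^sub>F k in sequentially. \<forall>w. psd (mom_mat k w) \<and> pairing (point_gens S T l) w \<le> 0 \<longrightarrow> pairing q w = 0)" for q :: "'n mpoly"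
  define G where "G u a = l u * coord u a" for u a
  have T2: "\<forall>\<^sub>F k in sequentially. \<forall>w. psd (mom_mat k w) \<and> pairing (point_gens S T l) w \<le> 0 \<longrightarrow>
      pairing (T ^ 2) w = 0 \<and> (\<forall>u\<in>S. \<forall>a\<in>UNIV. pairing (G u a ^ 2) w = 0)"
  proof -
    have "\<forall>\<^sub>F k in sequentially. \<forall>u\<in>S. \<forall>a\<in>UNIV. G u a \<in> polys k"
      by (intro eventually_ball_finite S finite ballI eventually_mem_polys)
    then show ?thesis using eventually_mem_polys[of T]
    proof eventually_elim
      case (elim k)
      show ?case
      proof (intro allI impI, elim conjE)
        fix w assume psd: "psd (mom_mat k w)" and le: "pairing (point_gens S T l) w \<le> 0"
        have nnT: "pairing (T ^ 2) w \<ge> 0" using psd elim(2) by (simp add: psd_mom_mat_iff)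
        have nnG: "pairing (G u a ^ 2) w \<ge> 0" if "u \<in> S" for u a
          using psd elim(1) that by (simp add: psd_mom_mat_iff)
        \<comment> \<open>All squares in \<open>Q\<close> pair nonnegatively with \<open>w\<close>,
          so a nonpositive total forces each of them to be 0.\<close>
        have "pairing (point_gens S T l) w = pairing (T ^ 2) w + (\<Sum>u\<in>S. \<Sum>a\<in>UNIV. pairing (G u a ^ 2) w)"
          by (simp add: point_gens_def pairing_add pairing_sum G_def)
        moreover have "(\<Sum>u\<in>S. \<Sum>a\<in>UNIV. pairing (G u a ^ 2) w) \<ge> 0"
          by (intro sum_nonneg nnG)
        ultimately have "pairing (T ^ 2) w = 0" "(\<Sum>u\<in>S. \<Sum>a\<in>UNIV. pairing (G u a ^ 2) w) = 0"
          using nnT le by linarith+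
        moreover from this(2) have "pairing (G u a ^ 2) w = 0" if "u \<in> S" for u a
        proof -
          have "\<forall>u\<in>S. (\<Sum>a\<in>UNIV. pairing (G u a ^ 2) w) = 0"
            using \<open>(\<Sum>u\<in>S. \<Sum>a\<in>UNIV. pairing (G u a ^ 2) w) = 0\<close> S nnG
            by (subst (asm) sum_nonneg_eq_0_iff) (auto intro: sum_nonneg)
          then have "(\<Sum>a\<in>UNIV. pairing (G u a ^ 2) w) = 0" using that by blast
          then show ?thesis using nnG[OF that]
            by (subst (asm) sum_nonneg_eq_0_iff) auto
        qed
        ultimately show "pairing (T ^ 2) w = 0 \<and> (\<forall>u\<in>S. \<forall>a\<in>UNIV. pairing (G u a ^ 2) w = 0)" by blast
      qed
    qed
  qed
  have kerT: "ker (T * q)" for q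
    unfolding ker_def using T2 eventually_mem_polys[of T] eventually_mem_polys[of q]
    by eventually_elim (auto intro: mom_mat_kernel)
  have kerG: "ker (G u a * q)" if "u \<in> S" for u a q
    unfolding ker_def using T2 eventually_mem_polys[of "G u a"] eventually_mem_polys[of q]
    by eventually_elim (use that in \<open>auto intro: mom_mat_kernel\<close>)
  have ker0: "ker 0" by (simp add: ker_def)
  have kadd: "ker (p + q)" if "ker p" "ker q" for p q
    using that unfolding ker_def by eventually_elim (simp add: pairing_add)
  have ksum1: "ker (\<Sum>i\<in>A. f i)" if "\<And>i. i \<in> A \<Longrightarrow> ker (f i)" for f and A :: "(real ^ 'n::{finite,linorder}) set"
    using that by (induction A rule: infinite_finite_induct) (auto intro: kadd ker0)
  have ksum2: "ker (\<Sum>i\<in>A. f i)" if "\<And>i. i \<in> A \<Longrightarrow> ker (f i)" for f and A :: "'n set"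
    using that by (induction A rule: infinite_finite_induct) (auto intro: kadd ker0)
  have kerp: "ker ((p - (\<Sum>u\<in>S. Const (peval p u) * l u)) * q)" for p q
  proof -
    \<comment> \<open>By Hadamard at \<open>u\<close>, \<open>l u * p\<close> agrees with
      \<open>p(u) * l u\<close> up to multiples of the \<open>G u a\<close>; the defect of the sum
      of the \<open>l u\<close> from 1 is a multiple of \<open>T\<close>.\<close>
    have "\<forall>u. \<exists>g. p = Const (peval p u) + (\<Sum>a\<in>UNIV. coord u a * g a)" using Hadamard by blast
    then obtain g where g: "\<And>u. p = Const (peval p u) + (\<Sum>a\<in>UNIV. coord u a * g u a)" by metis
    have "l u * p - Const (peval p u) * l u = (\<Sum>a\<in>UNIV. G u a * g u a)" for u
    proof -
      have "l u * p = l u * (Const (peval p u) + (\<Sum>a\<in>UNIV. coord u a * g u a))"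
        by (rule arg_cong[OF g])
      then show ?thesis by (simp add: G_def distrib_left sum_distrib_left mult_ac)
    qed
    then have 1: "(\<Sum>u\<in>S. l u * p) - (\<Sum>u\<in>S. Const (peval p u) * l u) = (\<Sum>u\<in>S. \<Sum>a\<in>UNIV. G u a * g u a)"
      unfolding sum_subtractf[symmetric] by (intro sum.cong refl)
    have "p = T * \<rho> * p + (\<Sum>u\<in>S. l u * p)"
      unfolding \<rho>[symmetric] by (simp add: left_diff_distrib sum_distrib_right)
    then have "p - (\<Sum>u\<in>S. Const (peval p u) * l u) =
        (T * \<rho> * p + (\<Sum>u\<in>S. l u * p)) - (\<Sum>u\<in>S. Const (peval p u) * l u)"
      by (rule arg_cong)
    also have "\<dots> = T * \<rho> * p + (\<Sum>u\<in>S. \<Sum>a\<in>UNIV. G u a * g u a)"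
      unfolding 1[symmetric] by (rule add_diff_eq[symmetric])
    finally have "p - (\<Sum>u\<in>S. Const (peval p u) * l u) = T * \<rho> * p + (\<Sum>u\<in>S. \<Sum>a\<in>UNIV. G u a * g u a)" .
    then have "(p - (\<Sum>u\<in>S. Const (peval p u) * l u)) * q =
        T * (\<rho> * p * q) + (\<Sum>u\<in>S. \<Sum>a\<in>UNIV. G u a * (g u a * q))"
      by (simp add: distrib_right sum_distrib_right mult.assoc)
    then show ?thesis by (simp only:) (intro kadd ksum1 ksum2 kerT kerG)
  qed
  have "\<forall>\<^sub>F k in sequentially. \<forall>\<alpha>\<in>expos t. \<forall>\<beta>\<in>expos t. \<forall>w. psd (mom_mat k w) \<and> pairing (point_gens S T l) w \<le> 0 \<longrightarrow>
      pairing ((Mon \<alpha> - (\<Sum>u\<in>S. Const (peval (Mon \<alpha>) u) * l u)) * Mon \<beta>) w = 0"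
    by (intro eventually_ball_finite finite_expos ballI) (rule kerp[unfolded ker_def])
  then show ?thesis
  proof eventually_elim
    case (elim k)
    show ?case
    proof (intro allI impI ballI)
      fix w and \<alpha> \<beta> :: "'n expo"
      assume "psd (mom_mat k w) \<and> pairing (point_gens S T l) w \<le> 0" "\<alpha> \<in> expos t" "\<beta> \<in> expos t"
      with elim have "pairing ((Mon \<alpha> - (\<Sum>u\<in>S. Const (peval (Mon \<alpha>) u) * l u)) * Mon \<beta>) w = 0" by blast
      then show "w (\<alpha> + \<beta>) = (\<Sum>u\<in>S. monom_eval \<alpha> u * pairing (l u * Mon \<beta>) w)"
        by (simp add: left_diff_distrib sum_distrib_right mult.assoc pairing_diff pairing_sum pairing_Const_mult
          Mon_mult pairing_Mon peval_single)
    qed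
  qed
qed

section \<open>Atomic measures as feasible points\<close>

lemma pairing_atomic:
  assumes "p \<in> polys d"
  shows "pairing p (restrict (\<lambda>\<alpha>. \<Sum>u\<in>S. c u * monom_eval \<alpha> u) (expos d)) = (\<Sum>u\<in>S. c u * peval p u)"
proof -
  have "pairing p (restrict (\<lambda>\<alpha>. \<Sum>u\<in>S. c u * monom_eval \<alpha> u) (expos d)) =
      (\<Sum>\<alpha>\<in>keys p. \<Sum>u\<in>S. c u * (lookup p \<alpha> * monom_eval \<alpha> u))"
    unfolding pairing_def using assms
    by (intro sum.cong refl) (auto simp: polys_def sum_distrib_left mult_ac)
  also have "\<dots> = (\<Sum>u\<in>S. \<Sum>\<alpha>\<in>keys p. c u * (lookup p \<alpha> * monom_eval \<alpha> u))"
    by (rule sum.swap)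
  finally show ?thesis by (simp add: peval_def sum_distrib_left)
qed

lemma atomic_in_moment_cone:
  fixes S :: "(real ^ 'n::finite) set"
  assumes S: "finite S" "S \<subseteq> K" and c: "\<And>u. u \<in> S \<Longrightarrow> c u \<ge> 0" and K: "closed K"
  shows "restrict (\<lambda>\<alpha>. \<Sum>u\<in>S. c u * monom_eval \<alpha> u) (expos d) \<in> moment_cone d K"
proof -
  \<comment> \<open>The image under the identity moves the point measure from the power set of
    \<open>S\<close> to the Borel sets.\<close>
  define \<mu> where "\<mu> = distr (point_measure S (\<lambda>u. ennreal (c u))) borel (\<lambda>x :: real ^ 'n. x)"
  have idm: "(\<lambda>x. x) \<in> measurable (point_measure S (\<lambda>u. ennreal (c u))) borel"
    by (simp add: point_measure_def)
  have cont: "monom_eval \<alpha> \<in> borel_measurable borel" for \<alpha> :: "'n expo"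
    unfolding monom_eval_def[abs_def] by (intro borel_measurable_continuous_onI continuous_intros)
  have "AE x in \<mu>. x \<in> K"
    unfolding \<mu>_def using S K by (subst AE_distr_iff[OF idm]) (auto simp: AE_point_measure)
  moreover have "integrable \<mu> (monom_eval \<alpha>)" for \<alpha> :: "'n expo"
    unfolding \<mu>_def using S c
    by (subst integrable_distr_eq[OF idm cont]) (auto intro: integrable_point_measure_finite)
  moreover have "(LINT x|\<mu>. monom_eval \<alpha> x) = (\<Sum>u\<in>S. c u * monom_eval \<alpha> u)" for \<alpha> :: "'n expo"
    unfolding \<mu>_def using S c
    by (subst integral_distr[OF idm cont]) (simp add: lebesgue_integral_point_measure_finite)
  ultimately show ?thesis
    unfolding moment_cone_def tms_def by (intro CollectI conjI exI[of _ \<mu>]) (auto simp: \<mu>_def)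
qed

text \<open>Integration of a nonnegative function; this is weak duality between (P) and (D).\<close>

lemma moment_cone_nonneg:
  assumes y: "y \<in> moment_cone d K" and f: "f \<in> nonneg_polys d K"
  shows "pairing f y \<ge> 0"
proof -
  obtain \<mu> where \<mu>: "AE x in \<mu>. x \<in> K"
    "\<And>\<alpha>. \<alpha> \<in> expos d \<Longrightarrow> integrable \<mu> (monom_eval \<alpha>)"
    "\<And>\<alpha>. \<alpha> \<in> expos d \<Longrightarrow> y \<alpha> = (LINT x|\<mu>. monom_eval \<alpha> x)"
    using y unfolding moment_cone_def by blast
  have k: "\<alpha> \<in> expos d" if "\<alpha> \<in> keys f" for \<alpha> using f that by (auto simp: nonneg_polys_def polys_def)
  have "pairing f y = (\<Sum>\<alpha>\<in>keys f. (LINT x|\<mu>. lookup f \<alpha> * monom_eval \<alpha> x))"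
    unfolding pairing_def using \<mu>(3) k by (intro sum.cong refl) simp
  also have "\<dots> = (LINT x|\<mu>. (\<Sum>\<alpha>\<in>keys f. lookup f \<alpha> * monom_eval \<alpha> x))"
    using \<mu>(2) k by (intro Bochner_Integration.integral_sum[symmetric]) simp
  also have "\<dots> = (LINT x|\<mu>. peval f x)" by (simp add: peval_def)
  also have "\<dots> \<ge> 0"
    using \<mu>(1) f by (intro integral_nonneg_AE) (auto simp: nonneg_polys_def)
  finally show ?thesis .
qed

lemma atomic_in_feas_Pk:
  fixes S :: "(real ^ 'n::{finite,linorder}) set"
  assumes S: "S \<subseteq> semialg c E I" and wt: "\<And>u. u \<in> S \<Longrightarrow> wt u \<ge> 0"
    and k: "\<And>i. i \<in> E \<union> I \<Longrightarrow> tdeg (c i) \<le> 2 * k"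
    and a: "\<And>i. i \<in> {1..m} \<Longrightarrow> a i \<in> polys (2 * k)"
    and b: "\<And>i. i \<in> {1..m} \<Longrightarrow> b i = (\<Sum>u\<in>S. wt u * peval (a i) u)"
  shows "restrict (\<lambda>\<alpha>. \<Sum>u\<in>S. wt u * monom_eval \<alpha> u) (expos (2 * k)) \<in> feas_Pk m a b c E I k"
proof -
  define w where "w = restrict (\<lambda>\<alpha>. \<Sum>u\<in>S. wt u * monom_eval \<alpha> u) (expos (2 * k))"
  have pw: "pairing p w = (\<Sum>u\<in>S. wt u * peval p u)" if "p \<in> polys (2 * k)" for p
    unfolding w_def by (rule pairing_atomic[OF that])
  \<comment> \<open>\<open>tdeg q \<le> 2 * k\<close> ensures that the difference
    \<open>k - ceil_half (tdeg q)\<close> is not cut off at 0, so the product stays within degree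
    \<open>2 * k\<close>.\<close>
  have deg: "q * p ^ 2 \<in> polys (2 * k)" if "tdeg q \<le> 2 * k" "p \<in> polys (k - ceil_half (tdeg q))" for p q
    using that(1) by (intro polys_mult_le[OF polys_tdeg polys_power2_le[OF that(2) order_refl]])
      (auto simp: ceil_half_eq)
  show ?thesis
    unfolding feas_Pk_def w_def[symmetric]
  proof (intro CollectI conjI ballI)
    show "w \<in> tms (2 * k)" by (simp add: w_def tms_def)
    show "pairing (a i) w = b i" if "i \<in> {1..m}" for i
      using pw[OF a[OF that]] b[OF that] by simp
    show "loc_mat (c i) k w = 0\<^sub>m (dim_row (loc_mat (c i) k w)) (dim_col (loc_mat (c i) k w))" if i: "i \<in> E" for i
      unfolding loc_mat_zero_iff
    proof
      fix p :: "'n mpoly" assume "p \<in> polys (k - ceil_half (tdeg (c i)))"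
      then have "pairing (c i * p ^ 2) w = (\<Sum>u\<in>S. wt u * peval (c i * p ^ 2) u)"
        using i k by (intro pw deg) auto
      also have "\<dots> = 0" using S i by (intro sum.neutral) (auto simp: semialg_def)
      finally show "pairing (c i * p ^ 2) w = 0" .
    qed
    show "psd (loc_mat (c j) k w)" if j: "j \<in> I" for j
      unfolding psd_loc_mat_iff
    proof
      fix p :: "'n mpoly" assume "p \<in> polys (k - ceil_half (tdeg (c j)))"
      then have "pairing (c j * p ^ 2) w = (\<Sum>u\<in>S. wt u * peval (c j * p ^ 2) u)"
        using j k by (intro pw deg) auto
      also have "\<dots> \<ge> 0" using S j wt by (intro sum_nonneg mult_nonneg_nonneg) (auto simp: semialg_def)
      finally show "pairing (c j * p ^ 2) w \<ge> 0" .
    qed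
    show "psd (mom_mat k w)"
      unfolding psd_mom_mat_iff
    proof
      fix p :: "'n mpoly" assume "p \<in> polys k"
      then have "pairing (p ^ 2) w = (\<Sum>u\<in>S. wt u * peval (p ^ 2) u)"
        by (intro pw polys_power2_le[of _ k]) auto
      also have "\<dots> \<ge> 0" using wt by (intro sum_nonneg mult_nonneg_nonneg) auto
      finally show "pairing (p ^ 2) w \<ge> 0" .
    qed
  qed
qed

lemma generic_in_SOS_le_mono:
  assumes "generic_in_SOS_le d P" "\<And>R. R \<in> SOS_le d \<Longrightarrow> P R \<Longrightarrow> Q R"
  shows "generic_in_SOS_le d Q"
  using assms unfolding generic_in_SOS_le_def by blast

lemma compact_semialg:
  assumes fin: "finite E" "finite I" and arch: "archimedean c E I"
  shows "compact (semialg c E I)"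
proof -
  obtain N where "Const N - (\<Sum>i\<in>UNIV. Var i ^ 2) \<in> constraint_qm c E I"
    using arch unfolding archimedean_def constraint_qm_def by blast
  from compact_qm_set[OF this] show ?thesis by (simp add: qm_set_constraint_qm fin)
qed

text \<open>On the affine constraints the objective is the Lagrangian plus a constant, so comparing
  values amounts to the sign of the pairing with \<open>f\<close>.\<close>

lemma pairing_lagrangian:
  fixes a :: "nat \<Rightarrow> 'n::finite mpoly" and m :: nat
  assumes "\<And>i. i \<in> {1..m} \<Longrightarrow> pairing (a i) y = b i"
  shows "pairing R y = pairing (R - (\<Sum>i=1..m. Const (lam i) * a i)) y + (\<Sum>i=1..m. b i * lam i)"
proof -
  have "(\<Sum>i=1..m. lam i * pairing (a i) y) = (\<Sum>i=1..m. b i * lam i)"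
    using assms by (intro sum.cong refl) simp
  then show ?thesis by (simp add: pairing_diff pairing_sum pairing_Const_mult)
qed

text \<open>Every value is squeezed to \<open>v\<close>: the atoms attain it in (P) and (P_k),
  \<open>lam\<close> attains it in (D_k), and nonnegativity of \<open>f\<close> on feasible points
  together with optimality in (D) gives the opposite bounds.\<close>

lemma hierarchy_exact_and_flat:
  fixes a :: "nat \<Rightarrow> 'n::{finite,linorder} mpoly"
    and c :: "'l \<Rightarrow> 'n mpoly" and E I :: "'l set" and m d1 :: nat
  defines "K \<equiv> semialg c E I"
  assumes fin: "finite E" "finite I" and disj: "E \<inter> I = {}" and arch: "archimedean c E I"
    and a: "\<And>i. i \<in> {1..m} \<Longrightarrow> a i \<in> polys d1" and R: "R \<in> polys d1"
    and Rpos: "\<And>x. x \<in> K \<Longrightarrow> peval R x > 0"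
    and lam: "maximizer_D m a b d1 K R lam"
    and opt: "\<And>u. is_arg_min (peval (R - (\<Sum>i=1..m. Const (lam i) * a i))) (\<lambda>x. x \<in> K) u \<Longrightarrow>
      opt_conditions (R - (\<Sum>i=1..m. Const (lam i) * a i)) c E I u"
  shows "\<forall>\<^sub>F k in sequentially. is_relax_order c E I d1 k \<longrightarrow>
    phi m a b c E I R k = psi m a b c E I R k \<and> psi m a b c E I R k = phi_star m a b d1 K R \<and>
    (\<forall>w. minimizer_Pk m a b c E I R k w \<longrightarrow> flat_truncation c E I k w)"
proof -
  define M where "M = constraint_qm c E I"
  have M: "quadratic_module M" unfolding M_def by (rule quadratic_module_constraint_qm)
  have KM: "K = qm_set M" by (simp add: K_def M_def qm_set_constraint_qm fin)
  have cK: "compact K" unfolding K_def by (rule compact_semialg[OF fin arch])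
  obtain N where N: "N > 0" "Const N - (\<Sum>i\<in>UNIV. Var i ^ 2) \<in> M"
    using arch unfolding archimedean_def M_def constraint_qm_def by blast
  define L where "L lam = R - (\<Sum>i=1..m. Const (lam i) * a i)" for lam
  define f where "f = L lam"
  define v where "v = (\<Sum>i=1..m. b i * lam i)"
  have Ldeg: "L lam \<in> polys d1" for lam
    unfolding L_def by (intro polys_diff R polys_sum polys_mult_le[OF polys_Const[of _ 0] a]) auto
  have lamD: "lam \<in> feas_D m a d1 K R"
    and lammax: "\<And>lam'. lam' \<in> feas_D m a d1 K R \<Longrightarrow> (\<Sum>i=1..m. b i * lam' i) \<le> v"
    using lam unfolding maximizer_D_def is_arg_max_def v_def by (auto simp: not_less)
  have max: "(\<Sum>i=1..m. b i * lam' i) \<le> v" if "\<And>x. x \<in> K \<Longrightarrow> peval (L lam') x \<ge> 0" for lam'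
    using that Ldeg by (intro lammax) (simp add: feas_D_def nonneg_polys_def L_def)
  have fnn: "peval f x \<ge> 0" if "x \<in> K" for x
    using lamD that by (simp add: f_def L_def feas_D_def nonneg_polys_def)
  have loc: "strict_local_cert M u f" if u: "u \<in> K" "peval f u = 0" for u
    unfolding M_def
  proof (rule opt_conditions_imp_strict_local_cert[OF fin disj])
    have "is_arg_min (peval f) (\<lambda>x. x \<in> K) u"
      using u fnn by (auto simp: is_arg_min_def not_less)
    then show "opt_conditions f c E I u" unfolding f_def L_def by (rule opt)
  qed (use u in \<open>auto simp: K_def\<close>)
  define S where "S = {u \<in> K. peval f u = 0}"
  from nonneg_with_strict_local_certs[OF M N(2,1), folded KM, OF fnn loc, folded S_def]
  obtain T l \<rho> \<gamma> where S: "finite S" and \<gamma>: "\<gamma> > 0"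
    and F: "f - Const \<gamma> * point_gens S T l \<in> M" and \<rho>: "1 - (\<Sum>u\<in>S. l u) = T * \<rho>"
    by blast
  define Q where "Q = point_gens S T l"
  have Q: "Q \<in> M" unfolding Q_def by (intro qm_SOS[OF M] point_gens_SOS)
  \<comment> \<open>Adding the multiple of \<open>Q\<close> back; this certificate makes
    \<open>lam\<close> feasible for (D_k) at large \<open>k\<close>.\<close>
  have fM: "f \<in> M"
    using qm_add[OF M F qm_Const_mult[OF M Q less_imp_le[OF \<gamma>]]] by (simp add: Q_def)
  have "\<exists>wt. (\<forall>u\<in>S. wt u \<ge> 0) \<and> (\<forall>i\<in>{1..m}. b i = (\<Sum>u\<in>S. wt u * peval (a i) u))"
    unfolding S_def f_def L_def
    by (rule optimal_dual_atomic_certificate[OF cK])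
      (use fnn Rpos S max in \<open>auto simp: S_def f_def L_def v_def\<close>)
  then obtain wt where wt: "\<And>u. u \<in> S \<Longrightarrow> wt u \<ge> 0"
    "\<And>i. i \<in> {1..m} \<Longrightarrow> b i = (\<Sum>u\<in>S. wt u * peval (a i) u)" by blast
  have SK: "S \<subseteq> K" by (auto simp: S_def)
  define atoms where "atoms D = restrict (\<lambda>\<alpha>. \<Sum>u\<in>S. wt u * monom_eval \<alpha> u) (expos D)" for D
  have pa: "pairing p (atoms D) = (\<Sum>u\<in>S. wt u * peval p u)" if "p \<in> polys D" for p D
    unfolding atoms_def by (rule pairing_atomic[OF that])
  have Ratoms: "pairing R (atoms D) = v" if "d1 \<le> D" for D
  proof -
    have "pairing (a i) (atoms D) = b i" if "i \<in> {1..m}" for i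
      using pa[OF polys_mono[OF a[OF that] \<open>d1 \<le> D\<close>]] wt(2)[OF that] by simp
    from pairing_lagrangian[OF this, where R = R and lam = lam]
    have "pairing R (atoms D) = pairing f (atoms D) + v" by (simp add: f_def L_def v_def)
    moreover have "pairing f (atoms D) = 0"
      using pa[OF polys_mono[OF Ldeg that], of lam] by (simp add: f_def[symmetric] S_def)
    ultimately show ?thesis by simp
  qed
  have phi_star: "phi_star m a b d1 K R = ereal v"
    unfolding phi_star_def
  proof (rule antisym)
    have "atoms d1 \<in> feas_P m a b d1 K"
      unfolding feas_P_def atoms_def using atomic_in_moment_cone[OF S SK wt(1) compact_imp_closed[OF cK]]
      using a wt(2) by (auto simp: pairing_atomic)
    then show "(INF y\<in>feas_P m a b d1 K. ereal (pairing R y)) \<le> ereal v"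
      by (rule INF_lower2) (simp add: Ratoms)
    show "ereal v \<le> (INF y\<in>feas_P m a b d1 K. ereal (pairing R y))"
    proof (rule INF_greatest)
      fix y assume y: "y \<in> feas_P m a b d1 K"
      have "pairing R y = pairing f y + v"
        using y pairing_lagrangian[of m a y b R lam] by (simp add: feas_P_def f_def L_def v_def)
      moreover have "pairing f y \<ge> 0"
        using y lamD by (intro moment_cone_nonneg[of y d1 K]) (auto simp: feas_P_def feas_D_def f_def L_def)
      ultimately show "ereal v \<le> ereal (pairing R y)" by simp
    qed
  qed
  \<comment> \<open>One multiple of \<open>d_K\<close> beyond the rank bound \<open>card S\<close>,
    as the pigeonhole argument for flatness requires.\<close>
  define t where "t = (card S + 1) * d_K c E I"
  have "\<forall>\<^sub>F k in sequentially. t \<le> k" by (rule eventually_ge_at_top)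
  with constraint_qm_eventually_nonneg[OF fin F[unfolded M_def], of m a b]
    constraint_qm_eventually_nonneg[OF fin Q[unfolded M_def], of m a b]
    constraint_qm_eventually_truncated[OF fin fM[unfolded M_def]]
    atomic_moments_of_kernel[OF S \<rho>, of t]
  show ?thesis
  proof eventually_elim
    case (elim k)
    show ?case
    proof (intro impI)
      assume rel: "is_relax_order c E I d1 k"
      then have d1: "d1 \<le> 2 * k" by (simp add: is_relax_order_def)
      have fw: "pairing R w = pairing f w + v" "pairing f w \<ge> \<gamma> * pairing Q w" "pairing Q w \<ge> 0"
        if w: "w \<in> feas_Pk m a b c E I k" for w
      proof -
        show "pairing R w = pairing f w + v"
          using w pairing_lagrangian[of m a w b R lam] by (simp add: feas_Pk_def f_def L_def v_def)
        have "pairing (f - Const \<gamma> * Q) w \<ge> 0" using elim(1) w by (simp add: Q_def)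
        then show "pairing f w \<ge> \<gamma> * pairing Q w" by (simp add: pairing_diff pairing_Const_mult)
        show "pairing Q w \<ge> 0" using elim(2) w by blast
      qed
      have atoms_feas: "atoms (2 * k) \<in> feas_Pk m a b c E I k"
        unfolding atoms_def using SK rel a wt d1
        by (intro atomic_in_feas_Pk) (auto simp: K_def is_relax_order_def intro: polys_mono)
      have phi: "phi m a b c E I R k = ereal v"
        unfolding phi_def
      proof (rule antisym)
        show "(INF w\<in>feas_Pk m a b c E I k. ereal (pairing R w)) \<le> ereal v"
          by (rule INF_lower2[OF atoms_feas]) (simp add: Ratoms d1)
        show "ereal v \<le> (INF w\<in>feas_Pk m a b c E I k. ereal (pairing R w))"
        proof (rule INF_greatest)
          fix w assume w: "w \<in> feas_Pk m a b c E I k"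
          have "\<gamma> * pairing Q w \<ge> 0" using fw(3)[OF w] \<gamma> by simp
          then show "ereal v \<le> ereal (pairing R w)"
            unfolding ereal_less_eq using fw(1,2)[OF w] by linarith
        qed
      qed
      have psi: "psi m a b c E I R k = ereal v"
        unfolding psi_def
      proof (rule antisym)
        have "lam \<in> feas_Dk m a c E I k R"
          using elim(3) by (simp add: feas_Dk_def f_def L_def)
        then show "ereal v \<le> (SUP lam\<in>feas_Dk m a c E I k R. ereal (\<Sum>i=1..m. b i * lam i))"
          by (rule SUP_upper2) (simp add: v_def)
        show "(SUP lam\<in>feas_Dk m a c E I k R. ereal (\<Sum>i=1..m. b i * lam i)) \<le> ereal v"
        proof (rule SUP_least)
          \<comment> \<open>A truncated certificate implies nonnegativity on \<open>K\<close>, so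
            \<open>lam'\<close> is feasible for (D) and cannot exceed \<open>v\<close>.\<close>
          fix lam' assume "lam' \<in> feas_Dk m a c E I k R"
          then have "L lam' \<in> M"
            unfolding M_def feas_Dk_def L_def by (intro truncated_in_constraint_qm[of _ c E "2 * k"]) simp
          then show "ereal (\<Sum>i=1..m. b i * lam' i) \<le> ereal v"
            unfolding ereal_less_eq by (intro max) (simp add: KM qm_set_def)
        qed
      qed
      have "flat_truncation c E I k w" if w: "minimizer_Pk m a b c E I R k w" for w
      proof -
        have wf: "w \<in> feas_Pk m a b c E I k" and "pairing R w \<le> pairing R (atoms (2 * k))"
          using w atoms_feas unfolding minimizer_Pk_def is_arg_min_def by (auto simp: not_less)
        \<comment> \<open>The atoms already attain \<open>v\<close>, so \<open>f\<close> pairs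
          nonpositively with \<open>w\<close>, and \<gamma> times the pairing with \<open>Q\<close>
          lies below that.\<close>
        then have "pairing f w \<le> 0" using fw(1)[OF wf] by (simp add: Ratoms d1)
        then have "\<gamma> * pairing Q w \<le> 0" using fw(2)[OF wf] by linarith
        then have "pairing Q w \<le> 0" using \<gamma> by (simp add: mult_le_0_iff)
        then have mom: "\<forall>\<alpha>\<in>expos t. \<forall>\<beta>\<in>expos t. w (\<alpha> + \<beta>) = (\<Sum>u\<in>S. monom_eval \<alpha> u * pairing (l u * Mon \<beta>) w)"
          using elim(4) feas_Pk_psd[OF wf] by (simp add: Q_def)
        have "mat_rank (mom_mat t w) \<le> card S"
          by (rule mat_rank_mom_mat_le[OF S, of t w "\<lambda>u \<alpha>. monom_eval \<alpha> u" "\<lambda>u \<beta>. pairing (l u * Mon \<beta>) w"])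
            (use mom in blast)
        then show ?thesis
          using elim(5) by (intro flat_truncation_of_low_rank[of "card S"]) (simp_all add: t_def)
      qed
      with phi psi phi_star show "phi m a b c E I R k = psi m a b c E I R k \<and>
        psi m a b c E I R k = phi_star m a b d1 K R \<and>
        (\<forall>w. minimizer_Pk m a b c E I R k w \<longrightarrow> flat_truncation c E I k w)" by simp
    qed
  qed
qed

text \<open>The exceptional null set depends only on \<open>K\<close> and \<open>d1\<close>, so one
  \<open>R\<close> serves every maximizer \<open>lam\<close>. The bound \<open>d_K < k\<close> in
  the first claim leaves room for the order \<open>k - 1\<close>: at \<open>k = d_K\<close> the only
  candidate is \<open>t = k\<close>, whose matrix is not controlled on the diagonal of top
  degree.\<close>

theorem theorem3p2:
  fixes a :: "nat \<Rightarrow> 'n::{finite,linorder} mpoly"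
    and b :: "nat \<Rightarrow> real"
    and c :: "'l \<Rightarrow> 'n mpoly"
    and E I :: "'l set"
    and d m d1 :: nat
    and K :: "(real ^ 'n::{finite,linorder}) set"
  assumes "d \<ge> 1" and "m \<ge> 1"
    and "\<And>i. i \<in> {1..m} \<Longrightarrow> a i \<in> polys d"
    and "d1 = 2 * ceil_half d"
    and "finite E" and "finite I" and "E \<inter> I = {}"
    and "K = semialg c E I"
    and "feas_P m a b d1 K \<noteq> {}"
    and "archimedean c E I"
  shows "generic_in_SOS_le d1 (\<lambda>R. \<forall>lam. maximizer_D m a b d1 K R lam \<longrightarrow>
     (\<forall>k w. is_relax_order c E I d1 k \<and> d_K c E I < k \<and>
        minimizer_Pk m a b c E I R k w \<and> w 0 = 0 \<longrightarrow> flat_truncation c E I k w) \<and>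
     ((\<forall>u. is_arg_min (peval (R - (\<Sum>i=1..m. Const (lam i) * a i))) (\<lambda>x. x \<in> K) u \<longrightarrow>
          opt_conditions (R - (\<Sum>i=1..m. Const (lam i) * a i)) c E I u) \<longrightarrow>
      (\<exists>k0. \<forall>k\<ge>k0. is_relax_order c E I d1 k \<longrightarrow>
         (\<forall>w. minimizer_Pk m a b c E I R k w \<and> w 0 \<noteq> 0 \<longrightarrow>
            phi m a b c E I R k = psi m a b c E I R k \<and>
            psi m a b c E I R k = phi_star m a b d1 K R \<and>
            (\<forall>w'. minimizer_Pk m a b c E I R k w' \<longrightarrow> flat_truncation c E I k w')))))"
proof (rule generic_in_SOS_le_mono[OF generic_SOS_positive_on_compact[of d1 K]])
  fix R :: "'n mpoly"
  assume R: "R \<in> SOS_le d1" and Rpos: "\<forall>x\<in>K. peval R x > 0"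
  have a: "a i \<in> polys d1" if "i \<in> {1..m}" for i
    using polys_mono[OF assms(3)[OF that], of d1] by (simp add: assms(4) ceil_half_eq)
  show "\<forall>lam. maximizer_D m a b d1 K R lam \<longrightarrow>
     (\<forall>k w. is_relax_order c E I d1 k \<and> d_K c E I < k \<and>
        minimizer_Pk m a b c E I R k w \<and> w 0 = 0 \<longrightarrow> flat_truncation c E I k w) \<and>
     ((\<forall>u. is_arg_min (peval (R - (\<Sum>i=1..m. Const (lam i) * a i))) (\<lambda>x. x \<in> K) u \<longrightarrow>
          opt_conditions (R - (\<Sum>i=1..m. Const (lam i) * a i)) c E I u) \<longrightarrow>
      (\<exists>k0. \<forall>k\<ge>k0. is_relax_order c E I d1 k \<longrightarrow>
         (\<forall>w. minimizer_Pk m a b c E I R k w \<and> w 0 \<noteq> 0 \<longrightarrow>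
            phi m a b c E I R k = psi m a b c E I R k \<and>
            psi m a b c E I R k = phi_star m a b d1 K R \<and>
            (\<forall>w'. minimizer_Pk m a b c E I R k w' \<longrightarrow> flat_truncation c E I k w'))))"
  proof (intro allI impI conjI)
    fix k w
    assume "is_relax_order c E I d1 k \<and> d_K c E I < k \<and> minimizer_Pk m a b c E I R k w \<and> w 0 = 0"
    then show "flat_truncation c E I k w"
      by (intro flat_truncation_zero_moment feas_Pk_psd) (auto simp: minimizer_Pk_def is_arg_min_def)
  next
    fix lam
    assume lam: "maximizer_D m a b d1 K R lam"
      and opt: "\<forall>u. is_arg_min (peval (R - (\<Sum>i=1..m. Const (lam i) * a i))) (\<lambda>x. x \<in> K) u \<longrightarrow>
          opt_conditions (R - (\<Sum>i=1..m. Const (lam i) * a i)) c E I u"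
    have "\<forall>\<^sub>F k in sequentially. is_relax_order c E I d1 k \<longrightarrow>
      phi m a b c E I R k = psi m a b c E I R k \<and> psi m a b c E I R k = phi_star m a b d1 K R \<and>
      (\<forall>w. minimizer_Pk m a b c E I R k w \<longrightarrow> flat_truncation c E I k w)"
      unfolding assms(8)
    proof (rule hierarchy_exact_and_flat[OF assms(5-7,10) a])
      show "R \<in> polys d1" using R by (simp add: SOS_le_def)
    qed (use Rpos lam opt assms(8) in auto)
    then show "\<exists>k0. \<forall>k\<ge>k0. is_relax_order c E I d1 k \<longrightarrow>
         (\<forall>w. minimizer_Pk m a b c E I R k w \<and> w 0 \<noteq> 0 \<longrightarrow>
            phi m a b c E I R k = psi m a b c E I R k \<and>
            psi m a b c E I R k = phi_star m a b d1 K R \<and>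
            (\<forall>w'. minimizer_Pk m a b c E I R k w' \<longrightarrow> flat_truncation c E I k w'))"
      unfolding eventually_sequentially by blast
  qed
qed

end
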